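(* Let $(M,\eta,\xi,g,\Phi)$ be a compact, connected Sasakian $7$-manifold, $E\to M$ a Sasakian vector bundle with adjoint bundle $\mathfrak g_E$, and $\nabla\in\mathcal A(E)$ a connection with curvature $F_\nabla$. Let $\varphi\in\Omega^{2,0}(\mathfrak g_E)$ be written in transverse holomorphic coordinates as $\varphi=\frac12\sum_{\gamma,\tau}\varphi_{\gamma\tau}\,dz^\gamma\wedge dz^\tau$, with $\varphi_{\gamma\tau}=-\varphi_{\tau\gamma}$ $\mathfrak g\otimes\mathbb C$-valued functions, and write $\Delta_{\partial_\nabla}\varphi=\frac12\sum_{\mu,\nu}(\Delta_{\partial_\nabla}\varphi)_{\mu\nu}\,dz^\mu\wedge dz^\nu$, where $\Delta_{\partial_\nabla}=\partial_\nabla\partial_\nabla^*+\partial_\nabla^*\partial_\nabla$. Then $$(\Delta_{\partial_\nabla}\varphi)_{\mu\nu}=-\sum_{\alpha,\beta}g^{\alpha\bar\beta}\,\widetilde\nabla_{\bar\beta}\widetilde\nabla_{\alpha}\varphi_{\mu\nu}-(\mathcal F\varphi)_{\mu\nu}-(\mathcal R\varphi)_{\mu\nu},$$ where $$(\mathcal F\varphi)_{\mu\nu}=\sum_{\alpha,\beta}g^{\alpha\bar\beta}\big([\varphi_{\alpha\nu},F_{\mu\bar\beta}]-[\varphi_{\alpha\mu},F_{\nu\bar\beta}]\big),\qquad (\mathcal R\varphi)_{\mu\nu}=\sum_{\alpha,\beta}g^{\alpha\bar\beta}\big(R_{\bar\beta\mu}\varphi_{\alpha\nu}-R_{\bar\beta\nu}\varphi_{\alpha\mu}\big)$$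 are the components of endomorphisms $\mathcal F$ and $\mathcal R$ of $\Omega^{2,0}(\mathfrak g_E)$, depending respectively on the curvature $F_\nabla$ and on the transverse Ricci curvature $R_{\bar\alpha\beta}=\sum_{\mu,\nu} g^{\mu\bar\nu}R_{\bar\nu\mu\bar\alpha\beta}$.
   Context: Sasakian setting. $M$ is a Sasakian manifold with contact form $\eta$, Reeb field $\xi$, metric $g$ and $\Phi\in\mathrm{End}(TM)$; $H=\ker\eta$, $TM=H\oplus\mathbb R\xi$, and $\Phi|_H^2=-1$ gives $H\otimes\mathbb C=H^{1,0}\oplus H^{0,1}$. The Reeb foliation is transversely Kähler: there are foliated charts $(z^1,z^2,z^3,x)$ ($z$ transverse holomorphic coordinates, $\xi=\partial_x$), whose coordinate changes are holomorphic in $z$ and independent of $x$; the transverse metric $g^T=g|_H$ has components $g_{\alpha\bar\beta}$ with inverse $g^{\alpha\bar\beta}$. Forms are computed in these transverse coordinates, with coefficients not depending on the Reeb coordinate $x$. Bundle. $G$ is a compact semisimple Lie group with Lie algebra $\mathfrak g$; $E\to M$ is a complex vector $G$-bundle which is Sasakian, i.e. equipped with a partial connection along $\xi$ (so that it is a foliated bundle for the Reeb foliation); $\mathcal A(E)$ is the space of $G$-connections (compatible with this structure); $\mathfrak g_E\subset\mathrm{End}(E)$ is the adjoint bundle. $\Omega^{p,q}(\mathfrak g_E)$ denotes sections of $\Lambda^p(H^{1,0})^*\otimes\Lambda^q(H^{0,1})^*\otimes\mathfrak g_E$. Conventions. With connection matrix $A$, $\nabla$ acts on $\mathfrak g_E$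 by $\nabla_i\phi=\partial_i\phi+[\phi,A_i]$, and $F_{ij}=\partial_iA_j-\partial_jA_i-[A_i,A_j]$, so that $[\nabla_i,\nabla_j]\phi=[\phi,F_{ij}]$. $D$ is the (transverse) Levi-Civita connection, and $\widetilde\nabla$ is the tensor product of $D$ (on the form part) and $\nabla$ (on $\mathfrak g_E$). The curvature components of $D$ are normalised by $[D_\mu,D_{\bar\beta}]\varphi_{\alpha\nu}=\sum_\epsilon (R^\epsilon_{\mu\bar\beta\alpha}\varphi_{\epsilon\nu}+R^\epsilon_{\mu\bar\beta\nu}\varphi_{\alpha\epsilon})$ and $R^\epsilon_{\mu\bar\beta\alpha}=\sum_\tau g^{\epsilon\bar\tau}R_{\bar\tau\mu\bar\beta\alpha}$. Operators. $\partial_\nabla$ is the $(1,0)$ part of the exterior covariant derivative on transverse forms and $\partial_\nabla^*$ its formal adjoint. In components (with $\varphi=\frac1{p!}\sum\varphi_{\mu_1\dots\mu_p}dz^{\mu_1}\wedge\dots\wedge dz^{\mu_p}$): on $\Omega^{1,0}$, $(\partial_\nabla\varphi)_{\mu\nu}=\widetilde\nabla_\mu\varphi_\nu-\widetilde\nabla_\nu\varphi_\mu$; on $\Omega^{2,0}$, $(\partial_\nabla\varphi)_{\mu\nu\sigma}=\widetilde\nabla_\mu\varphi_{\nu\sigma}+\widetilde\nabla_\nu\varphi_{\sigma\mu}+\widetilde\nabla_\sigma\varphi_{\mu\nu}$ and $(\partial_\nabla^*\varphi)_\mu=-\sum_{\nu,\tau} g^{\nu\bar\tau}\widetilde\nabla_{\bar\tau}\varphi_{\nu\mu}$;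 on $\Omega^{3,0}$, $(\partial_\nabla^*\varphi)_{\mu\nu}=-\sum_{\sigma,\tau} g^{\sigma\bar\tau}\widetilde\nabla_{\bar\tau}\varphi_{\sigma\mu\nu}$. *)

theory Defs
  imports "HOL-Analysis.Analysis"
begin

section \<open>Smooth maps and smooth 7-manifolds\<close>

primrec C_k_on :: "nat \<Rightarrow> 'a::real_normed_vector set \<Rightarrow> ('a \<Rightarrow> 'b::real_normed_vector) \<Rightarrow> bool" where
  "C_k_on 0 S f = continuous_on S f"
| "C_k_on (Suc k) S f =
    ((\<forall>x\<in>S. f differentiable (at x)) \<and> (\<forall>v. C_k_on k S (\<lambda>x. frechet_derivative f (at x) v)))"

text \<open>Only used for open \<open>S\<close>.\<close>

definition smooth_on :: "'a::real_normed_vector set \<Rightarrow> ('a \<Rightarrow> 'b::real_normed_vector) \<Rightarrow> bool" where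
  "smooth_on S f \<longleftrightarrow> (\<forall>k. C_k_on k S f)"

text \<open>The model space is \<open>\<complex>\<^sup>3 \<times> \<real> = \<real>\<^sup>7\<close>; a general chart uses only its real structure, a
  foliated chart has the values \<open>(z\<^sup>1, z\<^sup>2, z\<^sup>3, x)\<close>. A chart is its domain together with a map of
  which only the values on the domain matter.\<close>

type_synonym coords = "(complex^3) \<times> real"
type_synonym 'm chart = "'m set \<times> ('m \<Rightarrow> coords)"

definition chart_inv :: "'m chart \<Rightarrow> coords \<Rightarrow> 'm" where
  "chart_inv c = inv_into (fst c) (snd c)"

definition change :: "'m chart \<Rightarrow> 'm chart \<Rightarrow> coords \<Rightarrow> coords" where
  "change c c' = snd c' \<circ> chart_inv c"

definition dchange :: "'m chart \<Rightarrow> 'm chart \<Rightarrow> coords \<Rightarrow> coords \<Rightarrow> coords" where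
  "dchange c c' p = frechet_derivative (change c c') (at p)"

definition is_chart :: "'m::topological_space chart \<Rightarrow> bool" where
  "is_chart c \<longleftrightarrow> open (fst c) \<and> open (snd c ` fst c)
     \<and> (\<exists>k. homeomorphism (fst c) (snd c ` fst c) (snd c) k)"

definition charts_compatible :: "'m chart \<Rightarrow> 'm chart \<Rightarrow> bool" where
  "charts_compatible c c' \<longleftrightarrow>
     smooth_on (snd c ` (fst c \<inter> fst c')) (change c c') \<and>
     smooth_on (snd c' ` (fst c \<inter> fst c')) (change c' c)"

definition smooth_atlas :: "'m::topological_space chart set \<Rightarrow> bool" where
  "smooth_atlas \<A> \<longleftrightarrow>
     (\<forall>c\<in>\<A>. is_chart c) \<and> (\<Union>c\<in>\<A>. fst c) = UNIV \<and>
     (\<forall>c\<in>\<A>. \<forall>c'\<in>\<A>. charts_compatible c c') \<and>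
     (\<forall>c. is_chart c \<and> (\<forall>c'\<in>\<A>. charts_compatible c c') \<longrightarrow> c \<in> \<A>)"

section \<open>Tensor fields, given by their representatives in all charts\<close>

definition one_form_on ::
  "'m chart set \<Rightarrow> 'm set \<Rightarrow> ('m chart \<Rightarrow> coords \<Rightarrow> coords \<Rightarrow> 'v::real_normed_vector) \<Rightarrow> bool" where
  "one_form_on \<A> W \<theta> \<longleftrightarrow>
     (\<forall>c\<in>\<A>. \<forall>p \<in> snd c ` (fst c \<inter> W). linear (\<theta> c p)) \<and>
     (\<forall>c\<in>\<A>. \<forall>v. smooth_on (snd c ` (fst c \<inter> W)) (\<lambda>p. \<theta> c p v)) \<and>
     (\<forall>c\<in>\<A>. \<forall>c'\<in>\<A>. \<forall>p \<in> snd c ` (fst c \<inter> fst c' \<inter> W). \<forall>v.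
        \<theta> c p v = \<theta> c' (change c c' p) (dchange c c' p v))"

definition vector_field :: "'m chart set \<Rightarrow> ('m chart \<Rightarrow> coords \<Rightarrow> coords) \<Rightarrow> bool" where
  "vector_field \<A> X \<longleftrightarrow>
     (\<forall>c\<in>\<A>. smooth_on (snd c ` fst c) (X c)) \<and>
     (\<forall>c\<in>\<A>. \<forall>c'\<in>\<A>. \<forall>p \<in> snd c ` (fst c \<inter> fst c').
        X c' (change c c' p) = dchange c c' p (X c p))"

definition endomorphism_field ::
  "'m chart set \<Rightarrow> ('m chart \<Rightarrow> coords \<Rightarrow> coords \<Rightarrow> coords) \<Rightarrow> bool" where
  "endomorphism_field \<A> \<Phi> \<longleftrightarrow>
     (\<forall>c\<in>\<A>. \<forall>p \<in> snd c ` fst c. linear (\<Phi> c p)) \<and>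
     (\<forall>c\<in>\<A>. \<forall>v. smooth_on (snd c ` fst c) (\<lambda>p. \<Phi> c p v)) \<and>
     (\<forall>c\<in>\<A>. \<forall>c'\<in>\<A>. \<forall>p \<in> snd c ` (fst c \<inter> fst c'). \<forall>v.
        \<Phi> c' (change c c' p) (dchange c c' p v) = dchange c c' p (\<Phi> c p v))"

definition riemannian_metric ::
  "'m chart set \<Rightarrow> ('m chart \<Rightarrow> coords \<Rightarrow> coords \<Rightarrow> coords \<Rightarrow> real) \<Rightarrow> bool" where
  "riemannian_metric \<A> g \<longleftrightarrow>
     (\<forall>c\<in>\<A>. \<forall>p \<in> snd c ` fst c. bilinear (g c p) \<and>
        (\<forall>v w. g c p v w = g c p w v) \<and> (\<forall>v. v \<noteq> 0 \<longrightarrow> g c p v v > 0)) \<and>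
     (\<forall>c\<in>\<A>. \<forall>v w. smooth_on (snd c ` fst c) (\<lambda>p. g c p v w)) \<and>
     (\<forall>c\<in>\<A>. \<forall>c'\<in>\<A>. \<forall>p \<in> snd c ` (fst c \<inter> fst c'). \<forall>v w.
        g c p v w = g c' (change c c' p) (dchange c c' p v) (dchange c c' p w))"

text \<open>\<open>d\<theta>(X, Y) = X \<theta>(Y) - Y \<theta>(X) - \<theta>([X, Y])\<close>, without a factor \<open>1/2\<close>.\<close>

definition ext_d :: "(coords \<Rightarrow> coords \<Rightarrow> real) \<Rightarrow> coords \<Rightarrow> coords \<Rightarrow> coords \<Rightarrow> real" where
  "ext_d \<theta> p v w = frechet_derivative (\<lambda>q. \<theta> q w) (at p) v - frechet_derivative (\<lambda>q. \<theta> q v) (at p) w"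

definition lie_bracket :: "(coords \<Rightarrow> coords) \<Rightarrow> (coords \<Rightarrow> coords) \<Rightarrow> coords \<Rightarrow> coords" where
  "lie_bracket X Y p = frechet_derivative Y (at p) (X p) - frechet_derivative X (at p) (Y p)"

definition nijenhuis ::
  "(coords \<Rightarrow> coords \<Rightarrow> coords) \<Rightarrow> (coords \<Rightarrow> coords) \<Rightarrow> (coords \<Rightarrow> coords) \<Rightarrow> coords \<Rightarrow> coords" where
  "nijenhuis \<Phi> X Y p =
     \<Phi> p (\<Phi> p (lie_bracket X Y p)) + lie_bracket (\<lambda>q. \<Phi> q (X q)) (\<lambda>q. \<Phi> q (Y q)) p
     - \<Phi> p (lie_bracket (\<lambda>q. \<Phi> q (X q)) Y p) - \<Phi> p (lie_bracket X (\<lambda>q. \<Phi> q (Y q)) p)"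

section \<open>Sasakian 7-manifolds\<close>

record 'm sasakian_data =
  atlas :: "'m chart set"
  eta :: "'m chart \<Rightarrow> coords \<Rightarrow> coords \<Rightarrow> real"
  xi :: "'m chart \<Rightarrow> coords \<Rightarrow> coords"
  met :: "'m chart \<Rightarrow> coords \<Rightarrow> coords \<Rightarrow> coords \<Rightarrow> real"
  Phi :: "'m chart \<Rightarrow> coords \<Rightarrow> coords \<Rightarrow> coords"

text \<open>A Sasakian structure is a normal contact metric structure. The contact condition
  \<open>\<eta> \<and> (d\<eta>)\<^sup>3 \<noteq> 0\<close> is nondegeneracy of \<open>d\<eta>\<close> on \<open>ker \<eta>\<close>. With the convention for \<open>d\<close> above, the
  contact metric condition is \<open>d\<eta>(X, Y) = 2 g(X, \<Phi> Y)\<close> and normality is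
  \<open>N\<^sub>\<Phi> + d\<eta> \<otimes> \<xi> = 0\<close>; by tensoriality the latter is tested on constant fields.\<close>

definition contact_form_with_reeb :: "'m sasakian_data \<Rightarrow> bool" where
  "contact_form_with_reeb M \<longleftrightarrow>
     one_form_on (atlas M) UNIV (eta M) \<and> vector_field (atlas M) (xi M) \<and>
     (\<forall>c\<in>atlas M. \<forall>p \<in> snd c ` fst c.
        (\<forall>v. eta M c p v = 0 \<and> v \<noteq> 0 \<longrightarrow> (\<exists>w. eta M c p w = 0 \<and> ext_d (eta M c) p v w \<noteq> 0)) \<and>
        eta M c p (xi M c p) = 1 \<and> (\<forall>v. ext_d (eta M c) p (xi M c p) v = 0))"

definition contact_metric :: "'m sasakian_data \<Rightarrow> bool" where
  "contact_metric M \<longleftrightarrow>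
     contact_form_with_reeb M \<and> riemannian_metric (atlas M) (met M) \<and>
     endomorphism_field (atlas M) (Phi M) \<and>
     (\<forall>c\<in>atlas M. \<forall>p \<in> snd c ` fst c. \<forall>v w.
        Phi M c p (Phi M c p v) = - v + eta M c p v *\<^sub>R xi M c p \<and>
        met M c p (Phi M c p v) (Phi M c p w) = met M c p v w - eta M c p v * eta M c p w \<and>
        ext_d (eta M c) p v w = 2 * met M c p v (Phi M c p w))"

definition sasakian :: "'m::topological_space sasakian_data \<Rightarrow> bool" where
  "sasakian M \<longleftrightarrow>
     smooth_atlas (atlas M) \<and> contact_metric M \<and>
     (\<forall>c\<in>atlas M. \<forall>p \<in> snd c ` fst c. \<forall>v w.
        nijenhuis (Phi M c) (\<lambda>_. v) (\<lambda>_. w) p + ext_d (eta M c) p v w *\<^sub>R xi M c p = 0)"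

text \<open>Foliated charts \<open>(z, x)\<close>: \<open>\<xi> = \<partial>\<^sub>x\<close>, and \<open>dz\<^sup>\<alpha> \<circ> \<Phi> = \<i> dz\<^sup>\<alpha>\<close>, that is, the \<open>z\<^sup>\<alpha>\<close> are
  transverse holomorphic coordinates: \<open>dz\<^sup>\<alpha>\<close> kills \<open>\<xi>\<close> and the \<open>-\<i>\<close>-eigenspace \<open>H\<^sup>0\<^sup>,\<^sup>1\<close> of \<open>\<Phi>\<close>.
  On a Sasakian manifold such charts cover the manifold, and coordinate changes between them are
  holomorphic in \<open>z\<close> with \<open>z'\<close> independent of \<open>x\<close>.\<close>

definition foliated_charts :: "'m sasakian_data \<Rightarrow> 'm chart set" where
  "foliated_charts M = {c \<in> atlas M. \<forall>p \<in> snd c ` fst c.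
     xi M c p = (0, 1) \<and> (\<forall>v. fst (Phi M c p v) = \<i> *s fst v)}"

section \<open>Complexified transverse coordinate indices\<close>

text \<open>\<open>Hol \<alpha>\<close> is the index \<open>\<alpha>\<close> and \<open>Bar \<alpha>\<close> is the index \<open>\<alpha>\<close>-bar. For a real-linear \<open>L\<close>,
  \<open>cext L A\<close> is the value of its complex-linear extension on
  \<open>\<partial>\<^sub>\<alpha> = (\<partial>/\<partial>Re z\<^sup>\<alpha> - \<i> \<partial>/\<partial>Im z\<^sup>\<alpha>) / 2\<close>, respectively on the conjugate of this vector.\<close>

type_synonym cidx = "3 + 3"
abbreviation Hol :: "3 \<Rightarrow> cidx" where "Hol \<equiv> Inl"
abbreviation Bar :: "3 \<Rightarrow> cidx" where "Bar \<equiv> Inr"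

definition cext :: "(coords \<Rightarrow> complex) \<Rightarrow> cidx \<Rightarrow> complex" where
  "cext L A = (case A of
      Inl \<alpha> \<Rightarrow> (L (axis \<alpha> 1, 0) - \<i> * L (axis \<alpha> \<i>, 0)) / 2
    | Inr \<alpha> \<Rightarrow> (L (axis \<alpha> 1, 0) + \<i> * L (axis \<alpha> \<i>, 0)) / 2)"

definition cpartial :: "cidx \<Rightarrow> (coords \<Rightarrow> complex) \<Rightarrow> coords \<Rightarrow> complex" where
  "cpartial A f p = cext (frechet_derivative f (at p)) A"

type_synonym 'r mat = "complex^'r^'r"

definition cextM :: "(coords \<Rightarrow> 'r::finite mat) \<Rightarrow> cidx \<Rightarrow> 'r mat" where
  "cextM L A = (\<chi> i j. cext (\<lambda>v. L v $ i $ j) A)"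

definition cpartialM :: "cidx \<Rightarrow> (coords \<Rightarrow> 'r::finite mat) \<Rightarrow> coords \<Rightarrow> 'r mat" where
  "cpartialM A T p = cextM (frechet_derivative T (at p)) A"

definition cscale :: "complex \<Rightarrow> 'r::finite mat \<Rightarrow> 'r mat" where
  "cscale a X = (\<chi> i j. a * X $ i $ j)"

definition comm :: "'r::finite mat \<Rightarrow> 'r mat \<Rightarrow> 'r mat" where
  "comm X Y = X ** Y - Y ** X"

section \<open>Transverse metric, Levi-Civita connection and curvature\<close>

definition horizontal :: "'m sasakian_data \<Rightarrow> 'm chart \<Rightarrow> coords \<Rightarrow> coords \<Rightarrow> coords" where
  "horizontal M c p v = v - eta M c p v *\<^sub>R xi M c p"

text \<open>The components of \<open>g|\<^sub>H\<close> (extended complex bilinearly), where a transverse coordinate vector is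
  identified with its horizontal lift. \<open>gup M c p A B\<close> is the inverse, so that
  \<open>\<Sum>\<^sub>\<beta> gup (Hol \<alpha>) (Bar \<beta>) gdn (Hol \<gamma>) (Bar \<beta>) = \<delta>\<^sub>\<alpha>\<^sub>\<gamma>\<close>. The metric, and every coefficient below,
  is kept as a function of \<open>p = (z, x)\<close>; on a foliated chart it is locally constant in \<open>x\<close>.\<close>

definition gdn :: "'m sasakian_data \<Rightarrow> 'm chart \<Rightarrow> coords \<Rightarrow> cidx \<Rightarrow> cidx \<Rightarrow> complex" where
  "gdn M c p A B =
     cext (\<lambda>v. cext (\<lambda>w. complex_of_real
        (met M c p (horizontal M c p v) (horizontal M c p w))) B) A"

definition gup :: "'m sasakian_data \<Rightarrow> 'm chart \<Rightarrow> coords \<Rightarrow> cidx \<Rightarrow> cidx \<Rightarrow> complex" where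
  "gup M c p A B = matrix_inv (\<chi> A' B'. gdn M c p A' B') $ A $ B"

definition christoffel ::
  "'m sasakian_data \<Rightarrow> 'm chart \<Rightarrow> cidx \<Rightarrow> cidx \<Rightarrow> cidx \<Rightarrow> coords \<Rightarrow> complex" where
  "christoffel M c E A B p = (\<Sum>C\<in>UNIV. gup M c p E C *
     (cpartial A (\<lambda>q. gdn M c q B C) p + cpartial B (\<lambda>q. gdn M c q A C) p
      - cpartial C (\<lambda>q. gdn M c q A B) p)) / 2"

text \<open>\<open>curv M c E A B C\<close> is \<open>R\<^sup>E\<^sub>A\<^sub>B\<^sub>C\<close>, normalised by \<open>[D\<^sub>A, D\<^sub>B] \<phi>\<^sub>C = \<Sum>\<^sub>E R\<^sup>E\<^sub>A\<^sub>B\<^sub>C \<phi>\<^sub>E\<close> on covectors,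
  where \<open>D\<^sub>A \<phi>\<^sub>C = \<partial>\<^sub>A \<phi>\<^sub>C - \<Sum>\<^sub>E \<Gamma>\<^sup>E\<^sub>A\<^sub>C \<phi>\<^sub>E\<close>.\<close>

definition curv ::
  "'m sasakian_data \<Rightarrow> 'm chart \<Rightarrow> cidx \<Rightarrow> cidx \<Rightarrow> cidx \<Rightarrow> cidx \<Rightarrow> coords \<Rightarrow> complex" where
  "curv M c E A B C p =
     cpartial B (christoffel M c E A C) p - cpartial A (christoffel M c E B C) p
     + (\<Sum>K\<in>UNIV. christoffel M c K A C p * christoffel M c E B K p
                - christoffel M c K B C p * christoffel M c E A K p)"

text \<open>\<open>curv_low \<tau> \<mu> \<beta> \<alpha>\<close> is \<open>R\<close> with indices \<open>\<tau>\<close>-bar, \<open>\<mu>\<close>, \<open>\<beta>\<close>-bar, \<open>\<alpha>\<close> (so that raising the first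
  index returns \<open>R\<^sup>\<epsilon>\<close> with indices \<open>\<mu>\<close>, \<open>\<beta>\<close>-bar, \<open>\<alpha>\<close>), and \<open>ricci \<alpha> \<beta>\<close> is \<open>R\<close> with indices \<open>\<alpha>\<close>-bar, \<open>\<beta>\<close>.\<close>

definition curv_low ::
  "'m sasakian_data \<Rightarrow> 'm chart \<Rightarrow> 3 \<Rightarrow> 3 \<Rightarrow> 3 \<Rightarrow> 3 \<Rightarrow> coords \<Rightarrow> complex" where
  "curv_low M c \<tau> \<mu> \<beta> \<alpha> p =
     (\<Sum>\<epsilon>\<in>UNIV. gdn M c p (Hol \<epsilon>) (Bar \<tau>) * curv M c (Hol \<epsilon>) (Hol \<mu>) (Bar \<beta>) (Hol \<alpha>) p)"

definition ricci :: "'m sasakian_data \<Rightarrow> 'm chart \<Rightarrow> 3 \<Rightarrow> 3 \<Rightarrow> coords \<Rightarrow> complex" where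
  "ricci M c \<alpha> \<beta> p =
     (\<Sum>\<mu>\<in>UNIV. \<Sum>\<nu>\<in>UNIV. gup M c p (Hol \<mu>) (Bar \<nu>) * curv_low M c \<nu> \<mu> \<alpha> \<beta> p)"

section \<open>Structure groups\<close>

text \<open>The structure group enters through its image in \<open>GL(r, \<complex>)\<close>, a compact matrix group.\<close>

definition compact_matrix_group :: "'r::finite mat set \<Rightarrow> bool" where
  "compact_matrix_group G \<longleftrightarrow> compact G \<and> mat 1 \<in> G \<and>
     (\<forall>X\<in>G. \<forall>Y\<in>G. X ** Y \<in> G) \<and> (\<forall>X\<in>G. invertible X \<and> matrix_inv X \<in> G)"

definition lie_algebra :: "'r::finite mat set \<Rightarrow> 'r mat set" where
  "lie_algebra G = {X. \<exists>\<gamma>::real \<Rightarrow> 'r mat. smooth_on UNIV \<gamma> \<and> range \<gamma> \<subseteq> G \<and> \<gamma> 0 = mat 1 \<and>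
     (\<gamma> has_vector_derivative X) (at 0)}"

text \<open>Semisimple: every abelian ideal of the Lie algebra vanishes.\<close>

definition semisimple_group :: "'r::finite mat set \<Rightarrow> bool" where
  "semisimple_group G \<longleftrightarrow>
     (\<forall>I. subspace I \<and> I \<subseteq> lie_algebra G \<and> (\<forall>X\<in>lie_algebra G. \<forall>Y\<in>I. comm X Y \<in> I) \<and>
          (\<forall>X\<in>I. \<forall>Y\<in>I. comm X Y = 0) \<longrightarrow> I \<subseteq> {0})"

text \<open>The complexification of the Lie algebra \<open>\<gg>\<close>, realised as \<open>\<gg> + \<i> \<gg>\<close>; the sum is direct because a
  compact group is conjugate into the unitary group.\<close>

definition complex_lie_algebra :: "'r::finite mat set \<Rightarrow> 'r mat set" where
  "complex_lie_algebra G = {X + cscale \<i> Y | X Y. X \<in> lie_algebra G \<and> Y \<in> lie_algebra G}"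

section \<open>Sasakian vector bundles and connections\<close>

text \<open>A local trivialisation over \<open>V\<close> is \<open>V\<close> with the fibre component \<open>\<theta>\<close> of
  \<open>e \<mapsto> (\<pi> e, \<theta> e)\<close>. The maximal family of \<open>G\<close>-trivialisations determines the topology, the smooth
  structure and the linear structure on the fibres of the total space.\<close>

type_synonym ('m, 'e, 'r) triv = "'m set \<times> ('e \<Rightarrow> complex^'r)"

definition is_triv :: "('e \<Rightarrow> 'm::topological_space) \<Rightarrow> ('m, 'e, 'r::finite) triv \<Rightarrow> bool" where
  "is_triv pr b \<longleftrightarrow> open (fst b) \<and>
     bij_betw (\<lambda>e. (pr e, snd b e)) (pr -` fst b) (fst b \<times> UNIV)"

text \<open>\<open>transition pr b b' m\<close> is the matrix \<open>t\<close> with \<open>\<theta>' = t \<theta>\<close> on the fibre over \<open>m\<close>.\<close>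

definition transition ::
  "('e \<Rightarrow> 'm) \<Rightarrow> ('m, 'e, 'r::finite) triv \<Rightarrow> ('m, 'e, 'r) triv \<Rightarrow> 'm \<Rightarrow> 'r mat" where
  "transition pr b b' m =
     matrix (\<lambda>u. snd b' (inv_into (pr -` fst b) (\<lambda>e. (pr e, snd b e)) (m, u)))"

definition triv_compatible ::
  "'m chart set \<Rightarrow> 'r::finite mat set \<Rightarrow> ('e \<Rightarrow> 'm) \<Rightarrow> ('m, 'e, 'r) triv \<Rightarrow> ('m, 'e, 'r) triv \<Rightarrow> bool" where
  "triv_compatible \<A> G pr b b' \<longleftrightarrow>
     (\<forall>m \<in> fst b \<inter> fst b'. transition pr b b' m \<in> G) \<and>
     (\<forall>e \<in> pr -` (fst b \<inter> fst b'). snd b' e = transition pr b b' (pr e) *v snd b e) \<and>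
     (\<forall>c\<in>\<A>. smooth_on (snd c ` (fst c \<inter> fst b \<inter> fst b')) (transition pr b b' \<circ> chart_inv c))"

definition G_vector_bundle ::
  "'m::topological_space chart set \<Rightarrow> 'r::finite mat set \<Rightarrow> ('e \<Rightarrow> 'm) \<Rightarrow> ('m, 'e, 'r) triv set \<Rightarrow> bool" where
  "G_vector_bundle \<A> G pr \<B> \<longleftrightarrow>
     (\<forall>b\<in>\<B>. is_triv pr b) \<and> (\<Union>b\<in>\<B>. fst b) = UNIV \<and>
     (\<forall>b\<in>\<B>. \<forall>b'\<in>\<B>. triv_compatible \<A> G pr b b') \<and>
     (\<forall>b. is_triv pr b \<and>
        (\<forall>b'\<in>\<B>. triv_compatible \<A> G pr b b' \<and> triv_compatible \<A> G pr b' b) \<longrightarrow> b \<in> \<B>)"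

record ('m, 'e, 'r::finite) bundle_data =
  grp :: "'r mat set"
  proj :: "'e \<Rightarrow> 'm"
  trivs :: "('m, 'e, 'r) triv set"
  pconn :: "('m, 'e, 'r) triv \<Rightarrow> 'm \<Rightarrow> 'r mat"

text \<open>In a trivialisation the partial connection along \<open>\<xi>\<close> is \<open>s \<mapsto> \<xi> s - a s\<close> with \<open>a = pconn B b\<close>.
  Under \<open>s' = t s\<close> this gives \<open>a' = t a t\<^sup>-\<^sup>1 + (\<xi> t) t\<^sup>-\<^sup>1\<close>. The sign is the one for which
  \<open>\<nabla> \<phi> = d\<phi> + [\<phi>, A]\<close> on \<open>End(E)\<close> is induced by \<open>\<nabla> s = ds - A s\<close>.\<close>

definition partial_connection :: "'m sasakian_data \<Rightarrow> ('m, 'e, 'r::finite) bundle_data \<Rightarrow> bool" where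
  "partial_connection M B \<longleftrightarrow>
     (\<forall>b\<in>trivs B. \<forall>m\<in>fst b. pconn B b m \<in> lie_algebra (grp B)) \<and>
     (\<forall>b\<in>trivs B. \<forall>c\<in>atlas M. smooth_on (snd c ` (fst c \<inter> fst b)) (pconn B b \<circ> chart_inv c)) \<and>
     (\<forall>b\<in>trivs B. \<forall>b'\<in>trivs B. \<forall>c\<in>atlas M. \<forall>m \<in> fst c \<inter> fst b \<inter> fst b'.
        let t = transition (proj B) b b' in
        pconn B b' m = t m ** pconn B b m ** matrix_inv (t m)
          + frechet_derivative (t \<circ> chart_inv c) (at (snd c m)) (xi M c (snd c m)) ** matrix_inv (t m))"

definition sasakian_bundle ::
  "'m::topological_space sasakian_data \<Rightarrow> ('m, 'e, 'r::finite) bundle_data \<Rightarrow> bool" where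
  "sasakian_bundle M B \<longleftrightarrow>
     compact_matrix_group (grp B) \<and> semisimple_group (grp B) \<and>
     G_vector_bundle (atlas M) (grp B) (proj B) (trivs B) \<and> partial_connection M B"

text \<open>Foliated trivialisations are given by frames that are parallel along \<open>\<xi>\<close>.\<close>

definition foliated_trivs :: "('m, 'e, 'r::finite) bundle_data \<Rightarrow> ('m, 'e, 'r) triv set" where
  "foliated_trivs B = {b \<in> trivs B. \<forall>m\<in>fst b. pconn B b m = 0}"

definition basic_on :: "coords set \<Rightarrow> (coords \<Rightarrow> 'v::real_normed_vector) \<Rightarrow> bool" where
  "basic_on S f \<longleftrightarrow> (\<forall>p\<in>S. frechet_derivative f (at p) (0, 1) = 0)"

text \<open>The \<open>G\<close>-connections on \<open>E\<close> which extend the partial connection and whose connection matrices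
  in foliated charts and frames do not depend on the Reeb coordinate.\<close>

definition connections ::
  "'m sasakian_data \<Rightarrow> ('m, 'e, 'r::finite) bundle_data \<Rightarrow>
   (('m, 'e, 'r) triv \<Rightarrow> 'm chart \<Rightarrow> coords \<Rightarrow> coords \<Rightarrow> 'r mat) set" where
  "connections M B = {\<omega>.
     (\<forall>b\<in>trivs B. one_form_on (atlas M) (fst b) (\<omega> b)) \<and>
     (\<forall>b\<in>trivs B. \<forall>c\<in>atlas M. \<forall>m \<in> fst c \<inter> fst b.
        (\<forall>v. \<omega> b c (snd c m) v \<in> lie_algebra (grp B)) \<and>
        \<omega> b c (snd c m) (xi M c (snd c m)) = pconn B b m) \<and>
     (\<forall>b\<in>trivs B. \<forall>b'\<in>trivs B. \<forall>c\<in>atlas M. \<forall>m \<in> fst c \<inter> fst b \<inter> fst b'. \<forall>v.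
        let t = transition (proj B) b b' in
        \<omega> b' c (snd c m) v = t m ** \<omega> b c (snd c m) v ** matrix_inv (t m)
          + frechet_derivative (t \<circ> chart_inv c) (at (snd c m)) v ** matrix_inv (t m)) \<and>
     (\<forall>b\<in>foliated_trivs B. \<forall>c\<in>foliated_charts M. \<forall>v.
        basic_on (snd c ` (fst c \<inter> fst b)) (\<lambda>p. \<omega> b c p v))}"

section \<open>Transverse forms with values in the adjoint bundle\<close>

text \<open>A local tensor assigns to a list of complexified indices the matrix-valued component function.\<close>

type_synonym 'r tensor = "cidx list \<Rightarrow> coords \<Rightarrow> 'r mat"
type_synonym ('m, 'e, 'r) gforms = "('m, 'e, 'r) triv \<Rightarrow> 'm chart \<Rightarrow> 'r tensor"

definition zcoord :: "cidx \<Rightarrow> coords \<Rightarrow> complex" where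
  "zcoord A p = (case A of Inl \<alpha> \<Rightarrow> fst p $ \<alpha> | Inr \<alpha> \<Rightarrow> cnj (fst p $ \<alpha>))"

text \<open>\<open>cjac c c' p C A\<close> is \<open>\<partial>z'\<^sup>C / \<partial>z\<^sup>A\<close>.\<close>

definition cjac :: "'m chart \<Rightarrow> 'm chart \<Rightarrow> coords \<Rightarrow> cidx \<Rightarrow> cidx \<Rightarrow> complex" where
  "cjac c c' p C A = cpartial A (zcoord C \<circ> change c c') p"

text \<open>Sections of \<open>\<Lambda>\<^sup>k(H\<^sup>1\<^sup>,\<^sup>0)\<^sup>* \<otimes> \<Lambda>\<^sup>l(H\<^sup>0\<^sup>,\<^sup>1)\<^sup>* \<otimes> \<gg>\<^sub>E\<close> with coefficients not depending on \<open>x\<close>, given by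
  their components in all foliated charts and frames; the last clause is the transformation rule.\<close>

definition Omega ::
  "nat \<Rightarrow> nat \<Rightarrow> 'm sasakian_data \<Rightarrow> ('m, 'e, 'r::finite) bundle_data \<Rightarrow> ('m, 'e, 'r) gforms set" where
  "Omega k l M B = {\<phi>.
     (\<forall>b\<in>foliated_trivs B. \<forall>c\<in>foliated_charts M. \<forall>As.
        smooth_on (snd c ` (fst c \<inter> fst b)) (\<phi> b c As) \<and>
        basic_on (snd c ` (fst c \<inter> fst b)) (\<phi> b c As) \<and>
        (\<forall>p \<in> snd c ` (fst c \<inter> fst b).
           \<phi> b c As p \<in> complex_lie_algebra (grp B) \<and>
           (\<not> (length (filter isl As) = k \<and> length (filter (Not \<circ> isl) As) = l) \<longrightarrow> \<phi> b c As p = 0) \<and>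
           (\<forall>j < length As. \<forall>i < j. \<phi> b c (As[i := As ! j, j := As ! i]) p = - \<phi> b c As p))) \<and>
     (\<forall>b\<in>foliated_trivs B. \<forall>b'\<in>foliated_trivs B. \<forall>c\<in>foliated_charts M. \<forall>c'\<in>foliated_charts M.
        \<forall>m \<in> fst c \<inter> fst c' \<inter> fst b \<inter> fst b'. \<forall>As.
        let t = transition (proj B) b b' m in
        t ** \<phi> b c As (snd c m) ** matrix_inv t =
          (\<Sum>Cs | length Cs = length As.
             cscale (\<Prod>i<length As. cjac c c' (snd c m) (Cs ! i) (As ! i)) (\<phi> b' c' Cs (snd c' m))))}"

definition endomorphism_of ::
  "('m, 'e, 'r::finite) gforms set \<Rightarrow> (('m, 'e, 'r) gforms \<Rightarrow> ('m, 'e, 'r) gforms) \<Rightarrow> bool" where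
  "endomorphism_of \<Omega> T \<longleftrightarrow>
     (\<forall>\<phi>\<in>\<Omega>. T \<phi> \<in> \<Omega>) \<and>
     (\<forall>\<phi>\<in>\<Omega>. \<forall>\<psi>\<in>\<Omega>. T (\<lambda>b c As p. \<phi> b c As p + \<psi> b c As p) = (\<lambda>b c As p. T \<phi> b c As p + T \<psi> b c As p)) \<and>
     (\<forall>a. \<forall>\<phi>\<in>\<Omega>. T (\<lambda>b c As p. cscale a (\<phi> b c As p)) = (\<lambda>b c As p. cscale a (T \<phi> b c As p)))"

section \<open>Operators in components\<close>

text \<open>Below, \<open>\<alpha>\<close> is a connection form in a fixed chart \<open>c\<close> and frame (\<open>\<omega> b c\<close> for a connection \<open>\<omega>\<close>).\<close>

definition connA :: "(coords \<Rightarrow> coords \<Rightarrow> 'r::finite mat) \<Rightarrow> cidx \<Rightarrow> coords \<Rightarrow> 'r mat" where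
  "connA \<alpha> A p = cextM (\<alpha> p) A"

definition curvF :: "(coords \<Rightarrow> coords \<Rightarrow> 'r::finite mat) \<Rightarrow> cidx \<Rightarrow> cidx \<Rightarrow> coords \<Rightarrow> 'r mat" where
  "curvF \<alpha> A B p = cpartialM A (connA \<alpha> B) p - cpartialM B (connA \<alpha> A) p
     - comm (connA \<alpha> A p) (connA \<alpha> B p)"

text \<open>The components of \<open>\<nabla>\<close>-tilde of a tensor; the new index comes first, so
  \<open>nabt M c \<alpha> (nabt M c \<alpha> T) (B # A # Cs)\<close> is \<open>\<nabla>\<^sub>B \<nabla>\<^sub>A T\<^sub>C\<^sub>s\<close>.\<close>

definition nabt ::
  "'m sasakian_data \<Rightarrow> 'm chart \<Rightarrow> (coords \<Rightarrow> coords \<Rightarrow> 'r::finite mat) \<Rightarrow> 'r tensor \<Rightarrow> 'r tensor" where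
  "nabt M c \<alpha> T As p = (case As of [] \<Rightarrow> 0 | A # Cs \<Rightarrow>
     cpartialM A (T Cs) p + comm (T Cs p) (connA \<alpha> A p)
     - (\<Sum>i<length Cs. \<Sum>E\<in>UNIV. cscale (christoffel M c E A (Cs ! i) p) (T (Cs[i := E]) p)))"

text \<open>\<open>del1\<close>, \<open>del2\<close>: the operator \<open>\<partial>\<^sub>\<nabla>\<close> on \<open>\<Omega>\<^sup>1\<^sup>,\<^sup>0\<close> and \<open>\<Omega>\<^sup>2\<^sup>,\<^sup>0\<close>; \<open>delstar2\<close>, \<open>delstar3\<close>: its formal
  adjoint on \<open>\<Omega>\<^sup>2\<^sup>,\<^sup>0\<close> and \<open>\<Omega>\<^sup>3\<^sup>,\<^sup>0\<close>.\<close>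

definition del1 ::
  "'m sasakian_data \<Rightarrow> 'm chart \<Rightarrow> (coords \<Rightarrow> coords \<Rightarrow> 'r::finite mat) \<Rightarrow> 'r tensor \<Rightarrow> 'r tensor" where
  "del1 M c \<alpha> T As p = (case As of
      [Inl \<mu>, Inl \<nu>] \<Rightarrow> nabt M c \<alpha> T [Hol \<mu>, Hol \<nu>] p - nabt M c \<alpha> T [Hol \<nu>, Hol \<mu>] p
    | _ \<Rightarrow> 0)"

definition del2 ::
  "'m sasakian_data \<Rightarrow> 'm chart \<Rightarrow> (coords \<Rightarrow> coords \<Rightarrow> 'r::finite mat) \<Rightarrow> 'r tensor \<Rightarrow> 'r tensor" where
  "del2 M c \<alpha> T As p = (case As of
      [Inl \<mu>, Inl \<nu>, Inl \<sigma>] \<Rightarrow> nabt M c \<alpha> T [Hol \<mu>, Hol \<nu>, Hol \<sigma>] p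
         + nabt M c \<alpha> T [Hol \<nu>, Hol \<sigma>, Hol \<mu>] p + nabt M c \<alpha> T [Hol \<sigma>, Hol \<mu>, Hol \<nu>] p
    | _ \<Rightarrow> 0)"

definition delstar2 ::
  "'m sasakian_data \<Rightarrow> 'm chart \<Rightarrow> (coords \<Rightarrow> coords \<Rightarrow> 'r::finite mat) \<Rightarrow> 'r tensor \<Rightarrow> 'r tensor" where
  "delstar2 M c \<alpha> T As p = (case As of
      [Inl \<mu>] \<Rightarrow> - (\<Sum>\<nu>\<in>UNIV. \<Sum>\<tau>\<in>UNIV. cscale (gup M c p (Hol \<nu>) (Bar \<tau>))
                     (nabt M c \<alpha> T [Bar \<tau>, Hol \<nu>, Hol \<mu>] p))
    | _ \<Rightarrow> 0)"

definition delstar3 ::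
  "'m sasakian_data \<Rightarrow> 'm chart \<Rightarrow> (coords \<Rightarrow> coords \<Rightarrow> 'r::finite mat) \<Rightarrow> 'r tensor \<Rightarrow> 'r tensor" where
  "delstar3 M c \<alpha> T As p = (case As of
      [Inl \<mu>, Inl \<nu>] \<Rightarrow> - (\<Sum>\<sigma>\<in>UNIV. \<Sum>\<tau>\<in>UNIV. cscale (gup M c p (Hol \<sigma>) (Bar \<tau>))
                            (nabt M c \<alpha> T [Bar \<tau>, Hol \<sigma>, Hol \<mu>, Hol \<nu>] p))
    | _ \<Rightarrow> 0)"

definition laplace ::
  "'m sasakian_data \<Rightarrow> 'm chart \<Rightarrow> (coords \<Rightarrow> coords \<Rightarrow> 'r::finite mat) \<Rightarrow> 'r tensor \<Rightarrow> 'r tensor" where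
  "laplace M c \<alpha> T As p =
     del1 M c \<alpha> (delstar2 M c \<alpha> T) As p + delstar3 M c \<alpha> (del2 M c \<alpha> T) As p"

definition F_op ::
  "'m sasakian_data \<Rightarrow> (('m, 'e, 'r::finite) triv \<Rightarrow> 'm chart \<Rightarrow> coords \<Rightarrow> coords \<Rightarrow> 'r mat) \<Rightarrow>
   ('m, 'e, 'r) gforms \<Rightarrow> ('m, 'e, 'r) gforms" where
  "F_op M \<omega> \<phi> b c As p = (case As of
      [Inl \<mu>, Inl \<nu>] \<Rightarrow> (\<Sum>\<alpha>\<in>UNIV. \<Sum>\<beta>\<in>UNIV. cscale (gup M c p (Hol \<alpha>) (Bar \<beta>))
         (comm (\<phi> b c [Hol \<alpha>, Hol \<nu>] p) (curvF (\<omega> b c) (Hol \<mu>) (Bar \<beta>) p)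
          - comm (\<phi> b c [Hol \<alpha>, Hol \<mu>] p) (curvF (\<omega> b c) (Hol \<nu>) (Bar \<beta>) p)))
    | _ \<Rightarrow> 0)"

definition R_op ::
  "'m sasakian_data \<Rightarrow> ('m, 'e, 'r::finite) gforms \<Rightarrow> ('m, 'e, 'r) gforms" where
  "R_op M \<phi> b c As p = (case As of
      [Inl \<mu>, Inl \<nu>] \<Rightarrow> (\<Sum>\<alpha>\<in>UNIV. \<Sum>\<beta>\<in>UNIV. cscale (gup M c p (Hol \<alpha>) (Bar \<beta>))
         (cscale (ricci M c \<beta> \<mu> p) (\<phi> b c [Hol \<alpha>, Hol \<nu>] p)
          - cscale (ricci M c \<beta> \<nu> p) (\<phi> b c [Hol \<alpha>, Hol \<mu>] p)))
    | _ \<Rightarrow> 0)"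

end

theory Submission
  imports Defs
begin

text \<open>In a foliated chart the transverse metric is \<open>d\<eta>(J\<cdot>, \<cdot>) / 2\<close>, so it is Kaehler because
  \<open>d(d\<eta>) = 0\<close>. Hence the only Christoffel symbols are \<open>\<Gamma> = h\<^sup>-\<^sup>1 \<partial>h\<close> and their conjugates, and the curvature
  entering the statement is \<open>\<partial>\<close>-bar of \<open>\<Gamma>\<close>. Expanding the Laplacian, the second-order terms combine into
  the rough Laplacian and commutators of covariant derivatives; the commutators give \<open>\<F>\<close>, and the
  derivatives of \<open>\<Gamma>\<close> contract to \<open>\<R>\<close> by the symmetry of the Kaehler curvature. That \<open>\<F>\<close> and \<open>\<R>\<close> act on
  sections is the tensoriality of the curvature form and of the Ricci form
  \<open>\<partial>\<close>-bar \<open>\<partial> log det h\<close>.\<close>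

section \<open>Calculus of smooth maps\<close>

text \<open>The coordinate vectors of a foliated chart are in general not horizontal: they differ
  from their horizontal lifts by multiples of \<partial>_x. The operators in components
  differentiate along the coordinate vectors, which agrees with the lifts only on functions that do
  not depend on x. Likewise x' depends on z in a change of charts, so the chain rule closes up on
  transverse indices only for such functions. Independence of x is therefore carried along with
  smoothness in one notion, \<open>invariant_on\<close>, and derived for \<eta>, the metric, its
  inverse, the Christoffel symbols and the Ricci tensor. The definition of foliated charts says
  nothing about coordinate changes; that these are holomorphic has to be derived from the invariance
  of \<Phi>. The formula for the Laplacian concerns one chart and one frame, but \<open>F_op\<close>
  and \<open>R_op\<close> must satisfy every clause of \<open>Omega\<close>. Besides the
  transformation law, their values must stay in the complexified Lie algebra. The group is given
  only as a compact set of matrices, so it has to be shown that its Lie algebra is a subspace closed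
  under brackets and that derivatives of maps into it stay inside.\<close>

lemma C_k_on_Suc_imp: "C_k_on (Suc k) S f \<Longrightarrow> C_k_on k S f"
proof (induction k arbitrary: f)
  case 0
  then show ?case
    by (auto intro!: continuous_at_imp_continuous_on differentiable_imp_continuous_within)
next
  case (Suc k)
  then show ?case by simp
qed

lemma frechet_derivative_works_at:
  "f differentiable (at x) \<Longrightarrow> (f has_derivative frechet_derivative f (at x)) (at x)"
  using frechet_derivative_works by blast

lemma frechet_derivative_eqI: "(f has_derivative D) (at x) \<Longrightarrow> frechet_derivative f (at x) = D"
  using frechet_derivative_at by metis

text \<open>Neither function need be differentiable: \<open>frechet_derivative\<close> is a choice
  among all derivatives, and the two functions have the same ones.\<close>

lemma frechet_derivative_cong_open:
  assumes "open S" "x \<in> S" "\<And>y. y \<in> S \<Longrightarrow> f y = g y"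
  shows "frechet_derivative f (at x) = frechet_derivative g (at x)"
proof -
  have "(f has_derivative D) (at x) \<longleftrightarrow> (g has_derivative D) (at x)" for D
    using assms has_derivative_transform_within_open[of f D x UNIV S g]
      has_derivative_transform_within_open[of g D x UNIV S f] by auto
  then show ?thesis
    by (simp add: frechet_derivative_def)
qed

lemma differentiable_cong_open:
  assumes "open S" "x \<in> S" "\<And>y. y \<in> S \<Longrightarrow> f y = g y"
  shows "f differentiable (at x) \<longleftrightarrow> g differentiable (at x)"
  using assms has_derivative_transform_within_open[of f _ x UNIV S g]
      has_derivative_transform_within_open[of g _ x UNIV S f]
  unfolding differentiable_def by metis

lemma C_k_on_cong:
  assumes "open S" "\<And>x. x \<in> S \<Longrightarrow> f x = g x"
  shows "C_k_on k S f \<longleftrightarrow> C_k_on k S g"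
  using assms(2)
proof (induction k arbitrary: f g)
  case 0
  then show ?case by (simp cong: continuous_on_cong)
next
  case (Suc k)
  have "C_k_on k S (\<lambda>x. frechet_derivative f (at x) v) \<longleftrightarrow>
        C_k_on k S (\<lambda>x. frechet_derivative g (at x) v)" for v
    by (rule Suc.IH) (use Suc.prems assms(1) frechet_derivative_cong_open in metis)
  moreover have "(\<forall>x\<in>S. f differentiable (at x)) \<longleftrightarrow> (\<forall>x\<in>S. g differentiable (at x))"
    using differentiable_cong_open[OF assms(1)] Suc.prems by blast
  ultimately show ?case by simp
qed

text \<open>Replaces the chosen derivative by any explicit formula valid on the open set; the
  closure properties below get their induction steps from it.\<close>

lemma C_k_on_SucI:
  assumes "open S" "\<And>x. x \<in> S \<Longrightarrow> (f has_derivative D x) (at x)" "\<And>v. C_k_on k S (\<lambda>x. D x v)"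
  shows "C_k_on (Suc k) S f"
proof -
  have "C_k_on k S (\<lambda>x. frechet_derivative f (at x) v)" for v
    using assms(3)[of v] C_k_on_cong[OF assms(1), of "\<lambda>x. frechet_derivative f (at x) v" "\<lambda>x. D x v"]
      frechet_derivative_eqI[OF assms(2)] by simp
  then show ?thesis
    using assms(2) by (auto simp: differentiable_def)
qed

lemma C_k_on_const: "C_k_on k S (\<lambda>x. a)"
  by (induction k arbitrary: a) auto

lemma C_k_on_bounded_linear:
  assumes "open S" "bounded_linear L" "C_k_on k S f"
  shows "C_k_on k S (\<lambda>x. L (f x))"
  using assms(3)
proof (induction k arbitrary: f)
  case 0
  then show ?case
    using assms(2) by (simp add: linear_continuous_on_compose bounded_linear.continuous_on)
next
  case (Suc k)
  have D: "((\<lambda>x. L (f x)) has_derivative (\<lambda>v. L (frechet_derivative f (at x) v))) (at x)" if "x \<in> S" for x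
    using Suc.prems that
    by (auto intro!: bounded_linear.has_derivative[OF assms(2)] frechet_derivative_works_at)
  have "C_k_on k S (\<lambda>x. L (frechet_derivative f (at x) v))" for v
    using Suc by auto
  then show ?case
    by (intro C_k_on_SucI[OF assms(1) D])
qed

lemma C_k_on_add:
  assumes "open S" "C_k_on k S f" "C_k_on k S g"
  shows "C_k_on k S (\<lambda>x. f x + g x)"
  using assms(2,3)
proof (induction k arbitrary: f g)
  case 0
  then show ?case by (simp add: continuous_on_add)
next
  case (Suc k)
  have D: "((\<lambda>x. f x + g x) has_derivative
      (\<lambda>v. frechet_derivative f (at x) v + frechet_derivative g (at x) v)) (at x)" if "x \<in> S" for x
    using Suc.prems that by (auto intro!: has_derivative_add frechet_derivative_works_at)
  have "C_k_on k S (\<lambda>x. frechet_derivative f (at x) v + frechet_derivative g (at x) v)" for v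
    using Suc by auto
  then show ?case
    by (intro C_k_on_SucI[OF assms(1) D])
qed

lemma C_k_on_bounded_bilinear:
  assumes "open S" "bounded_bilinear P" "C_k_on k S f" "C_k_on k S g"
  shows "C_k_on k S (\<lambda>x. P (f x) (g x))"
  using assms(3,4)
proof (induction k arbitrary: f g)
  case 0
  then show ?case using bounded_bilinear.continuous_on[OF assms(2)] by simp
next
  case (Suc k)
  have D: "((\<lambda>x. P (f x) (g x)) has_derivative
      (\<lambda>v. P (f x) (frechet_derivative g (at x) v) + P (frechet_derivative f (at x) v) (g x))) (at x)"
    if "x \<in> S" for x
    using Suc.prems that
    by (auto intro!: bounded_bilinear.FDERIV[OF assms(2)] frechet_derivative_works_at)
  \<comment> \<open>Each summand keeps one factor undifferentiated, which is why \<open>f\<close>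
    and \<open>g\<close> are also needed at the lower order \<open>k\<close>.\<close>
  have "C_k_on k S (\<lambda>x. P (f x) (frechet_derivative g (at x) v) + P (frechet_derivative f (at x) v) (g x))" for v
    using Suc.prems C_k_on_Suc_imp[OF Suc.prems(1)] C_k_on_Suc_imp[OF Suc.prems(2)]
    by (intro C_k_on_add[OF assms(1)] Suc.IH) auto
  then show ?case
    by (intro C_k_on_SucI[OF assms(1) D])
qed

text \<open>The derivative \<open>- f^-1 f' f^-1\<close> contains the inverse itself, one order
  lower, so the induction runs with \<open>f\<close> fixed.\<close>

lemma C_k_on_inverse:
  fixes f :: "'a::real_normed_vector \<Rightarrow> complex"
  assumes "open S" "C_k_on k S f" "\<And>x. x \<in> S \<Longrightarrow> f x \<noteq> 0"
  shows "C_k_on k S (\<lambda>x. inverse (f x))"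
  using assms(2)
proof (induction k)
  case 0
  then show ?case using assms(3) by (simp add: continuous_on_inverse)
next
  case (Suc k)
  have D: "((\<lambda>x. inverse (f x)) has_derivative
      (\<lambda>v. - (inverse (f x) * (frechet_derivative f (at x) v * inverse (f x))))) (at x)" if "x \<in> S" for x
    using Suc.prems that assms(3)
    by (auto intro!: derivative_eq_intros frechet_derivative_works_at)
  have IH: "C_k_on k S (\<lambda>x. inverse (f x))"
    using Suc C_k_on_Suc_imp by blast
  have "C_k_on k S (\<lambda>x. - (inverse (f x) * (frechet_derivative f (at x) v * inverse (f x))))" for v
    using Suc.prems IH
    by (auto intro!: C_k_on_bounded_linear[OF assms(1) bounded_linear_minus[OF bounded_linear_ident]]
        C_k_on_bounded_bilinear[OF assms(1) bounded_bilinear_mult])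
  then show ?case
    by (intro C_k_on_SucI[OF assms(1) D])
qed

lemma smooth_on_differentiable: "smooth_on S f \<Longrightarrow> x \<in> S \<Longrightarrow> f differentiable (at x)"
  unfolding smooth_on_def by (metis C_k_on.simps(2))

lemma smooth_on_has_derivative:
  "smooth_on S f \<Longrightarrow> x \<in> S \<Longrightarrow> (f has_derivative frechet_derivative f (at x)) (at x)"
  by (simp add: frechet_derivative_works_at smooth_on_differentiable)

lemma smooth_on_derivative: "smooth_on S f \<Longrightarrow> smooth_on S (\<lambda>x. frechet_derivative f (at x) v)"
  unfolding smooth_on_def by (metis C_k_on.simps(2))

lemma smooth_on_continuous: "smooth_on S f \<Longrightarrow> continuous_on S f"
  unfolding smooth_on_def by (metis C_k_on.simps(1))

lemma smooth_on_cong: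
  "open S \<Longrightarrow> (\<And>x. x \<in> S \<Longrightarrow> f x = g x) \<Longrightarrow> smooth_on S f \<longleftrightarrow> smooth_on S g"
  unfolding smooth_on_def using C_k_on_cong by blast

lemma smooth_on_subset: "smooth_on S f \<Longrightarrow> T \<subseteq> S \<Longrightarrow> smooth_on T f"
proof -
  have "C_k_on k S f \<Longrightarrow> T \<subseteq> S \<Longrightarrow> C_k_on k T f" for k
    by (induction k arbitrary: f) (auto intro: continuous_on_subset)
  then show "smooth_on S f \<Longrightarrow> T \<subseteq> S \<Longrightarrow> smooth_on T f"
    unfolding smooth_on_def by blast
qed

lemma smooth_on_const: "smooth_on S (\<lambda>x. a)"
  by (simp add: smooth_on_def C_k_on_const)

lemma smooth_on_bounded_linear:
  "open S \<Longrightarrow> bounded_linear L \<Longrightarrow> smooth_on S f \<Longrightarrow> smooth_on S (\<lambda>x. L (f x))"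
  by (simp add: smooth_on_def C_k_on_bounded_linear)

lemma smooth_on_bounded_bilinear:
  "open S \<Longrightarrow> bounded_bilinear P \<Longrightarrow> smooth_on S f \<Longrightarrow> smooth_on S g \<Longrightarrow> smooth_on S (\<lambda>x. P (f x) (g x))"
  by (simp add: smooth_on_def C_k_on_bounded_bilinear)

lemma smooth_on_add:
  "open S \<Longrightarrow> smooth_on S f \<Longrightarrow> smooth_on S g \<Longrightarrow> smooth_on S (\<lambda>x. f x + g x)"
  by (simp add: smooth_on_def C_k_on_add)

lemma smooth_on_inverse:
  fixes f :: "'a::real_normed_vector \<Rightarrow> complex"
  shows "open S \<Longrightarrow> smooth_on S f \<Longrightarrow> (\<And>x. x \<in> S \<Longrightarrow> f x \<noteq> 0) \<Longrightarrow> smooth_on S (\<lambda>x. inverse (f x))"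
  by (simp add: smooth_on_def C_k_on_inverse)

text \<open>Running a curve in the group \<open>a\<close> times as fast multiplies its velocity by
  \<open>a\<close>; this later gives the scalar multiples in the Lie algebra.\<close>

lemma smooth_on_comp_scaleR:
  fixes f :: "real \<Rightarrow> 'a::real_normed_vector"
  assumes "smooth_on UNIV f"
  shows "smooth_on UNIV (\<lambda>t. f (a * t))"
proof -
  have "C_k_on k UNIV f \<Longrightarrow> C_k_on k UNIV (\<lambda>t. f (a * t))" for k
  proof (induction k arbitrary: f)
    case 0
    then show ?case
      by (auto intro!: continuous_on_compose2[of UNIV f] continuous_intros)
  next
    case (Suc k)
    have D: "((\<lambda>t. f (a * t)) has_derivative (\<lambda>v. frechet_derivative f (at (a * t)) (a * v))) (at t)" for t
    proof -
      have "((\<lambda>t. a * t) has_derivative (\<lambda>v. a * v)) (at t)"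
        by (auto intro!: derivative_eq_intros)
      moreover have "(f has_derivative frechet_derivative f (at (a * t))) (at (a * t))"
        using Suc.prems by (auto intro!: frechet_derivative_works_at)
      ultimately show ?thesis
        using diff_chain_at by (fastforce simp: o_def)
    qed
    \<comment> \<open>For fixed \<open>v\<close> this is the derivative of \<open>f\<close> in the
      direction \<open>a * v\<close>, precomposed with the same scaling, so the induction hypothesis
      applies to it.\<close>
    have "C_k_on k UNIV (\<lambda>t. frechet_derivative (\<lambda>t. f (a * t)) (at t) v)" for v
      unfolding frechet_derivative_eqI[OF D] using Suc by auto
    then show ?case
      using D by (auto simp: differentiable_def)
  qed
  then show ?thesis using assms by (simp add: smooth_on_def)
qed

section \<open>Symmetry of second derivatives\<close>

lemma norm_increment_le:
  fixes \<gamma> :: "real \<Rightarrow> 'a::real_normed_vector"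
  assumes "0 \<le> h" "\<And>t. 0 \<le> t \<Longrightarrow> t \<le> h \<Longrightarrow> (\<gamma> has_vector_derivative \<gamma>' t) (at t)"
    and "\<And>t. 0 \<le> t \<Longrightarrow> t \<le> h \<Longrightarrow> norm (\<gamma>' t) \<le> C"
  shows "norm (\<gamma> h - \<gamma> 0) \<le> C * h"
proof -
  have "norm (\<gamma> h - \<gamma> 0) \<le> C * norm (h - 0)"
  proof (rule differentiable_bound[of "{0..h}" \<gamma> "\<lambda>t s. s *\<^sub>R \<gamma>' t"])
    show "onorm (\<lambda>s. s *\<^sub>R \<gamma>' t) \<le> C" if "t \<in> {0..h}" for t
      using assms(3)[of t] that
      by (intro onorm_le) (auto simp: mult.commute[of C] intro: mult_left_mono)
  qed (use assms in \<open>auto simp: has_vector_derivative_def intro: has_derivative_at_withinI\<close>)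
  then show ?thesis using assms(1) by simp
qed

text \<open>The mean value inequality is applied twice: in the direction \<open>w\<close> to the
  derivative along \<open>v\<close> with the linear term \<open>t L\<close> subtracted, then in the
  direction \<open>v\<close> to the resulting difference. Hence the second difference is as close to
  \<open>h^2 L\<close> as the iterated derivative is to \<open>L\<close> on the
  parallelogram.\<close>

lemma second_difference_estimate:
  fixes f :: "'a::real_normed_vector \<Rightarrow> 'b::real_normed_vector"
  assumes "open S" "smooth_on S f" "0 \<le> h"
    and Q: "\<And>s t. 0 \<le> s \<Longrightarrow> s \<le> h \<Longrightarrow> 0 \<le> t \<Longrightarrow> t \<le> h \<Longrightarrow> p + s *\<^sub>R v + t *\<^sub>R w \<in> S \<and>
       norm (frechet_derivative (\<lambda>q. frechet_derivative f (at q) v) (at (p + s *\<^sub>R v + t *\<^sub>R w)) w - L) \<le> \<epsilon>"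
  shows "norm (f (p + h *\<^sub>R v + h *\<^sub>R w) - f (p + h *\<^sub>R v) - f (p + h *\<^sub>R w) + f p - (h * h) *\<^sub>R L) \<le> \<epsilon> * h * h"
proof -
  define g where "g q = frechet_derivative f (at q) v" for q
  have sg: "smooth_on S g"
    unfolding g_def by (rule smooth_on_derivative[OF assms(2)])
  have der: "((\<lambda>t. k (q + t *\<^sub>R u)) has_vector_derivative frechet_derivative k (at (q + t *\<^sub>R u)) u) (at t)"
    if "smooth_on S k" "q + t *\<^sub>R u \<in> S" for k :: "'a \<Rightarrow> 'b" and q u t
  proof -
    have k: "(k has_derivative frechet_derivative k (at (q + t *\<^sub>R u))) (at (q + t *\<^sub>R u))"
      using smooth_on_has_derivative that by blast
    have "((\<lambda>t. q + t *\<^sub>R u) has_derivative (\<lambda>s. s *\<^sub>R u)) (at t)"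
      by (auto intro!: derivative_eq_intros)
    from diff_chain_at[OF this k] show ?thesis
      using linear_cmul[OF has_derivative_linear[OF k]] by (simp add: has_vector_derivative_def o_def)
  qed
  have inner: "norm (g (p + s *\<^sub>R v + h *\<^sub>R w) - g (p + s *\<^sub>R v) - h *\<^sub>R L) \<le> \<epsilon> * h" if s: "0 \<le> s" "s \<le> h" for s
  proof -
    have "norm ((g (p + s *\<^sub>R v + h *\<^sub>R w) - h *\<^sub>R L) - (g (p + s *\<^sub>R v + 0 *\<^sub>R w) - 0 *\<^sub>R L)) \<le> \<epsilon> * h"
    proof (rule norm_increment_le[where \<gamma>' = "\<lambda>t. frechet_derivative g (at (p + s *\<^sub>R v + t *\<^sub>R w)) w - L"])
      fix t assume t: "0 \<le> t" "t \<le> h"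
      show "((\<lambda>t. g (p + s *\<^sub>R v + t *\<^sub>R w) - t *\<^sub>R L) has_vector_derivative
          frechet_derivative g (at (p + s *\<^sub>R v + t *\<^sub>R w)) w - L) (at t)"
        using der[OF sg, of "p + s *\<^sub>R v" t w] Q s t by (auto intro!: derivative_eq_intros)
      show "norm (frechet_derivative g (at (p + s *\<^sub>R v + t *\<^sub>R w)) w - L) \<le> \<epsilon>"
        using Q[OF s t] unfolding g_def by simp
    qed (use assms in auto)
    then show ?thesis by (simp add: algebra_simps)
  qed
  \<comment> \<open>The increment of this function over [0, h] is the second difference minus
    \<open>h^2 L\<close>, and its velocity is the quantity bounded in \<open>inner\<close>.\<close>
  let ?\<phi> = "\<lambda>s. f (p + h *\<^sub>R w + s *\<^sub>R v) - f (p + s *\<^sub>R v) - (s * h) *\<^sub>R L"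
  have "norm (?\<phi> h - ?\<phi> 0) \<le> (\<epsilon> * h) * h"
  proof (rule norm_increment_le[where \<gamma>' = "\<lambda>s. g (p + h *\<^sub>R w + s *\<^sub>R v) - g (p + s *\<^sub>R v) - h *\<^sub>R L"])
    fix s assume s: "0 \<le> s" "s \<le> h"
    have "p + h *\<^sub>R w + s *\<^sub>R v \<in> S" "p + s *\<^sub>R v \<in> S"
      using Q[OF s, of h] Q[OF s, of 0] assms(3) by (auto simp: algebra_simps)
    then show "(?\<phi> has_vector_derivative g (p + h *\<^sub>R w + s *\<^sub>R v) - g (p + s *\<^sub>R v) - h *\<^sub>R L) (at s)"
      using der[OF assms(2), of "p + h *\<^sub>R w" s v] der[OF assms(2), of "p" s v] unfolding g_def
      by (auto intro!: derivative_eq_intros)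
    show "norm (g (p + h *\<^sub>R w + s *\<^sub>R v) - g (p + s *\<^sub>R v) - h *\<^sub>R L) \<le> \<epsilon> * h"
      using inner[OF s] by (simp add: algebra_simps)
  qed (use assms in auto)
  then show ?thesis by (simp add: algebra_simps)
qed

text \<open>The second difference is symmetric in \<open>v\<close> and \<open>w\<close>, and divided
  by \<open>h^2\<close> it approximates both iterated derivatives at \<open>p\<close> with error
  \<epsilon>.\<close>

lemma smooth_on_second_derivative_commute:
  fixes f :: "'a::real_normed_vector \<Rightarrow> 'b::real_normed_vector"
  assumes "open S" "smooth_on S f" "p \<in> S"
  shows "frechet_derivative (\<lambda>q. frechet_derivative f (at q) v) (at p) w =
         frechet_derivative (\<lambda>q. frechet_derivative f (at q) w) (at p) v"
proof -
  define X where "X v w q = frechet_derivative (\<lambda>q. frechet_derivative f (at q) v) (at q) w" for v w q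
  have cont: "continuous_on S (X v w)" for v w
    unfolding X_def using assms(2) by (intro smooth_on_continuous smooth_on_derivative)
  have "norm (X v w p - X w v p) \<le> 2 * \<epsilon>" if "\<epsilon> > 0" for \<epsilon>
  proof -
    have "\<forall>\<^sub>F q in nhds p. q \<in> S \<and> norm (X v w q - X v w p) < \<epsilon> \<and> norm (X w v q - X w v p) < \<epsilon>"
    proof (intro eventually_conj)
      show "\<forall>\<^sub>F q in nhds p. q \<in> S" using assms by (simp add: eventually_nhds_in_open)
      have "\<forall>\<^sub>F q in nhds p. norm (X v w q - X v w p) < \<epsilon>" for v w
        using cont[of v w] assms that tendstoD[of "X v w" "X v w p" "nhds p" \<epsilon>]
        by (simp add: continuous_on_eq_continuous_at continuous_at tendsto_at_iff_tendsto_nhds dist_norm)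
      then show "\<forall>\<^sub>F q in nhds p. norm (X v w q - X v w p) < \<epsilon>"
        "\<forall>\<^sub>F q in nhds p. norm (X w v q - X w v p) < \<epsilon>" by auto
    qed
    then obtain \<delta> where \<delta>: "\<delta> > 0" "\<And>q. dist q p < \<delta> \<Longrightarrow>
        q \<in> S \<and> norm (X v w q - X v w p) < \<epsilon> \<and> norm (X w v q - X w v p) < \<epsilon>"
      unfolding eventually_nhds_metric by blast
    \<comment> \<open>Small enough for the whole parallelogram to lie in the \<delta>-ball; the
      summand 1 keeps the denominator positive when \<open>v\<close> and \<open>w\<close>
      vanish.\<close>
    define h where "h = \<delta> / (2 * (norm v + norm w + 1))"
    have pos: "norm v + norm w + 1 > 0"
      by (meson add_nonneg_pos add_nonneg_nonneg norm_ge_zero zero_less_one)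
    have h: "h > 0" using \<delta>(1) pos by (simp add: h_def)
    have near: "dist (p + s *\<^sub>R v + t *\<^sub>R w) p < \<delta>" if "0 \<le> s" "s \<le> h" "0 \<le> t" "t \<le> h" for s t
    proof -
      have "dist (p + s *\<^sub>R v + t *\<^sub>R w) p \<le> s * norm v + t * norm w"
        using norm_triangle_ineq[of "s *\<^sub>R v" "t *\<^sub>R w"] that by (simp add: dist_norm add.assoc)
      also have "\<dots> \<le> h * norm v + h * norm w"
        using that by (intro add_mono mult_right_mono) auto
      also have "\<dots> < 2 * (h * (norm v + norm w + 1))"
        using mult_pos_pos[OF h pos] h by (simp add: distrib_left)
      also have "\<dots> = \<delta>" using pos by (simp add: h_def divide_simps)
      finally show ?thesis .
    qed
    let ?\<Delta> = "f (p + h *\<^sub>R v + h *\<^sub>R w) - f (p + h *\<^sub>R v) - f (p + h *\<^sub>R w) + f p"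
    have 1: "norm (?\<Delta> - (h * h) *\<^sub>R X v w p) \<le> \<epsilon> * h * h"
      using \<delta>(2) near h unfolding X_def
      by (intro second_difference_estimate[OF assms(1,2)]) (auto simp: less_imp_le)
    have "norm (f (p + h *\<^sub>R w + h *\<^sub>R v) - f (p + h *\<^sub>R w) - f (p + h *\<^sub>R v) + f p - (h * h) *\<^sub>R X w v p) \<le> \<epsilon> * h * h"
    proof (unfold X_def, rule second_difference_estimate[OF assms(1,2)])
      fix s t assume "0 \<le> s" "s \<le> h" "0 \<le> t" "t \<le> h"
      then show "p + s *\<^sub>R w + t *\<^sub>R v \<in> S \<and> norm (frechet_derivative (\<lambda>q. frechet_derivative f (at q) w)
          (at (p + s *\<^sub>R w + t *\<^sub>R v)) v - frechet_derivative (\<lambda>q. frechet_derivative f (at q) w) (at p) v) \<le> \<epsilon>"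
        using \<delta>(2)[OF near[of t s]] unfolding X_def by (simp add: algebra_simps)
    qed (use h in simp)
    then have 2: "norm (?\<Delta> - (h * h) *\<^sub>R X w v p) \<le> \<epsilon> * h * h"
      by (simp add: algebra_simps)
    have "norm ((h * h) *\<^sub>R (X v w p - X w v p)) \<le> \<epsilon> * h * h + \<epsilon> * h * h"
      using norm_triangle_ineq4[of "?\<Delta> - (h * h) *\<^sub>R X w v p" "?\<Delta> - (h * h) *\<^sub>R X v w p"] 1 2
      by (simp add: scaleR_diff_right)
    then have "(h * h) * norm (X v w p - X w v p) \<le> (h * h) * (2 * \<epsilon>)"
      by (simp add: mult.commute mult.left_commute)
    then show ?thesis using h by (simp add: mult_le_cancel_left)
  qed
  have "norm (X v w p - X w v p) \<le> 0 + \<epsilon>" if "\<epsilon> > 0" for \<epsilon>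
    using that \<open>\<And>\<epsilon>. \<epsilon> > 0 \<Longrightarrow> norm (X v w p - X w v p) \<le> 2 * \<epsilon>\<close>[of "\<epsilon> / 2"] by simp
  then have "norm (X v w p - X w v p) \<le> 0"
    by (rule field_le_epsilon)
  then show ?thesis by (simp add: X_def)
qed

text \<open>The case \<open>e = 0\<close> is plain smoothness; the case \<open>e = \<partial>\<^sub>x\<close> is smoothness together with
  independence of the Reeb coordinate.\<close>

definition invariant_on ::
  "'a::real_normed_vector \<Rightarrow> 'a set \<Rightarrow> ('a \<Rightarrow> 'b::real_normed_vector) \<Rightarrow> bool" where
  "invariant_on e S f \<longleftrightarrow> smooth_on S f \<and> (\<forall>p\<in>S. frechet_derivative f (at p) e = 0)"

lemma invariant_on_zero: "invariant_on 0 S f \<longleftrightarrow> smooth_on S f"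
  unfolding invariant_on_def
  using smooth_on_has_derivative has_derivative_linear linear_0 by blast

lemma invariant_on_basic: "invariant_on (0, 1) S f \<longleftrightarrow> smooth_on S f \<and> basic_on S f"
  by (simp add: invariant_on_def basic_on_def)

lemma invariant_on_smooth: "invariant_on e S f \<Longrightarrow> smooth_on S f"
  by (simp add: invariant_on_def)

lemma invariant_onI:
  assumes "smooth_on S f" "\<And>x. x \<in> S \<Longrightarrow> (f has_derivative D x) (at x)" "\<And>x. x \<in> S \<Longrightarrow> D x e = 0"
  shows "invariant_on e S f"
  using assms by (simp add: invariant_on_def frechet_derivative_eqI[OF assms(2)])

lemma invariant_on_vanishes: "invariant_on e S f \<Longrightarrow> p \<in> S \<Longrightarrow> frechet_derivative f (at p) e = 0"
  by (simp add: invariant_on_def)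

lemma invariant_on_has_derivative:
  "invariant_on e S f \<Longrightarrow> x \<in> S \<Longrightarrow> (f has_derivative frechet_derivative f (at x)) (at x)"
  using smooth_on_has_derivative invariant_on_smooth by blast

text \<open>Symmetry of second derivatives exchanges \<open>e\<close> and \<open>v\<close>, and the
  derivative of \<open>f\<close> along \<open>e\<close> vanishes on an open set.\<close>

lemma invariant_on_derivative:
  assumes "open S" "invariant_on e S f"
  shows "invariant_on e S (\<lambda>q. frechet_derivative f (at q) v)"
proof -
  have "frechet_derivative (\<lambda>q. frechet_derivative f (at q) v) (at p) e = 0" if "p \<in> S" for p
  proof -
    have "frechet_derivative (\<lambda>q. frechet_derivative f (at q) v) (at p) e =
          frechet_derivative (\<lambda>q. frechet_derivative f (at q) e) (at p) v"
      using assms that by (intro smooth_on_second_derivative_commute[of S]) (auto simp: invariant_on_def)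
    also have "\<dots> = frechet_derivative (\<lambda>q. 0) (at p) v"
      using assms that by (subst frechet_derivative_cong_open[of S p _ "\<lambda>q. 0"]) (auto simp: invariant_on_def)
    finally show ?thesis by simp
  qed
  then show ?thesis
    using assms(2) by (simp add: invariant_on_def smooth_on_derivative)
qed

lemma invariant_on_cong:
  assumes "open S" "\<And>x. x \<in> S \<Longrightarrow> f x = g x"
  shows "invariant_on e S f \<longleftrightarrow> invariant_on e S g"
proof -
  have "frechet_derivative f (at p) = frechet_derivative g (at p)" if "p \<in> S" for p
    using frechet_derivative_cong_open[OF assms(1) that assms(2)] .
  then show ?thesis
    using smooth_on_cong[OF assms] by (simp add: invariant_on_def)
qed

lemma invariant_on_subset: "invariant_on e S f \<Longrightarrow> T \<subseteq> S \<Longrightarrow> invariant_on e T f"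
  using smooth_on_subset unfolding invariant_on_def by blast

lemma invariant_on_const: "invariant_on e S (\<lambda>x. a)"
  by (simp add: invariant_on_def smooth_on_const)

lemma invariant_on_bounded_linear:
  assumes "open S" "bounded_linear L" "invariant_on e S f"
  shows "invariant_on e S (\<lambda>x. L (f x))"
proof (rule invariant_onI)
  show "smooth_on S (\<lambda>x. L (f x))"
    by (rule smooth_on_bounded_linear[OF assms(1,2) invariant_on_smooth[OF assms(3)]])
  show "((\<lambda>x. L (f x)) has_derivative (\<lambda>v. L (frechet_derivative f (at x) v))) (at x)" if "x \<in> S" for x
    using assms(3) that by (intro bounded_linear.has_derivative[OF assms(2)] invariant_on_has_derivative)
  show "L (frechet_derivative f (at x) e) = 0" if "x \<in> S" for x
    using invariant_on_vanishes[OF assms(3) that] linear_0[OF bounded_linear.linear[OF assms(2)]] by simp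
qed

lemma invariant_on_bounded_bilinear:
  assumes "open S" "bounded_bilinear P" "invariant_on e S f" "invariant_on e S g"
  shows "invariant_on e S (\<lambda>x. P (f x) (g x))"
proof (rule invariant_onI)
  show "smooth_on S (\<lambda>x. P (f x) (g x))"
    by (rule smooth_on_bounded_bilinear[OF assms(1,2) invariant_on_smooth[OF assms(3)] invariant_on_smooth[OF assms(4)]])
  fix x assume x: "x \<in> S"
  show "((\<lambda>x. P (f x) (g x)) has_derivative
      (\<lambda>v. P (f x) (frechet_derivative g (at x) v) + P (frechet_derivative f (at x) v) (g x))) (at x)"
    using assms(3,4) x by (intro bounded_bilinear.FDERIV[OF assms(2)] invariant_on_has_derivative)
  show "P (f x) (frechet_derivative g (at x) e) + P (frechet_derivative f (at x) e) (g x) = 0"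
    using invariant_on_vanishes[OF assms(3) x] invariant_on_vanishes[OF assms(4) x]
    by (simp add: bounded_bilinear.zero_left[OF assms(2)] bounded_bilinear.zero_right[OF assms(2)])
qed

lemma invariant_on_add:
  assumes "open S" "invariant_on e S f" "invariant_on e S g"
  shows "invariant_on e S (\<lambda>x. f x + g x)"
proof (rule invariant_onI)
  show "smooth_on S (\<lambda>x. f x + g x)"
    by (rule smooth_on_add[OF assms(1) invariant_on_smooth[OF assms(2)] invariant_on_smooth[OF assms(3)]])
  fix x assume x: "x \<in> S"
  show "((\<lambda>x. f x + g x) has_derivative
      (\<lambda>v. frechet_derivative f (at x) v + frechet_derivative g (at x) v)) (at x)"
    using assms(2,3) x by (intro has_derivative_add invariant_on_has_derivative)
  show "frechet_derivative f (at x) e + frechet_derivative g (at x) e = 0"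
    using invariant_on_vanishes[OF assms(2) x] invariant_on_vanishes[OF assms(3) x] by simp
qed

lemma invariant_on_inverse:
  fixes f :: "'a::real_normed_vector \<Rightarrow> complex"
  assumes "open S" "invariant_on e S f" "\<And>x. x \<in> S \<Longrightarrow> f x \<noteq> 0"
  shows "invariant_on e S (\<lambda>x. inverse (f x))"
proof (rule invariant_onI)
  show "smooth_on S (\<lambda>x. inverse (f x))"
    by (rule smooth_on_inverse[OF assms(1) invariant_on_smooth[OF assms(2)] assms(3)])
  fix x assume x: "x \<in> S"
  show "((\<lambda>x. inverse (f x)) has_derivative
      (\<lambda>v. - (inverse (f x) * frechet_derivative f (at x) v * inverse (f x)))) (at x)"
    by (rule Deriv.has_derivative_inverse[OF assms(3)[OF x] invariant_on_has_derivative[OF assms(2) x]])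
  show "- (inverse (f x) * frechet_derivative f (at x) e * inverse (f x)) = 0"
    using invariant_on_vanishes[OF assms(2) x] by simp
qed

lemma invariant_on_minus:
  "open S \<Longrightarrow> invariant_on e S f \<Longrightarrow> invariant_on e S (\<lambda>x. - f x)"
  by (rule invariant_on_bounded_linear[OF _ bounded_linear_minus[OF bounded_linear_ident]])

lemma invariant_on_diff:
  "open S \<Longrightarrow> invariant_on e S f \<Longrightarrow> invariant_on e S g \<Longrightarrow> invariant_on e S (\<lambda>x. f x - g x)"
  using invariant_on_add[of S e f "\<lambda>x. - g x"] invariant_on_minus[of S e g] by simp

lemma invariant_on_mult:
  fixes f g :: "'a::real_normed_vector \<Rightarrow> complex"
  shows "open S \<Longrightarrow> invariant_on e S f \<Longrightarrow> invariant_on e S g \<Longrightarrow> invariant_on e S (\<lambda>x. f x * g x)"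
  by (rule invariant_on_bounded_bilinear[OF _ bounded_bilinear_mult])

lemma invariant_on_sum:
  "open S \<Longrightarrow> (\<And>i. i \<in> I \<Longrightarrow> invariant_on e S (f i)) \<Longrightarrow> invariant_on e S (\<lambda>x. \<Sum>i\<in>I. f i x)"
  by (induction I rule: infinite_finite_induct) (auto intro: invariant_on_const invariant_on_add)

lemma invariant_on_prod:
  fixes f :: "'i \<Rightarrow> 'a::real_normed_vector \<Rightarrow> complex"
  shows "open S \<Longrightarrow> (\<And>i. i \<in> I \<Longrightarrow> invariant_on e S (f i)) \<Longrightarrow> invariant_on e S (\<lambda>x. \<Prod>i\<in>I. f i x)"
  by (induction I rule: infinite_finite_induct) (auto intro: invariant_on_const invariant_on_mult)

lemma invariant_on_vec_iff:
  fixes f :: "'a::real_normed_vector \<Rightarrow> 'b::euclidean_space^'n::finite"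
  assumes "open S"
  shows "invariant_on e S f \<longleftrightarrow> (\<forall>i. invariant_on e S (\<lambda>x. f x $ i))"
proof
  assume "invariant_on e S f"
  then show "\<forall>i. invariant_on e S (\<lambda>x. f x $ i)"
    using invariant_on_bounded_linear[OF assms bounded_linear_vec_nth] by blast
next
  assume R: "\<forall>i. invariant_on e S (\<lambda>x. f x $ i)"
  have "bounded_linear (\<lambda>a::'b. axis i a :: 'b^'n)" for i
    by (intro linear_conv_bounded_linear[THEN iffD1] linearI) (auto simp: axis_def vec_eq_iff)
  then have "invariant_on e S (\<lambda>x. \<Sum>i\<in>UNIV. axis i (f x $ i))"
    using R by (intro invariant_on_sum assms) (auto intro: invariant_on_bounded_linear[OF assms])
  moreover have "(\<lambda>x. \<Sum>i\<in>UNIV. axis i (f x $ i)) = f"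
    by (auto simp: fun_eq_iff vec_eq_iff axis_def sum_component if_distrib cong: if_cong)
  ultimately show "invariant_on e S f" by simp
qed

lemma invariant_on_mat_iff:
  fixes f :: "'a::real_normed_vector \<Rightarrow> complex^'n::finite^'k::finite"
  assumes "open S"
  shows "invariant_on e S f \<longleftrightarrow> (\<forall>i j. invariant_on e S (\<lambda>x. f x $ i $ j))"
  by (simp add: invariant_on_vec_iff[OF assms, of e f] invariant_on_vec_iff[OF assms, of e "\<lambda>x. f x $ i" for i])

lemma invariant_on_det:
  fixes G :: "'a::real_normed_vector \<Rightarrow> complex^'n::finite^'n"
  assumes "open S" "\<And>i j. invariant_on e S (\<lambda>x. G x $ i $ j)"
  shows "invariant_on e S (\<lambda>x. det (G x))"
  unfolding det_def using assms
  by (intro invariant_on_sum invariant_on_mult invariant_on_prod invariant_on_const) auto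

lemma matrix_inv_mult:
  fixes A :: "complex^'n::finite^'n"
  assumes "invertible A"
  shows "A ** matrix_inv A = mat 1" "matrix_inv A ** A = mat 1"
proof -
  have "\<exists>A'. A ** A' = mat 1 \<and> A' ** A = mat 1"
    using assms by (simp add: invertible_def)
  from someI_ex[OF this] show "A ** matrix_inv A = mat 1" "matrix_inv A ** A = mat 1"
    by (auto simp: matrix_inv_def)
qed

lemma matrix_inv_unique_left:
  fixes A :: "complex^'n::finite^'n"
  assumes "X ** A = mat 1"
  shows "matrix_inv A = X"
proof -
  have "invertible A"
    using assms invertible_left_inverse by blast
  then have "X ** (A ** matrix_inv A) = X"
    by (simp add: matrix_inv_mult)
  then show ?thesis
    by (simp add: matrix_mul_assoc assms)
qed

text \<open>Column \<open>j\<close> of the inverse solves a linear system with right-hand side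
  \<open>axis j 1\<close>. Cramer's rule writes its entries as a determinant divided by
  \<open>det (G x)\<close>, which is nowhere zero on \<open>S\<close>.\<close>

lemma invariant_on_matrix_inv:
  fixes G :: "'a::real_normed_vector \<Rightarrow> complex^'n::finite^'n"
  assumes "open S" "invariant_on e S G" "\<And>x. x \<in> S \<Longrightarrow> invertible (G x)"
  shows "invariant_on e S (\<lambda>x. matrix_inv (G x))"
proof -
  have G: "invariant_on e S (\<lambda>x. G x $ i $ j)" for i j
    using assms invariant_on_mat_iff by blast
  have det0: "det (G x) \<noteq> 0" if "x \<in> S" for x
    using assms(3)[OF that] invertible_det_nz by blast
  have eq: "matrix_inv (G x) $ i $ j =
      det (\<chi> a b. if b = i then axis j 1 $ a else G x $ a $ b) * inverse (det (G x))" if "x \<in> S" for x i j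
  proof -
    let ?v = "matrix_inv (G x) *v axis j 1"
    have "G x *v ?v = axis j 1"
      by (simp add: matrix_vector_mul_assoc matrix_inv_mult assms(3) that)
    then have "?v = (\<chi> k. det (\<chi> a b. if b = k then axis j 1 $ a else G x $ a $ b) / det (G x))"
      using cramer[OF det0[OF that]] by blast
    moreover have "?v $ i = matrix_inv (G x) $ i $ j"
      by (simp add: matrix_vector_mult_def axis_def if_distrib cong: if_cong)
    ultimately show ?thesis by (simp add: divide_inverse)
  qed
  have "invariant_on e S (\<lambda>x. det (\<chi> a b. if b = i then axis j 1 $ a else G x $ a $ b) * inverse (det (G x)))" for i j
  proof (intro invariant_on_mult invariant_on_inverse invariant_on_det assms(1) det0 G)
    show "invariant_on e S (\<lambda>x. (\<chi> a b. if b = i then axis j 1 $ a else G x $ a $ b) $ a $ b)" for a b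
      using G by (cases "b = i") (auto intro: invariant_on_const)
  qed
  then show ?thesis
    unfolding invariant_on_mat_iff[OF assms(1)]
    by (subst invariant_on_cong[OF assms(1) eq]) auto
qed

section \<open>Calculus with complex indices\<close>

lemma matrix_ring_simps:
  fixes X Y Z :: "'r::finite mat"
  shows "X ** (Y + Z) = X ** Y + X ** Z" "(X + Y) ** Z = X ** Z + Y ** Z"
    "X ** (Y - Z) = X ** Y - X ** Z" "(X - Y) ** Z = X ** Z - Y ** Z"
    "X ** (- Y) = - (X ** Y)" "(- X) ** Y = - (X ** Y)"
    "X ** 0 = 0" "0 ** X = 0"
  by (simp_all add: matrix_matrix_mult_def vec_eq_iff algebra_simps sum.distrib sum_subtractf sum_negf)

lemma bounded_bilinear_matrix_mult:
  "bounded_bilinear ((**) :: 'r::finite mat \<Rightarrow> 'r mat \<Rightarrow> 'r mat)"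
  by (intro bilinear_conv_bounded_bilinear[THEN iffD1])
    (auto simp: bilinear_def matrix_ring_simps scalar_matrix_assoc matrix_scalar_ac intro!: linearI)

lemma bounded_bilinear_cscale: "bounded_bilinear (cscale :: complex \<Rightarrow> 'r::finite mat \<Rightarrow> 'r mat)"
  by (intro bilinear_conv_bounded_bilinear[THEN iffD1])
    (auto simp: bilinear_def cscale_def vec_eq_iff algebra_simps intro!: linearI)

lemma invariant_on_matrix_mult:
  fixes X Y :: "'a::real_normed_vector \<Rightarrow> 'r::finite mat"
  shows "open S \<Longrightarrow> invariant_on e S X \<Longrightarrow> invariant_on e S Y \<Longrightarrow> invariant_on e S (\<lambda>q. X q ** Y q)"
  by (rule invariant_on_bounded_bilinear[OF _ bounded_bilinear_matrix_mult])

lemma invariant_on_cscale: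
  fixes X :: "'a::real_normed_vector \<Rightarrow> 'r::finite mat"
  shows "open S \<Longrightarrow> invariant_on e S a \<Longrightarrow> invariant_on e S X \<Longrightarrow> invariant_on e S (\<lambda>q. cscale (a q) (X q))"
  by (rule invariant_on_bounded_bilinear[OF _ bounded_bilinear_cscale])

lemma invariant_on_comm:
  "open S \<Longrightarrow> invariant_on e S X \<Longrightarrow> invariant_on e S Y \<Longrightarrow> invariant_on e S (\<lambda>q. comm (X q) (Y q))"
  unfolding comm_def by (intro invariant_on_diff invariant_on_matrix_mult)

lemmas invariant_on_intros = invariant_on_const invariant_on_add invariant_on_diff invariant_on_minus
  invariant_on_sum invariant_on_mult invariant_on_matrix_mult invariant_on_cscale invariant_on_comm

text \<open>With \<open>re_dir\<close>, \<open>im_dir\<close> and \<open>im_sign\<close> both cases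
  of \<open>cext\<close> become one formula, so the calculus with complex indices need not
  distinguish barred from unbarred ones.\<close>

definition re_dir :: "cidx \<Rightarrow> coords" where
  "re_dir A = (axis (case A of Inl \<alpha> \<Rightarrow> \<alpha> | Inr \<alpha> \<Rightarrow> \<alpha>) 1, 0)"

definition im_dir :: "cidx \<Rightarrow> coords" where
  "im_dir A = (axis (case A of Inl \<alpha> \<Rightarrow> \<alpha> | Inr \<alpha> \<Rightarrow> \<alpha>) \<i>, 0)"

definition im_sign :: "cidx \<Rightarrow> complex" where
  "im_sign A = (case A of Inl \<alpha> \<Rightarrow> - \<i> | Inr \<alpha> \<Rightarrow> \<i>)"

lemma cext_eq: "cext L A = (L (re_dir A) + im_sign A * L (im_dir A)) / 2"
  by (cases A) (auto simp: cext_def re_dir_def im_dir_def im_sign_def)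

lemma cextM_eq: "cextM L A = cscale (1 / 2) (L (re_dir A) + cscale (im_sign A) (L (im_dir A)))"
  by (simp add: cextM_def cext_eq cscale_def vec_eq_iff)

lemma cscale_simps:
  "cscale a (X + Y) = cscale a X + cscale a Y"
  "cscale a (X - Y) = cscale a X - cscale a Y"
  "cscale a (- X) = - cscale a X"
  "cscale (- a) X = - cscale a X"
  "cscale a 0 = 0"
  "cscale 0 X = 0"
  "cscale 1 X = X"
  "cscale a (cscale b X) = cscale (a * b) X"
  "cscale a X ** Y = cscale a (X ** Y)"
  "X ** cscale a Y = cscale a (X ** Y)"
  by (auto simp: cscale_def vec_eq_iff matrix_matrix_mult_def sum_distrib_left algebra_simps)

lemma cscale_add_left: "cscale (a + b) X = cscale a X + cscale b X"
  by (simp add: cscale_def vec_eq_iff algebra_simps)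

lemma cscale_sum_right: "cscale a (\<Sum>i\<in>I. X i) = (\<Sum>i\<in>I. cscale a (X i))"
  by (induction I rule: infinite_finite_induct) (auto simp: cscale_simps)

lemma cscale_sum_left: "cscale (\<Sum>i\<in>I. a i) X = (\<Sum>i\<in>I. cscale (a i) X)"
  by (induction I rule: infinite_finite_induct) (auto simp: cscale_simps cscale_add_left)

lemma cpartial_eqI:
  "(f has_derivative D) (at p) \<Longrightarrow> cpartial A f p = cext D A"
  by (simp add: cpartial_def frechet_derivative_eqI)

lemma cpartialM_eqI:
  "(X has_derivative D) (at p) \<Longrightarrow> cpartialM A X p = cextM D A"
  by (simp add: cpartialM_def frechet_derivative_eqI)

lemma cpartial_cong:
  "open S \<Longrightarrow> p \<in> S \<Longrightarrow> (\<And>q. q \<in> S \<Longrightarrow> f q = g q) \<Longrightarrow> cpartial A f p = cpartial A g p"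
  unfolding cpartial_def by (subst frechet_derivative_cong_open) auto

lemma cpartialM_cong:
  "open S \<Longrightarrow> p \<in> S \<Longrightarrow> (\<And>q. q \<in> S \<Longrightarrow> X q = Y q) \<Longrightarrow> cpartialM A X p = cpartialM A Y p"
  unfolding cpartialM_def by (subst frechet_derivative_cong_open) auto

lemma cpartial_const [simp]: "cpartial A (\<lambda>q. a) p = 0"
  by (simp add: cpartial_def cext_eq)

lemma cpartialM_const [simp]: "cpartialM A (\<lambda>q. X) p = 0"
  by (simp add: cpartialM_def cextM_eq cscale_simps)

lemma cpartial_add:
  "f differentiable (at p) \<Longrightarrow> g differentiable (at p) \<Longrightarrow>
    cpartial A (\<lambda>q. f q + g q) p = cpartial A f p + cpartial A g p"
  by (subst cpartial_eqI[OF has_derivative_add[OF frechet_derivative_works_at frechet_derivative_works_at]])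
    (auto simp: cpartial_def cext_eq field_simps)

lemma cpartial_diff:
  "f differentiable (at p) \<Longrightarrow> g differentiable (at p) \<Longrightarrow>
    cpartial A (\<lambda>q. f q - g q) p = cpartial A f p - cpartial A g p"
  by (subst cpartial_eqI[OF has_derivative_diff[OF frechet_derivative_works_at frechet_derivative_works_at]])
    (auto simp: cpartial_def cext_eq field_simps)

lemma cpartial_mult:
  "f differentiable (at p) \<Longrightarrow> g differentiable (at p) \<Longrightarrow>
    cpartial A (\<lambda>q. f q * g q) p = cpartial A f p * g p + f p * cpartial A g p"
  by (subst cpartial_eqI[OF has_derivative_mult[OF frechet_derivative_works_at frechet_derivative_works_at]])
    (auto simp: cpartial_def cext_eq field_simps)

lemma cpartial_sum:
  "(\<And>i. i \<in> I \<Longrightarrow> f i differentiable (at p)) \<Longrightarrow>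
    cpartial A (\<lambda>q. \<Sum>i\<in>I. f i q) p = (\<Sum>i\<in>I. cpartial A (f i) p)"
  by (subst cpartial_eqI[OF has_derivative_sum[OF frechet_derivative_works_at]])
    (auto simp: cpartial_def cext_eq sum.distrib sum_distrib_left sum_divide_distrib add_divide_distrib)

lemma cpartialM_add:
  "X differentiable (at p) \<Longrightarrow> Y differentiable (at p) \<Longrightarrow>
    cpartialM A (\<lambda>q. X q + Y q) p = cpartialM A X p + cpartialM A Y p"
  by (subst cpartialM_eqI[OF has_derivative_add[OF frechet_derivative_works_at frechet_derivative_works_at]])
    (auto simp: cpartialM_def cextM_eq cscale_simps)

lemma cpartialM_diff:
  "X differentiable (at p) \<Longrightarrow> Y differentiable (at p) \<Longrightarrow>
    cpartialM A (\<lambda>q. X q - Y q) p = cpartialM A X p - cpartialM A Y p"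
  by (subst cpartialM_eqI[OF has_derivative_diff[OF frechet_derivative_works_at frechet_derivative_works_at]])
    (auto simp: cpartialM_def cextM_eq cscale_simps)

lemma cpartialM_minus:
  "X differentiable (at p) \<Longrightarrow> cpartialM A (\<lambda>q. - X q) p = - cpartialM A X p"
  by (subst cpartialM_eqI[OF has_derivative_minus[OF frechet_derivative_works_at]])
    (auto simp: cpartialM_def cextM_eq cscale_simps)

lemma cpartialM_sum:
  "(\<And>i. i \<in> I \<Longrightarrow> X i differentiable (at p)) \<Longrightarrow>
    cpartialM A (\<lambda>q. \<Sum>i\<in>I. X i q) p = (\<Sum>i\<in>I. cpartialM A (X i) p)"
  by (subst cpartialM_eqI[OF has_derivative_sum[OF frechet_derivative_works_at]])
    (auto simp: cpartialM_def cextM_eq sum.distrib cscale_sum_right cscale_simps)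

lemma cpartialM_cscale:
  "a differentiable (at p) \<Longrightarrow> X differentiable (at p) \<Longrightarrow>
    cpartialM A (\<lambda>q. cscale (a q) (X q)) p = cscale (cpartial A a p) (X p) + cscale (a p) (cpartialM A X p)"
  by (subst cpartialM_eqI[OF bounded_bilinear.FDERIV[OF bounded_bilinear_cscale
          frechet_derivative_works_at frechet_derivative_works_at]])
    (auto simp: cpartialM_def cpartial_def cextM_eq cext_eq cscale_def vec_eq_iff field_simps)

lemma cpartialM_matrix_mult:
  "X differentiable (at p) \<Longrightarrow> Y differentiable (at p) \<Longrightarrow>
    cpartialM A (\<lambda>q. X q ** Y q) p = cpartialM A X p ** Y p + X p ** cpartialM A Y p"
  by (subst cpartialM_eqI[OF bounded_bilinear.FDERIV[OF bounded_bilinear_matrix_mult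
          frechet_derivative_works_at frechet_derivative_works_at]])
    (auto simp: cpartialM_def cextM_eq cscale_simps matrix_ring_simps)

lemma cpartialM_nth:
  assumes "X differentiable (at p)"
  shows "cpartialM A X p $ i $ j = cpartial A (\<lambda>q. X q $ i $ j) p"
proof -
  have "((\<lambda>q. X q $ i $ j) has_derivative (\<lambda>v. frechet_derivative X (at p) v $ i $ j)) (at p)"
    using assms by (intro bounded_linear.has_derivative[OF bounded_linear_vec_nth] frechet_derivative_works_at)
  then show ?thesis
    by (simp add: cpartial_eqI cpartialM_def cextM_def)
qed


lemma invariant_on_cpartial:
  assumes "open S" "invariant_on e S f"
  shows "invariant_on e S (\<lambda>q. cpartial A f q)"
  unfolding cpartial_def cext_eq divide_inverse
  using assms by (intro invariant_on_intros invariant_on_derivative)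

lemma invariant_on_cpartialM:
  assumes "open S" "invariant_on e S X"
  shows "invariant_on e S (\<lambda>q. cpartialM A X q)"
  unfolding cpartialM_def cextM_eq
  using assms by (intro invariant_on_intros invariant_on_derivative)

text \<open>Both sides are the same complex combination of four iterated real derivatives, once
  these are known to be symmetric.\<close>

lemma cpartial_commute:
  assumes "open S" "smooth_on S f" "p \<in> S"
  shows "cpartial A (\<lambda>q. cpartial C f q) p = cpartial C (\<lambda>q. cpartial A f q) p"
proof -
  define D where "D v q = frechet_derivative f (at q) v" for v q
  have D: "(D v has_derivative frechet_derivative (D v) (at p)) (at p)" for v
    unfolding D_def using assms by (intro smooth_on_has_derivative[of S] smooth_on_derivative)
  have sym: "frechet_derivative (D v) (at p) w = frechet_derivative (D w) (at p) v" for v w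
    unfolding D_def by (rule smooth_on_second_derivative_commute[OF assms])
  have X: "cpartial A (\<lambda>q. cpartial C f q) p =
      cext (\<lambda>v. cext (\<lambda>w. frechet_derivative (D w) (at p) v) C) A" for A C
    unfolding cpartial_def[of C] cext_eq[of _ C] D_def[symmetric]
    by (rule cpartial_eqI) (auto intro!: derivative_eq_intros D)
  show ?thesis
    unfolding X by (simp add: cext_eq sym field_simps)
qed

lemma cpartialM_commute:
  assumes "open S" "smooth_on S X" "p \<in> S"
  shows "cpartialM A (\<lambda>q. cpartialM C X q) p = cpartialM C (\<lambda>q. cpartialM A X q) p"
proof -
  have nth: "smooth_on S (\<lambda>q. X q $ i $ j)" for i j
    using assms invariant_on_mat_iff[of S 0 X] by (simp add: invariant_on_zero)
  have "cpartialM A (\<lambda>q. cpartialM C X q) p $ i $ j = cpartial A (\<lambda>q. cpartial C (\<lambda>q. X q $ i $ j) q) p" for A C i j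
  proof -
    have "smooth_on S (cpartialM C X)"
      using invariant_on_cpartialM[of S 0 X C] assms by (simp add: invariant_on_zero)
    then have "cpartialM A (\<lambda>q. cpartialM C X q) p $ i $ j = cpartial A (\<lambda>q. cpartialM C X q $ i $ j) p"
      using assms by (intro cpartialM_nth) (auto intro: smooth_on_differentiable)
    also have "\<dots> = cpartial A (\<lambda>q. cpartial C (\<lambda>q. X q $ i $ j) q) p"
      using assms smooth_on_differentiable by (intro cpartial_cong[of S] cpartialM_nth) auto
    finally show ?thesis .
  qed
  then show ?thesis
    using cpartial_commute[OF assms(1) nth assms(3)] by (simp add: vec_eq_iff)
qed

declare split_paired_All [simp del]

lemma sum_cidx: "(\<Sum>A\<in>(UNIV::cidx set). f A) = (\<Sum>\<alpha>\<in>UNIV. f (Hol \<alpha>)) + (\<Sum>\<alpha>\<in>UNIV. f (Bar \<alpha>))"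
  using sum.Plus[of "UNIV::3 set" "UNIV::3 set" f] by (simp add: UNIV_Plus_UNIV)

lemma im_sign_simps [simp]: "im_sign (Hol \<alpha>) = - \<i>" "im_sign (Bar \<alpha>) = \<i>"
  by (auto simp: im_sign_def)

lemma im_sign_square: "im_sign A * im_sign A = - 1"
  by (cases A) auto

text \<open>The decomposition of a covector into its dz and conjugate dz parts, with
  \<open>zcoord C\<close> in the role of the coordinate covector. Vanishing on the Reeb direction
  excludes a dx part.\<close>

lemma linear_eq_sum_cext:
  assumes "linear L" "L (0, 1) = 0"
  shows "L w = (\<Sum>C\<in>UNIV. zcoord C w * cext L C)"
proof -
  obtain z x where w: "w = (z, x)" by (cases w)
  have ax: "L (axis \<gamma> (z $ \<gamma>), 0) = Re (z $ \<gamma>) * L (axis \<gamma> 1, 0) + Im (z $ \<gamma>) * L (axis \<gamma> \<i>, 0)" for \<gamma>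
  proof -
    have "(axis \<gamma> (z $ \<gamma>) :: complex^3, 0::real) =
        Re (z $ \<gamma>) *\<^sub>R (axis \<gamma> 1, 0) + Im (z $ \<gamma>) *\<^sub>R (axis \<gamma> \<i>, 0)"
      by (auto simp: axis_def vec_eq_iff complex_eq_iff)
    then show ?thesis
      by (simp only: linear_add[OF assms(1)] linear_cmul[OF assms(1)] scaleR_conv_of_real)
  qed
  have "w = (\<Sum>\<gamma>\<in>UNIV. (axis \<gamma> (z $ \<gamma>), 0)) + x *\<^sub>R (0, 1)"
    by (simp add: w prod_eq_iff vec_eq_iff sum_component axis_def fst_sum snd_sum if_distrib cong: if_cong)
  then have "L w = (\<Sum>\<gamma>\<in>UNIV. L (axis \<gamma> (z $ \<gamma>), 0))"
    using assms by (simp only: linear_add linear_sum linear_cmul) simp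
  also have "\<dots> = (\<Sum>\<gamma>\<in>UNIV. zcoord (Hol \<gamma>) w * cext L (Hol \<gamma>) + zcoord (Bar \<gamma>) w * cext L (Bar \<gamma>))"
    by (intro sum.cong refl) (auto simp: ax w zcoord_def cext_def complex_eq_iff field_simps)
  finally show ?thesis by (simp add: sum_cidx sum.distrib)
qed

section \<open>The transverse Kaehler metric in a foliated chart\<close>

locale foliated_chart =
  fixes M :: "'m::topological_space sasakian_data" and c :: "'m chart"
  assumes sasakian: "sasakian M" and foliated: "c \<in> foliated_charts M"
begin

abbreviation "U \<equiv> snd c ` fst c"
abbreviation "g \<equiv> gdn M c"
abbreviation "gi \<equiv> gup M c"
abbreviation "\<eta> \<equiv> eta M c"

lemma in_atlas: "c \<in> atlas M"
  using foliated by (simp add: foliated_charts_def)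

lemma open_U: "open U"
  using sasakian in_atlas unfolding sasakian_def smooth_atlas_def is_chart_def by blast

lemma contact: "contact_metric M" "contact_form_with_reeb M"
  using sasakian by (auto simp: sasakian_def contact_metric_def)

lemma reeb: "p \<in> U \<Longrightarrow> xi M c p = (0, 1)"
  using foliated by (auto simp: foliated_charts_def)

lemma fst_Phi: "p \<in> U \<Longrightarrow> fst (Phi M c p v) = \<i> *s fst v"
  using foliated unfolding foliated_charts_def by blast

lemma eta_form: "one_form_on (atlas M) UNIV (eta M)"
  using contact(2) by (simp add: contact_form_with_reeb_def)

lemma linear_eta: "p \<in> U \<Longrightarrow> linear (\<eta> p)"
  using eta_form in_atlas by (auto simp: one_form_on_def)

lemma smooth_eta: "smooth_on U (\<lambda>p. \<eta> p v)"
  using eta_form in_atlas unfolding one_form_on_def by fastforce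

lemma
  assumes "p \<in> U"
  shows eta_reeb: "\<eta> p (0, 1) = 1" and ext_d_eta_reeb: "ext_d \<eta> p (0, 1) v = 0"
proof -
  have "\<eta> p (xi M c p) = 1 \<and> (\<forall>v. ext_d \<eta> p (xi M c p) v = 0)"
    using contact(2) in_atlas assms unfolding contact_form_with_reeb_def by blast
  then show "\<eta> p (0, 1) = 1" "ext_d \<eta> p (0, 1) v = 0"
    unfolding reeb[OF assms] by blast+
qed

lemma ext_d_antisym: "ext_d \<eta> p v w = - ext_d \<eta> p w v"
  by (simp add: ext_d_def)

lemma metric:
  assumes "p \<in> U"
  shows "bilinear (met M c p)" "met M c p v w = met M c p w v" "v \<noteq> 0 \<Longrightarrow> met M c p v v > 0"
  using contact(1) in_atlas assms unfolding contact_metric_def riemannian_metric_def by auto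

lemma compatible:
  assumes "p \<in> U"
  shows "Phi M c p (Phi M c p v) = - v + \<eta> p v *\<^sub>R (0, 1)"
    "met M c p (Phi M c p v) (Phi M c p w) = met M c p v w - \<eta> p v * \<eta> p w"
    "ext_d \<eta> p v w = 2 * met M c p v (Phi M c p w)"
proof -
  have "Phi M c p (Phi M c p v) = - v + \<eta> p v *\<^sub>R xi M c p \<and>
        met M c p (Phi M c p v) (Phi M c p w) = met M c p v w - \<eta> p v * \<eta> p w \<and>
        ext_d \<eta> p v w = 2 * met M c p v (Phi M c p w)" for v w
    using contact(1) in_atlas assms unfolding contact_metric_def by blast
  then show "Phi M c p (Phi M c p v) = - v + \<eta> p v *\<^sub>R (0, 1)"
    "met M c p (Phi M c p v) (Phi M c p w) = met M c p v w - \<eta> p v * \<eta> p w"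
    "ext_d \<eta> p v w = 2 * met M c p v (Phi M c p w)"
    unfolding reeb[OF assms] by blast+
qed

text \<open>In coordinates \<open>d\<eta>(\<partial>_x, v) = \<partial>_x \<eta>(v) - \<partial>_v
  \<eta>(\<partial>_x)\<close>. The left side is zero by the Reeb condition and
  \<open>\<eta>(\<partial>_x)\<close> is constantly 1.\<close>

lemma eta_basic:
  assumes "p \<in> U"
  shows "frechet_derivative (\<lambda>q. \<eta> q v) (at p) (0, 1) = 0"
proof -
  have "frechet_derivative (\<lambda>q. \<eta> q (0, 1)) (at p) = frechet_derivative (\<lambda>q. 1) (at p)"
    by (rule frechet_derivative_cong_open[OF open_U assms eta_reeb])
  then show ?thesis
    using ext_d_eta_reeb[OF assms, of v] by (simp add: ext_d_def)
qed

text \<open>The squared length of \<open>\<Phi> \<xi>\<close> is half of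
  \<open>d\<eta>(\<Phi> \<xi>, \<xi>)\<close>, which the Reeb condition makes zero.\<close>

lemma Phi_reeb:
  assumes "p \<in> U"
  shows "Phi M c p (0, 1) = 0"
proof -
  have "met M c p (Phi M c p (0, 1)) (Phi M c p (0, 1)) = 0"
    using compatible(3)[OF assms, of "Phi M c p (0, 1)" "(0, 1)"] ext_d_eta_reeb[OF assms]
      ext_d_antisym[of p "Phi M c p (0, 1)" "(0, 1)"] by simp
  then show ?thesis
    using metric(3)[OF assms, of "Phi M c p (0, 1)"] by fastforce
qed

text \<open>The contact metric condition makes \<xi> orthogonal to the image of \<Phi>, in
  particular to \<open>\<Phi> (\<Phi> v) = - v + \<eta>(v) \<xi>\<close>; and \<xi> has length
  1.\<close>

lemma met_reeb:
  assumes "p \<in> U"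
  shows "met M c p v (0, 1) = \<eta> p v"
proof -
  have lin: "linear (met M c p (0, 1))" "linear (\<lambda>v. met M c p v (0, 1))"
    using metric(1)[OF assms] by (auto simp: bilinear_def)
  have zero: "met M c p (0, 1) 0 = 0"
    using linear_0[OF lin(1)] .
  have one: "met M c p (0, 1) (0, 1) = 1"
    using compatible(2)[OF assms, of "(0, 1)" "(0, 1)"] Phi_reeb[OF assms] eta_reeb[OF assms]
      linear_0[OF bilinear_def[THEN iffD1, THEN conjunct1, rule_format, OF metric(1)[OF assms]]]
    by simp
  have "met M c p (0, 1) (Phi M c p (Phi M c p v)) = 0"
    using compatible(3)[OF assms, of "(0, 1)" "Phi M c p v"] ext_d_eta_reeb[OF assms] by simp
  then have "met M c p (0, 1) (- v + \<eta> p v *\<^sub>R (0, 1)) = 0"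
    by (simp only: compatible(1)[OF assms])
  then show ?thesis
    using one by (simp only: linear_add[OF lin(1)] linear_cmul[OF lin(1)] linear_neg[OF lin(1)])
      (simp add: metric(2)[OF assms, of v])
qed

lemma linear_ext_d:
  assumes "p \<in> U"
  shows "linear (\<lambda>v. ext_d \<eta> p v w)"
proof -
  have D: "(\<lambda>q. \<eta> q v) differentiable (at p)" for v
    using smooth_eta assms by (rule smooth_on_differentiable)
  have "frechet_derivative (\<lambda>q. \<eta> q (u + v)) (at p) =
      frechet_derivative (\<lambda>q. \<eta> q u + \<eta> q v) (at p)" for u v
    by (rule frechet_derivative_cong_open[OF open_U assms]) (simp add: linear_add[OF linear_eta])
  then have add: "frechet_derivative (\<lambda>q. \<eta> q (u + v)) (at p) =
      (\<lambda>w. frechet_derivative (\<lambda>q. \<eta> q u) (at p) w + frechet_derivative (\<lambda>q. \<eta> q v) (at p) w)" for u v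
    using frechet_derivative_eqI[OF has_derivative_add[OF frechet_derivative_works_at[OF D]
          frechet_derivative_works_at[OF D]]] by simp
  have "frechet_derivative (\<lambda>q. \<eta> q (a *\<^sub>R v)) (at p) =
      frechet_derivative (\<lambda>q. a *\<^sub>R \<eta> q v) (at p)" for a v
    by (rule frechet_derivative_cong_open[OF open_U assms]) (simp add: linear_cmul[OF linear_eta])
  then have scale: "frechet_derivative (\<lambda>q. \<eta> q (a *\<^sub>R v)) (at p) =
      (\<lambda>w. a *\<^sub>R frechet_derivative (\<lambda>q. \<eta> q v) (at p) w)" for a v
    using frechet_derivative_eqI[OF has_derivative_scaleR_right[OF frechet_derivative_works_at[OF D]]] by simp
  have lin: "linear (frechet_derivative (\<lambda>q. \<eta> q w) (at p))"
    using has_derivative_linear[OF frechet_derivative_works_at[OF D]] .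
  show ?thesis
    by (intro linearI) (simp_all add: ext_d_def add scale linear_add[OF lin] linear_cmul[OF lin] algebra_simps)
qed

text \<open>Projecting to H subtracts \<open>\<eta>(v) \<eta>(w)\<close>, which leaves
  \<open>g(\<Phi> v, \<Phi> w)\<close>, half of \<open>d\<eta>(\<Phi> v, w)\<close>. The vertical
  part of \<open>\<Phi> v\<close> contributes nothing to it, and the transverse part is \<i> times
  that of \<open>v\<close>. So the transverse metric is determined by \<open>d\<eta>\<close> and the
  complex structure of the coordinates.\<close>

lemma met_horizontal:
  assumes "p \<in> U"
  shows "met M c p (horizontal M c p v) (horizontal M c p w) = ext_d \<eta> p (\<i> *s fst v, 0) w / 2"
proof -
  have lin: "linear (\<lambda>v. met M c p v w)" "linear (met M c p v)" for v w
    using metric(1)[OF assms] by (auto simp: bilinear_def)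
  have one: "met M c p (0, 1) (0, 1) = 1"
    using met_reeb[OF assms, of "(0, 1)"] eta_reeb[OF assms] by simp
  have "met M c p (horizontal M c p v) (horizontal M c p w) = met M c p v w - \<eta> p v * \<eta> p w"
    unfolding horizontal_def reeb[OF assms]
    by (simp only: linear_diff[OF lin(1)] linear_diff[OF lin(2)] linear_cmul[OF lin(1)] linear_cmul[OF lin(2)]
        linear_diff[OF linear_eta[OF assms]] linear_cmul[OF linear_eta[OF assms]]
        met_reeb[OF assms] metric(2)[OF assms, of "(0, 1)"] one eta_reeb[OF assms])
      (simp add: algebra_simps)
  also have "\<dots> = ext_d \<eta> p (Phi M c p v) w / 2"
    using compatible(2,3)[OF assms] by simp
  also have "Phi M c p v = (\<i> *s fst v, 0) + snd (Phi M c p v) *\<^sub>R (0, 1)"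
    using fst_Phi[OF assms, of v] by (simp add: prod_eq_iff)
  also have "ext_d \<eta> p \<dots> w = ext_d \<eta> p (\<i> *s fst v, 0) w"
    by (simp only: linear_add[OF linear_ext_d[OF assms]] linear_cmul[OF linear_ext_d[OF assms]]
        ext_d_eta_reeb[OF assms]) simp
  finally show ?thesis .
qed

definition etac :: "cidx \<Rightarrow> coords \<Rightarrow> complex" where
  "etac B q = cext (\<lambda>v. complex_of_real (\<eta> q v)) B"

text \<open>The components of \<open>d\<eta>\<close>, formed from derivatives of the components of
  \<eta>; in this shape closedness is the symmetry of second derivatives. \<open>omega_eq\<close>
  identifies them with the complex extension of \<open>ext_d\<close>.\<close>

definition omega :: "cidx \<Rightarrow> cidx \<Rightarrow> coords \<Rightarrow> complex" where
  "omega A B p = cpartial A (etac B) p - cpartial B (etac A) p"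

lemma invariant_eta: "invariant_on (0, 1) U (\<lambda>q. \<eta> q v)"
  by (simp add: invariant_on_def smooth_eta eta_basic)

lemma invariant_etac: "invariant_on (0, 1) U (etac B)"
proof -
  have "invariant_on (0, 1) U (\<lambda>q. complex_of_real (\<eta> q v))" for v
    by (rule invariant_on_bounded_linear[OF open_U bounded_linear_of_real invariant_eta])
  then show ?thesis
    unfolding etac_def cext_eq divide_inverse by (intro invariant_on_intros open_U)
qed

lemma invariant_omega: "invariant_on (0, 1) U (omega A B)"
  unfolding omega_def
  by (intro invariant_on_diff invariant_on_cpartial[OF open_U invariant_etac] open_U)

lemma omega_eq:
  assumes "p \<in> U"
  shows "omega A B p = cext (\<lambda>v. cext (\<lambda>w. complex_of_real (ext_d \<eta> p v w)) B) A"
proof -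
  have D: "((\<lambda>q. \<eta> q v) has_derivative frechet_derivative (\<lambda>q. \<eta> q v) (at p)) (at p)" for v
    using smooth_eta assms by (rule smooth_on_has_derivative)
  have "cpartial A (etac B) p =
      cext (\<lambda>v. cext (\<lambda>w. complex_of_real (frechet_derivative (\<lambda>q. \<eta> q w) (at p) v)) B) A" for A B
    unfolding etac_def cext_eq[of _ B]
    by (rule cpartial_eqI) (auto intro!: derivative_eq_intros D)
  then show ?thesis
    by (simp add: omega_def cext_eq ext_d_def) (simp add: field_simps)
qed

text \<open>Multiplication by \<i> maps \<open>re_dir A\<close> to \<open>im_dir A\<close> and
  \<open>im_dir A\<close> to \<open>- re_dir A\<close>, so the complex coordinate vector is an
  eigenvector with eigenvalue \<open>- im_sign A\<close>; the factor 1/2 is that of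
  \<open>met_horizontal\<close>.\<close>

lemma g_eq_omega:
  assumes "p \<in> U"
  shows "g p A B = - (im_sign A / 2) * omega A B p"
proof -
  have "ext_d \<eta> p (\<i> *s fst (re_dir A), 0) w = ext_d \<eta> p (im_dir A) w"
    "ext_d \<eta> p (\<i> *s fst (im_dir A), 0) w = - ext_d \<eta> p (re_dir A) w" for w
  proof -
    have "(\<i> *s fst (re_dir A), 0) = im_dir A" "(\<i> *s fst (im_dir A), 0) = - re_dir A"
      by (auto simp: re_dir_def im_dir_def axis_def vec_eq_iff)
    then show "ext_d \<eta> p (\<i> *s fst (re_dir A), 0) w = ext_d \<eta> p (im_dir A) w"
      "ext_d \<eta> p (\<i> *s fst (im_dir A), 0) w = - ext_d \<eta> p (re_dir A) w"
      by (simp_all add: linear_neg[OF linear_ext_d[OF assms]])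
  qed
  then show ?thesis
    using im_sign_square[of A] unfolding gdn_def met_horizontal[OF assms] omega_eq[OF assms] cext_eq
    by (simp add: field_simps) (cases A; simp add: field_simps)
qed

lemma g_sym: "p \<in> U \<Longrightarrow> g p A B = g p B A"
  by (simp add: gdn_def cext_eq metric(2)[of p "horizontal M c p (re_dir A)"]
      metric(2)[of p "horizontal M c p (im_dir A)"] field_simps)

lemma omega_antisym: "omega A B p = - omega B A p"
  by (simp add: omega_def)

text \<open>Within one type the factor between \<open>g\<close> and \<open>omega\<close> is the same
  for both orders of the indices, while \<open>g\<close> is symmetric and \<open>omega\<close>
  antisymmetric.\<close>

lemma omega_pure:
  assumes "p \<in> U" "isl A = isl B"
  shows "omega A B p = 0"
proof -
  have "im_sign A = im_sign B"
    using assms(2) by (cases A; cases B) auto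
  then have "im_sign A * omega A B p = - (im_sign A * omega A B p)"
    using g_sym[OF assms(1), of A B] omega_antisym[of B A p]
    by (simp add: g_eq_omega[OF assms(1)])
  then have "im_sign A * omega A B p = 0" by (simp add: equal_neg_zero)
  moreover have "im_sign A \<noteq> 0" by (cases A) auto
  ultimately show ?thesis by simp
qed

lemma g_pure: "p \<in> U \<Longrightarrow> isl A = isl B \<Longrightarrow> g p A B = 0"
  by (simp add: g_eq_omega omega_pure)

lemma invariant_g: "invariant_on (0, 1) U (\<lambda>q. g q A B)"
  by (rule invariant_on_cong[OF open_U, THEN iffD2, OF g_eq_omega])
    (assumption, intro invariant_on_mult invariant_on_const open_U invariant_omega)

lemma differentiable_of_invariant: "invariant_on e U f \<Longrightarrow> p \<in> U \<Longrightarrow> f differentiable (at p)"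
  using invariant_on_smooth smooth_on_differentiable by blast

text \<open>This is \<open>d(d\<eta>) = 0\<close>: the six second derivatives of \<eta> cancel in
  pairs.\<close>

lemma cpartial_omega_cyclic:
  assumes "p \<in> U"
  shows "cpartial A (omega B C) p + cpartial B (omega C A) p + cpartial C (omega A B) p = 0"
proof -
  have d: "cpartial A (omega B C) p = cpartial A (\<lambda>q. cpartial B (etac C) q) p - cpartial A (\<lambda>q. cpartial C (etac B) q) p" for A B C
    unfolding omega_def
    by (intro cpartial_diff differentiable_of_invariant[OF invariant_on_cpartial[OF open_U invariant_etac] assms])
  have s: "cpartial A (\<lambda>q. cpartial B (etac C) q) p = cpartial B (\<lambda>q. cpartial A (etac C) q) p" for A B C
    by (rule cpartial_commute[OF open_U invariant_on_smooth[OF invariant_etac] assms])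
  show ?thesis
    unfolding d s[of A B C] s[of C A B] s[of B C A] by simp
qed

text \<open>Since \<open>omega A B\<close> vanishes identically for indices of one type, the cyclic
  identity keeps only two terms, and both are turned into derivatives of \<open>g\<close> by the
  same factor.\<close>

lemma kaehler:
  assumes "p \<in> U" "isl A = isl B"
  shows "cpartial A (\<lambda>q. g q B C) p = cpartial B (\<lambda>q. g q A C) p"
proof -
  have sign: "im_sign A = im_sign B"
    using assms(2) by (cases A; cases B) auto
  have g: "cpartial A (\<lambda>q. g q B C) p = - (im_sign B / 2) * cpartial A (omega B C) p" for A B
  proof -
    have "cpartial A (\<lambda>q. g q B C) p = cpartial A (\<lambda>q. - (im_sign B / 2) * omega B C q) p"
      by (rule cpartial_cong[OF open_U assms(1) g_eq_omega])
    then show ?thesis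
      using cpartial_mult[of "\<lambda>q. - (im_sign B / 2)" p "omega B C" A]
        differentiable_of_invariant[OF invariant_omega assms(1)] by simp
  qed
  have "cpartial C (omega A B) p = cpartial C (\<lambda>q. 0) p"
    by (rule cpartial_cong[OF open_U assms(1)]) (simp add: omega_pure assms(2))
  moreover have "cpartial B (omega C A) p = - cpartial B (omega A C) p"
  proof -
    have "omega C A = (\<lambda>q. 0 - omega A C q)"
      by (simp add: omega_def fun_eq_iff)
    then show ?thesis
      using cpartial_diff[of "\<lambda>q. 0" p "omega A C" B]
        differentiable_of_invariant[OF invariant_omega assms(1)] by simp
  qed
  ultimately show ?thesis
    using cpartial_omega_cyclic[OF assms(1), of A B C] by (simp add: g sign)
qed

end

section \<open>The inverse of the transverse metric\<close>

lemma sum_UNIV_delta: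
  fixes f :: "'i::finite \<Rightarrow> 'a::semiring_1"
  shows "(\<Sum>i\<in>UNIV. (if i = a then 1 else 0) * f i) = f a" "(\<Sum>i\<in>UNIV. (if a = i then 1 else 0) * f i) = f a"
    "(\<Sum>i\<in>UNIV. f i * (if i = a then 1 else 0)) = f a" "(\<Sum>i\<in>UNIV. f i * (if a = i then 1 else 0)) = f a"
  by (simp_all add: if_distrib[of "\<lambda>x. x * _"] if_distrib[of "\<lambda>x. _ * x"] cong: if_cong)

lemma linear_complex_of_real: "linear f \<Longrightarrow> linear (\<lambda>v. complex_of_real (f v))"
  by (simp add: linear_iff scaleR_conv_of_real)

context foliated_chart
begin

lemma horizontal_linear:
  assumes "p \<in> U"
  shows "linear (horizontal M c p)"
  unfolding horizontal_def
  by (intro linearI)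
    (simp_all add: linear_add[OF linear_eta[OF assms]] linear_cmul[OF linear_eta[OF assms]] algebra_simps)

lemma horizontal_reeb: "p \<in> U \<Longrightarrow> horizontal M c p (0, 1) = 0"
  by (simp add: horizontal_def reeb eta_reeb)

definition gmat :: "coords \<Rightarrow> complex^cidx^cidx" where
  "gmat p = (\<chi> A B. g p A B)"

lemma linear_met_horizontal:
  assumes "p \<in> U"
  shows "linear (\<lambda>v. met M c p (horizontal M c p v) w)" "linear (\<lambda>w. met M c p v (horizontal M c p w))"
proof -
  have "linear (\<lambda>v. met M c p v w)" "linear (met M c p v)"
    using metric(1)[OF assms] by (auto simp: bilinear_def)
  from this[THEN linear_compose[OF horizontal_linear[OF assms]]]
  show "linear (\<lambda>v. met M c p (horizontal M c p v) w)" "linear (\<lambda>w. met M c p v (horizontal M c p w))"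
    by (simp_all add: o_def)
qed

text \<open>A complex tangent vector \<open>a + \<i> b\<close> in the kernel of \<open>g\<close> has real and imaginary
  parts of length zero.\<close>

lemma gmat_kernel:
  assumes p: "p \<in> U" and ker: "gmat p *v x = 0"
  shows "x = 0"
proof -
  let ?h = "horizontal M c p"
  have met0: "met M c p v 0 = 0" "met M c p 0 v = 0" for v
    using metric(1)[OF p] bilinear_rzero bilinear_lzero by blast+
  define a b :: coords where
    "a = (\<chi> \<gamma>. (x $ Hol \<gamma> + cnj (x $ Bar \<gamma>)) / 2, 0)" and
    "b = (\<chi> \<gamma>. (x $ Hol \<gamma> - cnj (x $ Bar \<gamma>)) / (2 * \<i>), 0)"
  have ab: "zcoord B a + \<i> * zcoord B b = x $ B" for B
    by (cases B) (simp_all add: a_def b_def zcoord_def field_simps)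
  \<comment> \<open>\<open>L\<close> is the pairing with a + \<i> b, so \<open>gmat p *v x\<close>
    lists its components. Its vanishing is used at \<open>a\<close> for the real part and at
    \<open>b\<close> for the imaginary part.\<close>
  define L where "L w = complex_of_real (met M c p (?h w) (?h a)) + \<i> * complex_of_real (met M c p (?h w) (?h b))" for w
  have linL: "linear L"
    unfolding L_def by (intro linearI)
      (simp_all add: linear_add[OF linear_met_horizontal(1)[OF p]] linear_cmul[OF linear_met_horizontal(1)[OF p]] algebra_simps
        scaleR_conv_of_real)
  have "cext L A = 0" for A
  proof -
    have pair: "(\<Sum>B\<in>UNIV. zcoord B w * cext (\<lambda>w. complex_of_real (met M c p (?h v) (?h w))) B) =
        complex_of_real (met M c p (?h v) (?h w))" for v w
      by (rule linear_eq_sum_cext[OF linear_complex_of_real[OF linear_met_horizontal(2)[OF p]], symmetric])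
        (simp add: horizontal_reeb[OF p] met0)
    have "cext L A = cext (\<lambda>v. \<Sum>B\<in>UNIV. x $ B * cext (\<lambda>w. complex_of_real (met M c p (?h v) (?h w))) B) A"
      unfolding ab[symmetric] by (simp add: distrib_right sum.distrib mult.assoc sum_distrib_left[symmetric] pair L_def[abs_def])
    also have "\<dots> = (\<Sum>B\<in>UNIV. x $ B * g p A B)"
      unfolding gdn_def cext_eq[of _ A] sum_distrib_left sum.distrib[symmetric] sum_divide_distrib
      by (intro sum.cong refl) (simp add: field_simps)
    also have "\<dots> = (gmat p *v x) $ A"
      by (simp add: matrix_vector_mult_def gmat_def mult.commute)
    finally show ?thesis using ker by simp
  qed
  then have "L w = 0" for w
    using linear_eq_sum_cext[OF linL, of w] by (simp add: L_def horizontal_reeb[OF p] met0)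
  then have "met M c p (?h a) (?h a) = 0" "met M c p (?h b) (?h b) = 0"
    by (auto simp: L_def complex_eq_iff)
  then have "?h a = 0" "?h b = 0"
    using metric(3)[OF p, of "?h a"] metric(3)[OF p, of "?h b"] by auto
  \<comment> \<open>A vector with zero horizontal part is a multiple of the Reeb field, and neither
    \<open>a\<close> nor \<open>b\<close> has an x-component.\<close>
  then have "a = 0" "b = 0"
    by (auto simp: horizontal_def reeb[OF p] a_def b_def prod_eq_iff)
  then have "x $ B = 0" for B
    using ab[of B] by (cases B) (auto simp: zcoord_def)
  then show "x = 0" by (simp add: vec_eq_iff)
qed

lemma invertible_gmat: "p \<in> U \<Longrightarrow> invertible (gmat p)"
  unfolding invertible_left_inverse matrix_left_invertible_ker using gmat_kernel by blast

lemma gi_eq: "gi p A B = matrix_inv (gmat p) $ A $ B"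
  by (simp add: gup_def gmat_def)

lemma invariant_gi: "invariant_on (0, 1) U (\<lambda>q. gi q A B)"
proof -
  have "invariant_on (0, 1) U (\<lambda>q. matrix_inv (gmat q))"
    by (rule invariant_on_matrix_inv[OF open_U _ invertible_gmat])
      (simp add: invariant_on_mat_iff[OF open_U] gmat_def invariant_g)
  then show ?thesis
    by (simp add: gi_eq invariant_on_mat_iff[OF open_U])
qed

lemma gi_g: "p \<in> U \<Longrightarrow> (\<Sum>B\<in>UNIV. gi p A B * g p B C) = (if A = C then 1 else 0)"
  using matrix_inv_mult(2)[OF invertible_gmat, of p]
  by (simp add: matrix_matrix_mult_def mat_def vec_eq_iff gi_eq gmat_def)

lemma gi_uniqueI:
  assumes "\<And>A C. (\<Sum>B\<in>UNIV. X A B * g p B C) = (if A = C then 1 else 0)"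
  shows "gi p A B = X A B"
proof -
  have "(\<chi> A B. X A B) ** gmat p = mat 1"
    using assms by (simp add: matrix_matrix_mult_def mat_def vec_eq_iff gmat_def)
  then show ?thesis
    by (simp add: gi_eq matrix_inv_unique_left)
qed

lemma gi_sym:
  assumes "p \<in> U"
  shows "gi p A B = gi p B A"
proof (rule gi_uniqueI)
  fix A C
  have "(\<Sum>B\<in>UNIV. gmat p $ C $ B * matrix_inv (gmat p) $ B $ A) = (if A = C then 1 else 0)"
    using matrix_inv_mult(1)[OF invertible_gmat[OF assms]]
    by (auto simp: matrix_matrix_mult_def mat_def vec_eq_iff)
  then show "(\<Sum>B\<in>UNIV. gi p B A * g p B C) = (if A = C then 1 else 0)"
    by (simp add: gi_eq gmat_def g_sym[OF assms, of C] mult.commute)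
qed

text \<open>Because \<open>g\<close> has only off-diagonal blocks, erasing the diagonal blocks of
  \<open>gi\<close> still leaves a left inverse of \<open>g\<close>, which is unique.\<close>

lemma gi_pure:
  assumes "p \<in> U" "isl A = isl B"
  shows "gi p A B = 0"
proof -
  have "gi p A B = (if isl A = isl B then 0 else gi p A B)"
  proof (rule gi_uniqueI)
    fix A C
    have "(\<Sum>B\<in>UNIV. (if isl A = isl B then 0 else gi p A B) * g p B C) =
        (if isl A = isl C then \<Sum>B\<in>UNIV. gi p A B * g p B C else 0)"
      using g_pure[OF assms(1)] by (auto intro!: sum.cong sum.neutral split: if_splits)
    also have "\<dots> = (if A = C then 1 else 0)"
      by (simp add: gi_g[OF assms(1)])
    finally show "(\<Sum>B\<in>UNIV. (if isl A = isl B then 0 else gi p A B) * g p B C) = (if A = C then 1 else 0)" .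
  qed
  with assms show ?thesis by simp
qed

abbreviation "k p \<alpha> \<beta> \<equiv> gi p (Hol \<alpha>) (Bar \<beta>)"
abbreviation "h p \<alpha> \<beta> \<equiv> g p (Hol \<alpha>) (Bar \<beta>)"
abbreviation "\<Gamma> \<epsilon> \<mu> \<nu> \<equiv> christoffel M c (Hol \<epsilon>) (Hol \<mu>) (Hol \<nu>)"

lemma k_h:
  assumes "p \<in> U"
  shows "(\<Sum>\<beta>\<in>UNIV. k p \<alpha> \<beta> * h p \<gamma> \<beta>) = (if \<alpha> = \<gamma> then 1 else 0)"
    "(\<Sum>\<alpha>\<in>UNIV. k p \<alpha> \<beta> * h p \<alpha> \<gamma>) = (if \<beta> = \<gamma> then 1 else 0)"
  using gi_g[OF assms, of "Hol \<alpha>" "Hol \<gamma>"] gi_g[OF assms, of "Bar \<beta>" "Bar \<gamma>"]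
  by (simp_all add: sum_cidx g_pure[OF assms] gi_pure[OF assms] g_sym[OF assms, of "Bar _" "Hol _"]
      gi_sym[OF assms, of "Bar _" "Hol _"])

section \<open>Christoffel symbols and Ricci curvature of the Kaehler metric\<close>

lemma cpartial_g_pure: "p \<in> U \<Longrightarrow> isl A = isl B \<Longrightarrow> cpartial C (\<lambda>q. g q A B) p = 0"
  using cpartial_cong[OF open_U, of p "\<lambda>q. g q A B" "\<lambda>q. 0" C] by (simp add: g_pure)

lemma cpartial_g_sym: "p \<in> U \<Longrightarrow> cpartial C (\<lambda>q. g q A B) p = cpartial C (\<lambda>q. g q B A) p"
  using cpartial_cong[OF open_U, of p "\<lambda>q. g q A B" "\<lambda>q. g q B A" C] g_sym by blast

text \<open>Whatever the type of \<open>C\<close>, one of the three derivatives is that of a pure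
  component and the other two cancel by \<open>kaehler\<close>.\<close>

lemma christoffel_mixed:
  assumes "p \<in> U" "isl A \<noteq> isl B"
  shows "christoffel M c E A B p = 0"
proof -
  have "cpartial A (\<lambda>q. g q B C) p + cpartial B (\<lambda>q. g q A C) p - cpartial C (\<lambda>q. g q A B) p = 0" for C
  proof (cases "isl C = isl A")
    case True
    then show ?thesis
      using assms kaehler[OF assms(1), of A C B] cpartial_g_sym[OF assms(1), of A B C]
        cpartial_g_pure[OF assms(1), of A C B] by simp
  next
    case False
    then have "isl C = isl B" using assms(2) by auto
    then show ?thesis
      using assms kaehler[OF assms(1), of B C A] cpartial_g_sym[OF assms(1), of B A C]
        cpartial_g_pure[OF assms(1), of B C A] cpartial_g_sym[OF assms(1), of C A B] by simp
  qed
  then show ?thesis by (simp add: christoffel_def)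
qed

lemma christoffel_sym: "p \<in> U \<Longrightarrow> christoffel M c E A B p = christoffel M c E B A p"
  by (simp add: christoffel_def add.commute cpartial_g_sym[of p _ A B])

text \<open>The third derivative is that of a pure component and the first two agree by
  \<open>kaehler\<close>, which absorbs the factor 1/2.\<close>

lemma christoffel_pure:
  assumes "p \<in> U" "isl A = isl B"
  shows "christoffel M c E A B p = (\<Sum>C\<in>UNIV. gi p E C * cpartial A (\<lambda>q. g q B C) p)"
  unfolding christoffel_def sum_divide_distrib
proof (intro sum.cong refl)
  fix C
  show "gi p E C * (cpartial A (\<lambda>q. g q B C) p + cpartial B (\<lambda>q. g q A C) p - cpartial C (\<lambda>q. g q A B) p) / 2 =
      gi p E C * cpartial A (\<lambda>q. g q B C) p"
    using kaehler[OF assms, of C] by (simp add: cpartial_g_pure[OF assms])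
qed

lemma christoffel_mixed_up:
  assumes "p \<in> U" "isl A = isl B" "isl E \<noteq> isl A"
  shows "christoffel M c E A B p = 0"
  unfolding christoffel_pure[OF assms(1,2)]
proof (intro sum.neutral ballI)
  fix C
  show "gi p E C * cpartial A (\<lambda>q. g q B C) p = 0"
    using gi_pure[OF assms(1), of E C] cpartial_g_pure[OF assms(1), of B C A] assms(2,3) by auto
qed

lemma christoffel_hol: "p \<in> U \<Longrightarrow> \<Gamma> \<epsilon> \<mu> \<nu> p = (\<Sum>\<tau>\<in>UNIV. k p \<epsilon> \<tau> * cpartial (Hol \<mu>) (\<lambda>q. h q \<nu> \<tau>) p)"
  by (simp add: christoffel_pure sum_cidx gi_pure)

lemma invariant_christoffel: "invariant_on (0, 1) U (christoffel M c E A B)"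
  unfolding christoffel_def divide_inverse
  by (intro invariant_on_intros open_U invariant_gi invariant_on_cpartial[OF open_U invariant_g])

lemma cpartial_christoffel_mixed:
  assumes "p \<in> U" "isl A \<noteq> isl B"
  shows "cpartial C (christoffel M c E A B) p = 0"
  using cpartial_cong[OF open_U assms(1), of "christoffel M c E A B" "\<lambda>q. 0" C] christoffel_mixed assms(2) by simp

text \<open>Every other term of \<open>curv\<close> contains a mixed symbol, the derivative of one,
  or a symbol whose upper index differs in type from its lower ones.\<close>

lemma curv_eq:
  assumes "p \<in> U"
  shows "curv M c (Hol \<epsilon>) (Hol \<mu>) (Bar \<beta>) (Hol \<alpha>) p = cpartial (Bar \<beta>) (\<Gamma> \<epsilon> \<mu> \<alpha>) p"
  by (simp add: curv_def sum_cidx christoffel_mixed[OF assms] christoffel_mixed_up[OF assms]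
      cpartial_christoffel_mixed[OF assms])

text \<open>Contraction with \<open>k\<close> undoes the lowering in \<open>curv_low\<close>, so the
  Ricci tensor is the trace over the upper index and the first lower one.\<close>

lemma ricci_eq:
  assumes "p \<in> U"
  shows "ricci M c \<beta> \<mu> p = (\<Sum>\<kappa>\<in>UNIV. cpartial (Bar \<beta>) (\<Gamma> \<kappa> \<kappa> \<mu>) p)"
proof -
  have "ricci M c \<beta> \<mu> p =
      (\<Sum>\<kappa>\<in>UNIV. \<Sum>\<epsilon>\<in>UNIV. (\<Sum>\<nu>\<in>UNIV. k p \<kappa> \<nu> * h p \<epsilon> \<nu>) * cpartial (Bar \<beta>) (\<Gamma> \<epsilon> \<kappa> \<mu>) p)"
    unfolding ricci_def curv_low_def curv_eq[OF assms] sum_distrib_left sum_distrib_right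
    by (rule sum.cong[OF refl], subst sum.swap) (simp add: mult.assoc)
  then show ?thesis
    by (simp add: k_h[OF assms] sum_UNIV_delta)
qed

text \<open>The fully lowered curvature is \<open>\<partial>\<^sub>\<tau> \<partial>\<^sub>\<mu> h - (\<partial>\<^sub>\<tau> h) \<Gamma>\<close> with \<open>\<tau>\<close> barred, which is symmetric in both pairs of
  indices of equal type.\<close>

definition curv4 :: "3 \<Rightarrow> 3 \<Rightarrow> 3 \<Rightarrow> 3 \<Rightarrow> coords \<Rightarrow> complex" where
  "curv4 \<kappa> \<mu> \<tau> \<sigma> p = (\<Sum>\<epsilon>\<in>UNIV. h p \<epsilon> \<kappa> * cpartial (Bar \<tau>) (\<Gamma> \<epsilon> \<mu> \<sigma>) p)"

lemma h_christoffel: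
  assumes "p \<in> U"
  shows "(\<Sum>\<epsilon>\<in>UNIV. h p \<epsilon> \<kappa> * \<Gamma> \<epsilon> \<mu> \<sigma> p) = cpartial (Hol \<mu>) (\<lambda>q. h q \<sigma> \<kappa>) p"
proof -
  have "(\<Sum>\<epsilon>\<in>UNIV. h p \<epsilon> \<kappa> * \<Gamma> \<epsilon> \<mu> \<sigma> p) =
      (\<Sum>\<tau>\<in>UNIV. (\<Sum>\<epsilon>\<in>UNIV. k p \<epsilon> \<tau> * h p \<epsilon> \<kappa>) * cpartial (Hol \<mu>) (\<lambda>q. h q \<sigma> \<tau>) p)"
    unfolding christoffel_hol[OF assms] sum_distrib_left sum_distrib_right
    by (subst sum.swap) (simp add: mult_ac)
  then show ?thesis
    by (simp add: k_h[OF assms] sum_UNIV_delta)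
qed

lemma curv4_eq:
  assumes "p \<in> U"
  shows "curv4 \<kappa> \<mu> \<tau> \<sigma> p = cpartial (Bar \<tau>) (\<lambda>q. cpartial (Hol \<mu>) (\<lambda>q. h q \<sigma> \<kappa>) q) p
     - (\<Sum>\<epsilon>\<in>UNIV. cpartial (Bar \<tau>) (\<lambda>q. h q \<epsilon> \<kappa>) p * \<Gamma> \<epsilon> \<mu> \<sigma> p)"
proof -
  note d = differentiable_of_invariant[OF invariant_g assms]
    differentiable_of_invariant[OF invariant_christoffel assms]
  have "cpartial (Bar \<tau>) (\<lambda>q. cpartial (Hol \<mu>) (\<lambda>q. h q \<sigma> \<kappa>) q) p =
      cpartial (Bar \<tau>) (\<lambda>q. \<Sum>\<epsilon>\<in>UNIV. h q \<epsilon> \<kappa> * \<Gamma> \<epsilon> \<mu> \<sigma> q) p"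
    by (rule cpartial_cong[OF open_U assms]) (simp add: h_christoffel)
  also have "\<dots> = (\<Sum>\<epsilon>\<in>UNIV. cpartial (Bar \<tau>) (\<lambda>q. h q \<epsilon> \<kappa>) p * \<Gamma> \<epsilon> \<mu> \<sigma> p +
      h p \<epsilon> \<kappa> * cpartial (Bar \<tau>) (\<Gamma> \<epsilon> \<mu> \<sigma>) p)"
    by (subst cpartial_sum) (auto intro!: sum.cong cpartial_mult derivative_intros d)
  finally show ?thesis
    by (simp add: curv4_def sum.distrib)
qed

text \<open>For the barred pair both terms of \<open>curv4_eq\<close> are symmetric, by
  \<open>kaehler\<close> for barred indices; for the unbarred pair it is the symmetry of \<Gamma> in
  its lower indices.\<close>

lemma curv4_sym:
  assumes "p \<in> U"
  shows "curv4 \<kappa> \<mu> \<tau> \<sigma> p = curv4 \<tau> \<mu> \<kappa> \<sigma> p" "curv4 \<kappa> \<mu> \<tau> \<sigma> p = curv4 \<kappa> \<sigma> \<tau> \<mu> p"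
proof -
  have kb: "cpartial (Bar \<tau>) (\<lambda>q. h q \<epsilon> \<kappa>) p = cpartial (Bar \<kappa>) (\<lambda>q. h q \<epsilon> \<tau>) p" if "p \<in> U" for \<tau> \<epsilon> \<kappa> p
    using kaehler[OF that, of "Bar \<tau>" "Bar \<kappa>" "Hol \<epsilon>"] cpartial_g_sym[OF that, of _ "Hol \<epsilon>"] by simp
  have "cpartial (Bar \<tau>) (\<lambda>q. cpartial (Hol \<mu>) (\<lambda>q. h q \<sigma> \<kappa>) q) p =
      cpartial (Hol \<mu>) (\<lambda>q. cpartial (Bar \<tau>) (\<lambda>q. h q \<sigma> \<kappa>) q) p" for \<tau> \<kappa>
    by (rule cpartial_commute[OF open_U invariant_on_smooth[OF invariant_g] assms])
  moreover have "cpartial (Hol \<mu>) (\<lambda>q. cpartial (Bar \<tau>) (\<lambda>q. h q \<sigma> \<kappa>) q) p =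
      cpartial (Hol \<mu>) (\<lambda>q. cpartial (Bar \<kappa>) (\<lambda>q. h q \<sigma> \<tau>) q) p"
    by (rule cpartial_cong[OF open_U assms kb])
  ultimately show "curv4 \<kappa> \<mu> \<tau> \<sigma> p = curv4 \<tau> \<mu> \<kappa> \<sigma> p"
    by (simp add: curv4_eq[OF assms] kb[OF assms, of \<tau> _ \<kappa>])
  have "cpartial (Bar \<tau>) (\<Gamma> \<epsilon> \<mu> \<sigma>) p = cpartial (Bar \<tau>) (\<Gamma> \<epsilon> \<sigma> \<mu>) p" for \<epsilon>
    by (rule cpartial_cong[OF open_U assms christoffel_sym])
  then show "curv4 \<kappa> \<mu> \<tau> \<sigma> p = curv4 \<kappa> \<sigma> \<tau> \<mu> p"
    by (simp add: curv4_def)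
qed

lemma curv_eq_curv4:
  assumes "p \<in> U"
  shows "cpartial (Bar \<tau>) (\<Gamma> \<epsilon> \<mu> \<sigma>) p = (\<Sum>\<kappa>\<in>UNIV. k p \<epsilon> \<kappa> * curv4 \<kappa> \<mu> \<tau> \<sigma> p)"
proof -
  have "(\<Sum>\<kappa>\<in>UNIV. k p \<epsilon> \<kappa> * curv4 \<kappa> \<mu> \<tau> \<sigma> p) =
      (\<Sum>\<gamma>\<in>UNIV. (\<Sum>\<kappa>\<in>UNIV. k p \<epsilon> \<kappa> * h p \<gamma> \<kappa>) * cpartial (Bar \<tau>) (\<Gamma> \<gamma> \<mu> \<sigma>) p)"
    unfolding curv4_def sum_distrib_left sum_distrib_right
    by (subst sum.swap) (simp add: mult_ac)
  then show ?thesis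
    by (simp add: k_h[OF assms] sum_UNIV_delta)
qed

text \<open>The left side, which arises from the rough Laplacian, traces over the direction of the
  barred derivative, whereas Ricci traces over the barred index lowered from the upper one. The
  symmetry of \<open>curv4\<close> exchanges these two.\<close>

lemma ricci_contraction:
  assumes "p \<in> U"
  shows "(\<Sum>\<sigma>\<in>UNIV. \<Sum>\<tau>\<in>UNIV. k p \<sigma> \<tau> * cpartial (Bar \<tau>) (\<Gamma> \<epsilon> \<sigma> \<mu>) p) =
    (\<Sum>\<beta>\<in>UNIV. k p \<epsilon> \<beta> * ricci M c \<beta> \<mu> p)"
proof -
  have "(\<Sum>\<sigma>\<in>UNIV. \<Sum>\<tau>\<in>UNIV. k p \<sigma> \<tau> * cpartial (Bar \<tau>) (\<Gamma> \<epsilon> \<sigma> \<mu>) p) =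
      (\<Sum>\<sigma>\<in>UNIV. \<Sum>\<tau>\<in>UNIV. \<Sum>\<kappa>\<in>UNIV. k p \<epsilon> \<kappa> * (k p \<sigma> \<tau> * curv4 \<tau> \<sigma> \<kappa> \<mu> p))"
    unfolding curv_eq_curv4[OF assms] sum_distrib_left
    using curv4_sym(1)[OF assms] by (intro sum.cong refl) (simp add: mult_ac)
  also have "\<dots> = (\<Sum>\<sigma>\<in>UNIV. \<Sum>\<kappa>\<in>UNIV. \<Sum>\<tau>\<in>UNIV. k p \<epsilon> \<kappa> * (k p \<sigma> \<tau> * curv4 \<tau> \<sigma> \<kappa> \<mu> p))"
    by (intro sum.cong refl sum.swap)
  also have "\<dots> = (\<Sum>\<kappa>\<in>UNIV. \<Sum>\<sigma>\<in>UNIV. \<Sum>\<tau>\<in>UNIV. k p \<epsilon> \<kappa> * (k p \<sigma> \<tau> * curv4 \<tau> \<sigma> \<kappa> \<mu> p))"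
    by (rule sum.swap)
  finally show ?thesis
    unfolding ricci_eq[OF assms] curv_eq_curv4[OF assms] sum_distrib_left .
qed

text \<open>The inverse metric is parallel: \<open>k h = 1\<close> is differentiated, the derivative
  of \<open>h\<close> is recognised as \<Gamma>, and multiplication by \<open>k\<close> removes the
  remaining \<open>h\<close>.\<close>

lemma cpartial_k:
  assumes "p \<in> U"
  shows "cpartial (Hol \<mu>) (\<lambda>q. k q \<sigma> \<tau>) p = - (\<Sum>\<epsilon>\<in>UNIV. \<Gamma> \<sigma> \<mu> \<epsilon> p * k p \<epsilon> \<tau>)"
proof -
  note d = differentiable_of_invariant[OF invariant_g assms] differentiable_of_invariant[OF invariant_gi assms]
  have "(\<Sum>\<beta>\<in>UNIV. cpartial (Hol \<mu>) (\<lambda>q. k q \<sigma> \<beta>) p * h p \<gamma> \<beta>) = - \<Gamma> \<sigma> \<mu> \<gamma> p" for \<gamma>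
  proof -
    have "cpartial (Hol \<mu>) (\<lambda>q. \<Sum>\<beta>\<in>UNIV. k q \<sigma> \<beta> * h q \<gamma> \<beta>) p =
        cpartial (Hol \<mu>) (\<lambda>q. if \<sigma> = \<gamma> then 1 else 0) p"
      by (rule cpartial_cong[OF open_U assms]) (simp add: k_h)
    moreover have "cpartial (Hol \<mu>) (\<lambda>q. \<Sum>\<beta>\<in>UNIV. k q \<sigma> \<beta> * h q \<gamma> \<beta>) p =
        (\<Sum>\<beta>\<in>UNIV. cpartial (Hol \<mu>) (\<lambda>q. k q \<sigma> \<beta>) p * h p \<gamma> \<beta> + k p \<sigma> \<beta> * cpartial (Hol \<mu>) (\<lambda>q. h q \<gamma> \<beta>) p)"
      by (subst cpartial_sum) (auto intro!: sum.cong cpartial_mult derivative_intros d)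
    ultimately show ?thesis
      by (simp add: sum.distrib christoffel_hol[OF assms] add_eq_0_iff2)
  qed
  then have "(\<Sum>\<epsilon>\<in>UNIV. \<Gamma> \<sigma> \<mu> \<epsilon> p * k p \<epsilon> \<tau>) =
      - (\<Sum>\<epsilon>\<in>UNIV. (\<Sum>\<beta>\<in>UNIV. cpartial (Hol \<mu>) (\<lambda>q. k q \<sigma> \<beta>) p * h p \<epsilon> \<beta>) * k p \<epsilon> \<tau>)"
    by (simp add: sum_negf)
  also have "\<dots> = - (\<Sum>\<beta>\<in>UNIV. cpartial (Hol \<mu>) (\<lambda>q. k q \<sigma> \<beta>) p * (\<Sum>\<epsilon>\<in>UNIV. k p \<epsilon> \<tau> * h p \<epsilon> \<beta>))"
    unfolding sum_distrib_left sum_distrib_right by (subst sum.swap) (simp add: mult_ac)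
  finally show ?thesis
    by (simp add: k_h[OF assms] sum_UNIV_delta)
qed

end

section \<open>The Weitzenboeck formula in a foliated chart and frame\<close>

lemma comm_simps:
  "comm (X + Y) Z = comm X Z + comm Y Z" "comm X (Y + Z) = comm X Y + comm X Z"
  "comm (X - Y) Z = comm X Z - comm Y Z" "comm X (Y - Z) = comm X Y - comm X Z"
  "comm (- X) Z = - comm X Z" "comm X (- Z) = - comm X Z"
  "comm (cscale a X) Z = cscale a (comm X Z)" "comm X (cscale a Z) = cscale a (comm X Z)"
  "comm 0 Z = 0" "comm X 0 = 0"
  by (auto simp: comm_def matrix_ring_simps cscale_simps)

lemma comm_sum_left: "comm (\<Sum>i\<in>I. X i) Z = (\<Sum>i\<in>I. comm (X i) Z)"
  by (induction I rule: infinite_finite_induct) (auto simp: comm_simps)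

lemma comm_sum_right: "comm Z (\<Sum>i\<in>I. X i) = (\<Sum>i\<in>I. comm Z (X i))"
  by (induction I rule: infinite_finite_induct) (auto simp: comm_simps)

text \<open>The Jacobi identity for brackets taken on the right; it accounts for the quadratic term,
  and its minus sign, in \<open>curvF\<close>.\<close>

lemma comm_jacobi: "comm (comm X Y) Z - comm (comm X Z) Y = comm X (comm Y Z)"
  by (simp add: comm_def matrix_ring_simps matrix_mul_assoc algebra_simps)

lemma differentiable_matrix_mult:
  fixes X Y :: "'a::real_normed_vector \<Rightarrow> 'r::finite mat"
  shows "X differentiable (at p) \<Longrightarrow> Y differentiable (at p) \<Longrightarrow> (\<lambda>q. X q ** Y q) differentiable (at p)"
  unfolding differentiable_def using bounded_bilinear.FDERIV[OF bounded_bilinear_matrix_mult] by blast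

lemma cpartialM_comm:
  "X differentiable (at p) \<Longrightarrow> Y differentiable (at p) \<Longrightarrow>
    cpartialM A (\<lambda>q. comm (X q) (Y q)) p = comm (cpartialM A X p) (Y p) + comm (X p) (cpartialM A Y p)"
  by (simp add: comm_def cpartialM_diff cpartialM_matrix_mult differentiable_matrix_mult algebra_simps)

locale chart_connection = foliated_chart M c
  for M :: "'m::topological_space sasakian_data" and c +
  fixes \<alpha> :: "coords \<Rightarrow> coords \<Rightarrow> 'r::finite mat" and V :: "coords set"
  assumes open_V: "open V" and V_subset: "V \<subseteq> snd c ` fst c"
    and smooth_connection: "\<And>v. smooth_on V (\<lambda>p. \<alpha> p v)"
begin

text \<open>The gauge part of \<open>nabt\<close>, without Christoffel terms. It acts on a single
  component function, and its commutators involve only the curvature of the connection.\<close>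

definition dd :: "cidx \<Rightarrow> (coords \<Rightarrow> 'r mat) \<Rightarrow> coords \<Rightarrow> 'r mat" where
  "dd A X p = cpartialM A X p + comm (X p) (connA \<alpha> A p)"

lemma smooth_connA: "invariant_on 0 V (connA \<alpha> A)"
  unfolding connA_def cextM_eq
  by (intro invariant_on_intros open_V) (simp_all add: invariant_on_zero smooth_connection)

lemma smooth_dd: "invariant_on 0 V X \<Longrightarrow> invariant_on 0 V (dd A X)"
  unfolding dd_def by (intro invariant_on_intros invariant_on_cpartialM open_V smooth_connA)

lemma differentiable_V: "invariant_on 0 V f \<Longrightarrow> p \<in> V \<Longrightarrow> f differentiable (at p)"
  by (simp add: invariant_on_zero smooth_on_differentiable)

lemma smooth_of_basic: "invariant_on (0, 1) (snd c ` fst c) f \<Longrightarrow> invariant_on 0 V f"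
  using invariant_on_smooth invariant_on_zero invariant_on_subset[OF _ V_subset] by blast

lemmas smooth_christoffel = smooth_of_basic[OF invariant_christoffel]
lemmas smooth_gi = smooth_of_basic[OF invariant_gi]

lemma in_U: "p \<in> V \<Longrightarrow> p \<in> snd c ` fst c"
  using V_subset by blast

lemma dd_cong: "p \<in> V \<Longrightarrow> (\<And>q. q \<in> V \<Longrightarrow> X q = Y q) \<Longrightarrow> dd A X p = dd A Y p"
  using cpartialM_cong[OF open_V, of p X Y A] by (simp add: dd_def)

lemma dd_add:
  assumes "invariant_on 0 V X" "invariant_on 0 V Y" "p \<in> V"
  shows "dd A (\<lambda>q. X q + Y q) p = dd A X p + dd A Y p"
  by (simp add: dd_def cpartialM_add comm_simps differentiable_V[OF _ assms(3)] assms)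

lemma dd_diff:
  assumes "invariant_on 0 V X" "invariant_on 0 V Y" "p \<in> V"
  shows "dd A (\<lambda>q. X q - Y q) p = dd A X p - dd A Y p"
  by (simp add: dd_def cpartialM_diff comm_simps differentiable_V[OF _ assms(3)] assms)

lemma dd_minus:
  assumes "invariant_on 0 V X" "p \<in> V"
  shows "dd A (\<lambda>q. - X q) p = - dd A X p"
  by (simp add: dd_def cpartialM_minus comm_simps differentiable_V assms)

lemma dd_sum:
  assumes "\<And>i. i \<in> I \<Longrightarrow> invariant_on 0 V (X i)" "p \<in> V"
  shows "dd A (\<lambda>q. \<Sum>i\<in>I. X i q) p = (\<Sum>i\<in>I. dd A (X i) p)"
  by (simp add: dd_def cpartialM_sum comm_sum_left sum.distrib differentiable_V assms)

lemma dd_cscale: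
  assumes "invariant_on 0 V a" "invariant_on 0 V X" "p \<in> V"
  shows "dd A (\<lambda>q. cscale (a q) (X q)) p = cscale (cpartial A a p) (X p) + cscale (a p) (dd A X p)"
  by (simp add: dd_def cpartialM_cscale comm_simps cscale_simps differentiable_V assms)

lemma dd_commutator:
  assumes "invariant_on 0 V X" "p \<in> V"
  shows "dd A (dd B X) p - dd B (dd A X) p = comm (X p) (curvF \<alpha> A B p)"
proof -
  have d: "X differentiable (at p)" "connA \<alpha> A differentiable (at p)" "cpartialM A X differentiable (at p)" for A
    using assms smooth_connA by (auto intro!: differentiable_V invariant_on_cpartialM open_V)
  have c: "(\<lambda>q. comm (X q) (connA \<alpha> A q)) differentiable (at p)" for A
    using assms smooth_connA by (intro differentiable_V invariant_on_comm open_V)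
  have "dd A (dd B X) p = cpartialM A (\<lambda>q. cpartialM B X q) p
     + (comm (cpartialM A X p) (connA \<alpha> B p) + comm (X p) (cpartialM A (connA \<alpha> B) p))
     + (comm (cpartialM B X p) (connA \<alpha> A p) + comm (comm (X p) (connA \<alpha> B p)) (connA \<alpha> A p))" for A B
    unfolding dd_def by (simp add: cpartialM_add cpartialM_comm d c comm_simps)
  moreover have "cpartialM A (\<lambda>q. cpartialM B X q) p = cpartialM B (\<lambda>q. cpartialM A X q) p"
    using assms by (intro cpartialM_commute[OF open_V]) (simp_all add: invariant_on_zero)
  ultimately show ?thesis
    using comm_jacobi[of "X p" "connA \<alpha> A p" "connA \<alpha> B p"]
    by (simp add: curvF_def comm_simps algebra_simps)
qed

lemma nabt_bar2:
  assumes "p \<in> V"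
  shows "nabt M c \<alpha> T [Bar \<tau>, Hol \<mu>, Hol \<nu>] p = dd (Bar \<tau>) (T [Hol \<mu>, Hol \<nu>]) p"
  by (simp add: nabt_def dd_def numeral_2_eq_2 lessThan_Suc christoffel_mixed[OF in_U[OF assms]] cscale_simps)

lemma nabt_bar3:
  assumes "p \<in> V"
  shows "nabt M c \<alpha> T [Bar \<tau>, Hol \<sigma>, Hol \<mu>, Hol \<nu>] p = dd (Bar \<tau>) (T [Hol \<sigma>, Hol \<mu>, Hol \<nu>]) p"
  by (simp add: nabt_def dd_def lessThan_Suc christoffel_mixed[OF in_U[OF assms]] cscale_simps)

lemma nabt_hol1:
  assumes "p \<in> V"
  shows "nabt M c \<alpha> T [Hol \<mu>, Hol \<nu>] p =
    dd (Hol \<mu>) (T [Hol \<nu>]) p - (\<Sum>\<epsilon>\<in>UNIV. cscale (\<Gamma> \<epsilon> \<mu> \<nu> p) (T [Hol \<epsilon>] p))"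
  by (simp add: nabt_def dd_def lessThan_Suc sum_cidx christoffel_mixed_up[OF in_U[OF assms]] cscale_simps)

lemma nabt_hol2:
  assumes "p \<in> V"
  shows "nabt M c \<alpha> T [Hol \<sigma>, Hol \<mu>, Hol \<nu>] p =
    dd (Hol \<sigma>) (T [Hol \<mu>, Hol \<nu>]) p - (\<Sum>\<epsilon>\<in>UNIV. cscale (\<Gamma> \<epsilon> \<sigma> \<mu> p) (T [Hol \<epsilon>, Hol \<nu>] p))
      - (\<Sum>\<epsilon>\<in>UNIV. cscale (\<Gamma> \<epsilon> \<sigma> \<nu> p) (T [Hol \<mu>, Hol \<epsilon>] p))"
  by (simp add: nabt_def dd_def lessThan_Suc sum_cidx christoffel_mixed_up[OF in_U[OF assms]] cscale_simps)

text \<open>Barred derivatives of purely holomorphic components involve no Christoffel symbols; the unbarred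
  ones remaining in the rough Laplacian come from the derivative of \<open>k\<close> in the divergence.\<close>

lemma weitzenboeck:
  assumes p: "p \<in> V"
    and smooth: "\<And>\<mu> \<nu>. invariant_on 0 V (T [Hol \<mu>, Hol \<nu>])"
    and anti: "\<And>q \<mu> \<nu>. q \<in> V \<Longrightarrow> T [Hol \<nu>, Hol \<mu>] q = - T [Hol \<mu>, Hol \<nu>] q"
  shows "laplace M c \<alpha> T [Hol \<mu>, Hol \<nu>] p =
      - (\<Sum>\<sigma>\<in>UNIV. \<Sum>\<tau>\<in>UNIV. cscale (k p \<sigma> \<tau>)
           (nabt M c \<alpha> (nabt M c \<alpha> T) [Bar \<tau>, Hol \<sigma>, Hol \<mu>, Hol \<nu>] p))
      - (\<Sum>\<sigma>\<in>UNIV. \<Sum>\<tau>\<in>UNIV. cscale (k p \<sigma> \<tau>)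
           (comm (T [Hol \<sigma>, Hol \<nu>] p) (curvF \<alpha> (Hol \<mu>) (Bar \<tau>) p)
            - comm (T [Hol \<sigma>, Hol \<mu>] p) (curvF \<alpha> (Hol \<nu>) (Bar \<tau>) p)))
      - (\<Sum>\<sigma>\<in>UNIV. \<Sum>\<tau>\<in>UNIV. cscale (k p \<sigma> \<tau>)
           (cscale (ricci M c \<tau> \<mu> p) (T [Hol \<sigma>, Hol \<nu>] p)
            - cscale (ricci M c \<tau> \<nu> p) (T [Hol \<sigma>, Hol \<mu>] p)))"
proof -
  define t where "t \<mu> \<nu> = T [Hol \<mu>, Hol \<nu>]" for \<mu> \<nu>
  have t: "invariant_on 0 V (t \<mu> \<nu>)" for \<mu> \<nu>
    using smooth by (simp add: t_def)
  have t_anti: "t \<nu> \<mu> q = - t \<mu> \<nu> q" if "q \<in> V" for q \<mu> \<nu>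
    using anti[OF that] unfolding t_def .
  have dd_anti: "dd A (t \<nu> \<mu>) q = - dd A (t \<mu> \<nu>) q" if "q \<in> V" for A q \<mu> \<nu>
    using dd_cong[OF that, of "t \<nu> \<mu>" "\<lambda>q. - t \<mu> \<nu> q" A, OF t_anti] dd_minus[OF t that] by simp
  have dd2_anti: "dd A (dd B (t \<nu> \<mu>)) p = - dd A (dd B (t \<mu> \<nu>)) p" for A B \<mu> \<nu>
    using dd_cong[OF p, of "dd B (t \<nu> \<mu>)" "\<lambda>q. - dd B (t \<mu> \<nu>) q" A, OF dd_anti]
      dd_minus[OF smooth_dd[OF t] p] by simp
  \<comment> \<open>\<open>K\<close> and \<open>K'\<close> carry the two orders of an unbarred and a
    barred derivative, so their difference is \<F>. \<open>Z\<close> is the second-order part of the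
    rough Laplacian, \<open>G\<close> has \<Gamma> times a first derivative, and \<open>Q\<close>
    the barred derivative of \<Gamma>. In the final count \<open>G\<close> occurs equally in
    \<open>del1\<close> and in the rough Laplacian, and \<open>Q\<close> cancels against
    \<R>.\<close>
  define K where "K \<mu> \<nu> = (\<Sum>\<sigma>\<in>UNIV. \<Sum>\<tau>\<in>UNIV. cscale (k p \<sigma> \<tau>) (dd (Hol \<mu>) (dd (Bar \<tau>) (t \<sigma> \<nu>)) p))" for \<mu> \<nu>
  define K' where "K' \<mu> \<nu> = (\<Sum>\<sigma>\<in>UNIV. \<Sum>\<tau>\<in>UNIV. cscale (k p \<sigma> \<tau>) (dd (Bar \<tau>) (dd (Hol \<mu>) (t \<sigma> \<nu>)) p))" for \<mu> \<nu>
  define G where "G \<mu> \<nu> = (\<Sum>\<sigma>\<in>UNIV. \<Sum>\<tau>\<in>UNIV. \<Sum>\<epsilon>\<in>UNIV.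
      cscale (k p \<sigma> \<tau>) (cscale (\<Gamma> \<epsilon> \<sigma> \<mu> p) (dd (Bar \<tau>) (t \<epsilon> \<nu>) p)))" for \<mu> \<nu>
  define Z where "Z = (\<Sum>\<sigma>\<in>UNIV. \<Sum>\<tau>\<in>UNIV. cscale (k p \<sigma> \<tau>) (dd (Bar \<tau>) (dd (Hol \<sigma>) (t \<mu> \<nu>)) p))"
  define Q where "Q \<mu> \<nu> = (\<Sum>\<sigma>\<in>UNIV. \<Sum>\<tau>\<in>UNIV. \<Sum>\<epsilon>\<in>UNIV.
      cscale (k p \<sigma> \<tau>) (cscale (cpartial (Bar \<tau>) (\<Gamma> \<epsilon> \<sigma> \<mu>) p) (t \<epsilon> \<nu> p)))" for \<mu> \<nu>

  have del1: "del1 M c \<alpha> (delstar2 M c \<alpha> T) [Hol \<mu>, Hol \<nu>] p = (G \<mu> \<nu> - K \<mu> \<nu>) - (G \<nu> \<mu> - K \<nu> \<mu>)"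
  proof -
    define \<delta> where "\<delta> \<nu> q = - (\<Sum>\<sigma>\<in>UNIV. \<Sum>\<tau>\<in>UNIV. cscale (k q \<sigma> \<tau>) (dd (Bar \<tau>) (t \<sigma> \<nu>) q))" for \<nu> q
    have ds: "delstar2 M c \<alpha> T [Hol \<nu>] q = \<delta> \<nu> q" if "q \<in> V" for \<nu> q
      by (simp add: delstar2_def \<delta>_def nabt_bar2[OF that] t_def)
    have "dd (Hol \<mu>) (delstar2 M c \<alpha> T [Hol \<nu>]) p = G \<mu> \<nu> - K \<mu> \<nu>" for \<mu> \<nu>
    proof -
      have sm: "invariant_on 0 V (\<lambda>q. cscale (k q \<sigma> \<tau>) (dd (Bar \<tau>) (t \<sigma> \<nu>) q))" for \<sigma> \<tau>
        by (intro invariant_on_cscale open_V smooth_gi smooth_dd t)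
      have "dd (Hol \<mu>) (delstar2 M c \<alpha> T [Hol \<nu>]) p = dd (Hol \<mu>) (\<delta> \<nu>) p"
        using ds by (intro dd_cong p)
      also have "\<dots> = - (\<Sum>\<sigma>\<in>UNIV. \<Sum>\<tau>\<in>UNIV. dd (Hol \<mu>) (\<lambda>q. cscale (k q \<sigma> \<tau>) (dd (Bar \<tau>) (t \<sigma> \<nu>) q)) p)"
        unfolding \<delta>_def by (simp add: dd_minus dd_sum invariant_on_sum open_V sm p)
      also have "\<dots> = - (\<Sum>\<sigma>\<in>UNIV. \<Sum>\<tau>\<in>UNIV. cscale (cpartial (Hol \<mu>) (\<lambda>q. k q \<sigma> \<tau>) p) (dd (Bar \<tau>) (t \<sigma> \<nu>) p))
          - K \<mu> \<nu>"
        by (simp add: dd_cscale smooth_gi smooth_dd t p sum.distrib K_def)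
      \<comment> \<open>The sign in \<open>cpartial_k\<close> cancels the sign of the divergence;
        after the lower indices of \<Gamma> are exchanged, only the names \<sigma> and \<epsilon>
        differ from \<open>G\<close>.\<close>
      also have "- (\<Sum>\<sigma>\<in>UNIV. \<Sum>\<tau>\<in>UNIV. cscale (cpartial (Hol \<mu>) (\<lambda>q. k q \<sigma> \<tau>) p) (dd (Bar \<tau>) (t \<sigma> \<nu>) p)) =
          (\<Sum>\<sigma>\<in>UNIV. \<Sum>\<tau>\<in>UNIV. \<Sum>\<epsilon>\<in>UNIV. cscale (k p \<epsilon> \<tau>) (cscale (\<Gamma> \<sigma> \<epsilon> \<mu> p) (dd (Bar \<tau>) (t \<sigma> \<nu>) p)))"
        using christoffel_sym[OF in_U[OF p], of _ "Hol \<mu>"]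
        by (simp add: cpartial_k[OF in_U[OF p]] cscale_simps cscale_sum_left sum_negf mult.commute)
      also have "\<dots> = G \<mu> \<nu>"
        unfolding G_def
        by (subst sum.swap, subst sum.swap, rule sum.cong[OF refl], subst sum.swap) (rule refl)
      finally show ?thesis .
    qed
    \<comment> \<open>The Christoffel terms of the two covariant derivatives cancel by the symmetry
      of \<Gamma>.\<close>
    then show ?thesis
      using christoffel_sym[OF in_U[OF p], of _ "Hol \<nu>" "Hol \<mu>"]
      by (simp add: del1_def nabt_hol1[OF p])
  qed

  have del2: "delstar3 M c \<alpha> (del2 M c \<alpha> T) [Hol \<mu>, Hol \<nu>] p = - Z + K' \<mu> \<nu> - K' \<nu> \<mu>"
  proof -
    have W: "del2 M c \<alpha> T [Hol \<sigma>, Hol \<mu>, Hol \<nu>] q =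
        dd (Hol \<sigma>) (t \<mu> \<nu>) q + dd (Hol \<mu>) (t \<nu> \<sigma>) q + dd (Hol \<nu>) (t \<sigma> \<mu>) q" if "q \<in> V" for \<sigma> q
    proof -
      \<comment> \<open>The cyclic sum has six Christoffel terms; they cancel in pairs because
        \<Gamma> is symmetric and \<open>t\<close> antisymmetric.\<close>
      have "(\<Sum>\<epsilon>\<in>UNIV. cscale (\<Gamma> \<epsilon> \<mu> \<nu> q) (t \<epsilon> \<sigma> q)) = - (\<Sum>\<epsilon>\<in>UNIV. cscale (\<Gamma> \<epsilon> \<nu> \<mu> q) (t \<sigma> \<epsilon> q))" for \<mu> \<nu> \<sigma>
        using christoffel_sym[OF in_U[OF that], of _ "Hol \<mu>" "Hol \<nu>"] t_anti[OF that, of _ \<sigma>]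
        by (simp add: cscale_simps sum_negf)
      from this[of \<sigma> \<mu> \<nu>] this[of \<mu> \<nu> \<sigma>] this[of \<nu> \<sigma> \<mu>] show ?thesis
        by (simp add: del2_def nabt_hol2[OF that] t_def)
    qed
    have "dd (Bar \<tau>) (del2 M c \<alpha> T [Hol \<sigma>, Hol \<mu>, Hol \<nu>]) p =
        dd (Bar \<tau>) (dd (Hol \<sigma>) (t \<mu> \<nu>)) p - dd (Bar \<tau>) (dd (Hol \<mu>) (t \<sigma> \<nu>)) p
          + dd (Bar \<tau>) (dd (Hol \<nu>) (t \<sigma> \<mu>)) p" for \<sigma> \<tau>
    proof -
      have "dd (Bar \<tau>) (del2 M c \<alpha> T [Hol \<sigma>, Hol \<mu>, Hol \<nu>]) p =
          dd (Bar \<tau>) (\<lambda>q. dd (Hol \<sigma>) (t \<mu> \<nu>) q + dd (Hol \<mu>) (t \<nu> \<sigma>) q + dd (Hol \<nu>) (t \<sigma> \<mu>) q) p"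
        by (rule dd_cong[OF p W])
      then show ?thesis
        using dd2_anti[where A = "Bar \<tau>" and B = "Hol \<mu>" and \<mu> = \<sigma> and \<nu> = \<nu>] by (simp add: dd_add invariant_on_add open_V smooth_dd t p)
    qed
    then show ?thesis
      by (simp add: delstar3_def nabt_bar3[OF p] cscale_simps sum.distrib sum_subtractf Z_def K'_def)
  qed

  have rough: "(\<Sum>\<sigma>\<in>UNIV. \<Sum>\<tau>\<in>UNIV. cscale (k p \<sigma> \<tau>)
      (nabt M c \<alpha> (nabt M c \<alpha> T) [Bar \<tau>, Hol \<sigma>, Hol \<mu>, Hol \<nu>] p)) =
      Z - (Q \<mu> \<nu> + G \<mu> \<nu>) + (Q \<nu> \<mu> + G \<nu> \<mu>)"
  proof -
    have "nabt M c \<alpha> (nabt M c \<alpha> T) [Bar \<tau>, Hol \<sigma>, Hol \<mu>, Hol \<nu>] p =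
        dd (Bar \<tau>) (dd (Hol \<sigma>) (t \<mu> \<nu>)) p
        - (\<Sum>\<epsilon>\<in>UNIV. cscale (cpartial (Bar \<tau>) (\<Gamma> \<epsilon> \<sigma> \<mu>) p) (t \<epsilon> \<nu> p) + cscale (\<Gamma> \<epsilon> \<sigma> \<mu> p) (dd (Bar \<tau>) (t \<epsilon> \<nu>) p))
        + (\<Sum>\<epsilon>\<in>UNIV. cscale (cpartial (Bar \<tau>) (\<Gamma> \<epsilon> \<sigma> \<nu>) p) (t \<epsilon> \<mu> p) + cscale (\<Gamma> \<epsilon> \<sigma> \<nu> p) (dd (Bar \<tau>) (t \<epsilon> \<mu>) p))"
      for \<sigma> \<tau>
    proof -
      have sm: "invariant_on 0 V (\<lambda>q. cscale (\<Gamma> \<epsilon> \<sigma> \<mu> q) (t \<epsilon> \<nu> q))" for \<epsilon> \<mu> \<nu>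
        by (intro invariant_on_cscale open_V smooth_christoffel t)
      have "nabt M c \<alpha> T [Hol \<sigma>, Hol \<mu>, Hol \<nu>] q = dd (Hol \<sigma>) (t \<mu> \<nu>) q
          - (\<Sum>\<epsilon>\<in>UNIV. cscale (\<Gamma> \<epsilon> \<sigma> \<mu> q) (t \<epsilon> \<nu> q)) + (\<Sum>\<epsilon>\<in>UNIV. cscale (\<Gamma> \<epsilon> \<sigma> \<nu> q) (t \<epsilon> \<mu> q))" if "q \<in> V" for q
        using t_anti[OF that, of \<mu>] by (simp add: nabt_hol2[OF that] t_def[symmetric] cscale_simps sum_negf)
      then have "nabt M c \<alpha> (nabt M c \<alpha> T) [Bar \<tau>, Hol \<sigma>, Hol \<mu>, Hol \<nu>] p =
          dd (Bar \<tau>) (\<lambda>q. dd (Hol \<sigma>) (t \<mu> \<nu>) q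
          - (\<Sum>\<epsilon>\<in>UNIV. cscale (\<Gamma> \<epsilon> \<sigma> \<mu> q) (t \<epsilon> \<nu> q)) + (\<Sum>\<epsilon>\<in>UNIV. cscale (\<Gamma> \<epsilon> \<sigma> \<nu> q) (t \<epsilon> \<mu> q))) p"
        unfolding nabt_bar3[OF p] by (intro dd_cong p)
      also have "\<dots> = dd (Bar \<tau>) (dd (Hol \<sigma>) (t \<mu> \<nu>)) p
          - (\<Sum>\<epsilon>\<in>UNIV. dd (Bar \<tau>) (\<lambda>q. cscale (\<Gamma> \<epsilon> \<sigma> \<mu> q) (t \<epsilon> \<nu> q)) p)
          + (\<Sum>\<epsilon>\<in>UNIV. dd (Bar \<tau>) (\<lambda>q. cscale (\<Gamma> \<epsilon> \<sigma> \<nu> q) (t \<epsilon> \<mu> q)) p)"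
        by (simp add: dd_add dd_diff dd_sum invariant_on_diff invariant_on_sum open_V smooth_dd t sm p)
      finally show ?thesis
        by (simp add: dd_cscale smooth_christoffel t p)
    qed
    then show ?thesis
      by (simp add: cscale_simps cscale_sum_right sum.distrib sum_subtractf Z_def Q_def G_def)
  qed

  have curvature: "(\<Sum>\<sigma>\<in>UNIV. \<Sum>\<tau>\<in>UNIV. cscale (k p \<sigma> \<tau>)
           (comm (T [Hol \<sigma>, Hol \<nu>] p) (curvF \<alpha> (Hol \<mu>) (Bar \<tau>) p)
            - comm (T [Hol \<sigma>, Hol \<mu>] p) (curvF \<alpha> (Hol \<nu>) (Bar \<tau>) p))) =
      (K \<mu> \<nu> - K' \<mu> \<nu>) - (K \<nu> \<mu> - K' \<nu> \<mu>)"
    unfolding t_def[symmetric] dd_commutator[OF t p, symmetric]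
    by (simp add: cscale_simps sum_subtractf K_def K'_def)

  have Q: "(\<Sum>\<sigma>\<in>UNIV. \<Sum>\<tau>\<in>UNIV. cscale (k p \<sigma> \<tau>) (cscale (ricci M c \<tau> \<mu> p) (t \<sigma> \<nu> p))) = Q \<mu> \<nu>" for \<mu> \<nu>
  proof -
    have "(\<Sum>\<sigma>\<in>UNIV. \<Sum>\<tau>\<in>UNIV. cscale (k p \<sigma> \<tau>) (cscale (ricci M c \<tau> \<mu> p) (t \<sigma> \<nu> p))) =
        (\<Sum>\<epsilon>\<in>UNIV. cscale (\<Sum>\<beta>\<in>UNIV. k p \<epsilon> \<beta> * ricci M c \<beta> \<mu> p) (t \<epsilon> \<nu> p))"
      by (simp add: cscale_sum_left cscale_simps)
    also have "\<dots> = (\<Sum>\<epsilon>\<in>UNIV. \<Sum>\<sigma>\<in>UNIV. \<Sum>\<tau>\<in>UNIV.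
        cscale (k p \<sigma> \<tau>) (cscale (cpartial (Bar \<tau>) (\<Gamma> \<epsilon> \<sigma> \<mu>) p) (t \<epsilon> \<nu> p)))"
      by (simp add: ricci_contraction[OF in_U[OF p], symmetric] cscale_sum_left cscale_simps)
    also have "\<dots> = Q \<mu> \<nu>"
      unfolding Q_def by (subst sum.swap, rule sum.cong[OF refl], subst sum.swap) (rule refl)
    finally show ?thesis .
  qed
  have ricci: "(\<Sum>\<sigma>\<in>UNIV. \<Sum>\<tau>\<in>UNIV. cscale (k p \<sigma> \<tau>)
           (cscale (ricci M c \<tau> \<mu> p) (T [Hol \<sigma>, Hol \<nu>] p)
            - cscale (ricci M c \<tau> \<nu> p) (T [Hol \<sigma>, Hol \<mu>] p))) = Q \<mu> \<nu> - Q \<nu> \<mu>"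
    unfolding t_def[symmetric] cscale_simps(2) sum_subtractf Q ..

  show ?thesis
    unfolding laplace_def del1 del2 rough curvature ricci by simp
qed

end

section \<open>The Lie algebra of the structure group\<close>

lemma lie_algebraI:
  assumes "smooth_on UNIV \<gamma>" "range \<gamma> \<subseteq> G" "\<gamma> 0 = mat 1" "(\<gamma> has_vector_derivative X) (at 0)"
  shows "X \<in> lie_algebra G"
  using assms unfolding lie_algebra_def by blast

lemma lie_algebraE:
  assumes "X \<in> lie_algebra G"
  obtains \<gamma> where "smooth_on UNIV \<gamma>" "\<And>s. \<gamma> s \<in> G" "\<gamma> 0 = mat 1" "(\<gamma> has_vector_derivative X) (at 0)"
  using assms unfolding lie_algebra_def by blast

text \<open>Pointwise products of curves in the group add the velocities at the identity, and
  reparametrisation scales them.\<close>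

lemma subspace_lie_algebra:
  assumes "compact_matrix_group G"
  shows "subspace (lie_algebra G)"
proof (intro subspaceI)
  show "0 \<in> lie_algebra G"
    using assms by (intro lie_algebraI[of "\<lambda>t. mat 1"])
      (auto simp: smooth_on_const compact_matrix_group_def)
next
  fix X Y assume "X \<in> lie_algebra G" "Y \<in> lie_algebra G"
  from \<open>X \<in> lie_algebra G\<close> obtain \<gamma> where \<gamma>: "smooth_on UNIV \<gamma>" "\<And>s. \<gamma> s \<in> G" "\<gamma> 0 = mat 1" "(\<gamma> has_vector_derivative X) (at 0)"
    using lie_algebraE by blast
  from \<open>Y \<in> lie_algebra G\<close> obtain \<delta> where \<delta>: "smooth_on UNIV \<delta>" "\<And>s. \<delta> s \<in> G" "\<delta> 0 = mat 1" "(\<delta> has_vector_derivative Y) (at 0)"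
    using lie_algebraE by blast
  have "((\<lambda>t. \<gamma> t ** \<delta> t) has_vector_derivative \<gamma> 0 ** Y + X ** \<delta> 0) (at 0)"
    by (rule bounded_bilinear.has_vector_derivative[OF bounded_bilinear_matrix_mult \<gamma>(4) \<delta>(4)])
  then show "X + Y \<in> lie_algebra G"
    using \<gamma> \<delta> assms
    by (intro lie_algebraI[of "\<lambda>t. \<gamma> t ** \<delta> t"] smooth_on_bounded_bilinear[OF _ bounded_bilinear_matrix_mult])
      (auto simp: compact_matrix_group_def add.commute)
next
  fix a X assume "X \<in> lie_algebra G"
  then obtain \<gamma> where \<gamma>: "smooth_on UNIV \<gamma>" "\<And>s. \<gamma> s \<in> G" "\<gamma> 0 = mat 1" "(\<gamma> has_vector_derivative X) (at 0)"
    using lie_algebraE by blast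
  have "((\<lambda>t. a * t) has_vector_derivative a) (at 0)"
    by (auto intro!: derivative_eq_intros)
  moreover have "(\<gamma> has_vector_derivative X) (at (a * 0))"
    using \<gamma>(4) by simp
  ultimately have "((\<lambda>t. \<gamma> (a * t)) has_vector_derivative a *\<^sub>R X) (at 0)"
    using vector_diff_chain_at[of "\<lambda>t. a * t" a 0 \<gamma> X] by (simp add: o_def)
  then show "a *\<^sub>R X \<in> lie_algebra G"
    using \<gamma> by (intro lie_algebraI[of "\<lambda>t. \<gamma> (a * t)"] smooth_on_comp_scaleR) auto
qed

lemma lie_algebra_conjugate:
  assumes "compact_matrix_group G" "X \<in> G" "Y \<in> lie_algebra G"
  shows "X ** Y ** matrix_inv X \<in> lie_algebra G"
proof -
  from assms(3) obtain \<gamma> where \<gamma>: "smooth_on UNIV \<gamma>" "\<And>s. \<gamma> s \<in> G" "\<gamma> 0 = mat 1" "(\<gamma> has_vector_derivative Y) (at 0)"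
    using lie_algebraE by blast
  have lin: "bounded_linear (\<lambda>Z. X ** Z ** matrix_inv X)"
    by (intro bounded_linear_compose[OF bounded_bilinear.bounded_linear_left[OF bounded_bilinear_matrix_mult]
          bounded_bilinear.bounded_linear_right[OF bounded_bilinear_matrix_mult]])
  have inv: "invertible X" "matrix_inv X \<in> G"
    using assms by (auto simp: compact_matrix_group_def)
  show ?thesis
  proof (rule lie_algebraI)
    show "smooth_on UNIV (\<lambda>t. X ** \<gamma> t ** matrix_inv X)"
      by (rule smooth_on_bounded_linear[OF open_UNIV lin \<gamma>(1)])
    show "range (\<lambda>t. X ** \<gamma> t ** matrix_inv X) \<subseteq> G"
      using assms inv \<gamma>(2) by (auto simp: compact_matrix_group_def)
    show "X ** \<gamma> 0 ** matrix_inv X = mat 1"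
      by (simp add: \<gamma>(3) matrix_inv_mult(1)[OF inv(1)])
    show "((\<lambda>t. X ** \<gamma> t ** matrix_inv X) has_vector_derivative X ** Y ** matrix_inv X) (at 0)"
      by (rule bounded_linear.has_vector_derivative[OF lin \<gamma>(4)])
  qed
qed

text \<open>A subspace of a finite-dimensional space is the set of vectors orthogonal to its orthogonal
  complement, so it contains the derivatives of the maps with values in it.\<close>

lemma frechet_derivative_in_subspace:
  fixes f :: "'a::real_normed_vector \<Rightarrow> 'b::euclidean_space"
  assumes "subspace V" "open S" "p \<in> S" "f differentiable (at p)" "\<And>q. q \<in> S \<Longrightarrow> f q \<in> V"
  shows "frechet_derivative f (at p) v \<in> V"
proof -
  have "u \<bullet> frechet_derivative f (at p) v = 0" if u: "\<And>y. y \<in> V \<Longrightarrow> u \<bullet> y = 0" for u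
  proof -
    have "((\<lambda>q. u \<bullet> f q) has_derivative (\<lambda>v. u \<bullet> frechet_derivative f (at p) v)) (at p)"
      by (rule has_derivative_inner_right[OF frechet_derivative_works_at[OF assms(4)]])
    then have "(\<lambda>v. u \<bullet> frechet_derivative f (at p) v) = frechet_derivative (\<lambda>q. u \<bullet> f q) (at p)"
      by (simp add: frechet_derivative_eqI)
    also have "\<dots> = frechet_derivative (\<lambda>q. 0) (at p)"
      by (rule frechet_derivative_cong_open[OF assms(2,3)]) (simp add: assms(5) u)
    finally show ?thesis by (simp add: fun_eq_iff)
  qed
  then have "frechet_derivative f (at p) v \<in> orthogonal_comp (orthogonal_comp V)"
    by (simp add: orthogonal_comp_def orthogonal_def inner_commute)
  then show ?thesis
    by (simp add: orthogonal_comp_self assms(1))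
qed

text \<open>The bracket is the velocity at 0 of the curve
  \<open>\<gamma> s ** Y ** \<delta> s\<close>, where \<delta> is the inverse curve. This curve lies
  in the Lie algebra, a subspace, so its velocity does too. That \<delta> has velocity
  \<open>- X\<close> follows by differentiating the constant product of \<gamma> and
  \<delta>.\<close>

lemma lie_algebra_comm:
  assumes "compact_matrix_group G" "X \<in> lie_algebra G" "Y \<in> lie_algebra G"
  shows "comm X Y \<in> lie_algebra G"
proof -
  from assms(2) obtain \<gamma> where \<gamma>: "smooth_on UNIV \<gamma>" "\<And>s. \<gamma> s \<in> G" "\<gamma> 0 = mat 1" "(\<gamma> has_vector_derivative X) (at 0)"
    using lie_algebraE by blast
  have inv: "invertible (\<gamma> s)" for s
    using assms(1) \<gamma>(2) by (auto simp: compact_matrix_group_def)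
  define \<delta> where "\<delta> s = matrix_inv (\<gamma> s)" for s
  have "smooth_on UNIV \<delta>"
    using invariant_on_matrix_inv[of UNIV 0 \<gamma>] \<gamma>(1) inv by (simp add: invariant_on_zero \<delta>_def[abs_def])
  then obtain Z where Z: "(\<delta> has_vector_derivative Z) (at 0)"
    using smooth_on_differentiable[of UNIV \<delta> 0] by (auto simp: vector_derivative_works)
  have prod: "((\<lambda>s. \<gamma> s ** \<delta> s) has_vector_derivative \<gamma> 0 ** Z + X ** \<delta> 0) (at 0)"
    by (rule bounded_bilinear.has_vector_derivative[OF bounded_bilinear_matrix_mult \<gamma>(4) Z])
  have "\<delta> 0 = mat 1"
    by (simp add: \<delta>_def \<gamma>(3) matrix_inv_unique_left)
  have "(\<lambda>s. \<gamma> s ** \<delta> s) = (\<lambda>s. mat 1)"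
    by (simp add: \<delta>_def matrix_inv_mult(1)[OF inv])
  with prod have "Z + X = 0"
    using vector_derivative_unique_at[of "\<lambda>s. mat 1" "Z + X" 0 0] \<open>\<delta> 0 = mat 1\<close> \<gamma>(3) by simp
  then have Z_eq: "Z = - X" by (simp add: eq_neg_iff_add_eq_0)
  have "((\<lambda>s. (\<gamma> s ** Y) ** \<delta> s) has_vector_derivative (\<gamma> 0 ** Y) ** Z + (\<gamma> 0 ** 0 + X ** Y) ** \<delta> 0) (at 0)"
    by (intro bounded_bilinear.has_vector_derivative[OF bounded_bilinear_matrix_mult] \<gamma>(4) Z has_vector_derivative_const)
  then have D: "((\<lambda>s. \<gamma> s ** Y ** \<delta> s) has_vector_derivative comm X Y) (at 0)"
    by (simp add: \<gamma>(3) \<open>\<delta> 0 = mat 1\<close> Z_eq comm_def matrix_ring_simps)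
  have "frechet_derivative (\<lambda>s. \<gamma> s ** Y ** \<delta> s) (at 0) 1 \<in> lie_algebra G"
  proof (rule frechet_derivative_in_subspace[OF subspace_lie_algebra[OF assms(1)] open_UNIV])
    show "(\<lambda>s. \<gamma> s ** Y ** \<delta> s) differentiable (at 0)"
      using D by (auto simp: has_vector_derivative_def differentiable_def)
    show "\<gamma> s ** Y ** \<delta> s \<in> lie_algebra G" for s
      unfolding \<delta>_def by (rule lie_algebra_conjugate[OF assms(1) \<gamma>(2) assms(3)])
  qed simp
  moreover have "frechet_derivative (\<lambda>s. \<gamma> s ** Y ** \<delta> s) (at 0) = (\<lambda>s. s *\<^sub>R comm X Y)"
    using D by (simp add: has_vector_derivative_def frechet_derivative_eqI)
  ultimately show ?thesis by simp
qed

section \<open>The complexified Lie algebra\<close>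

lemma lie_algebra_in_complex:
  assumes "compact_matrix_group G" "X \<in> lie_algebra G"
  shows "X \<in> complex_lie_algebra G"
proof -
  have "X = X + cscale \<i> 0" by (simp add: cscale_simps)
  then show ?thesis
    using assms(2) subspace_0[OF subspace_lie_algebra[OF assms(1)]] unfolding complex_lie_algebra_def by blast
qed

lemma complex_lie_algebra_add:
  assumes "compact_matrix_group G" "X \<in> complex_lie_algebra G" "Y \<in> complex_lie_algebra G"
  shows "X + Y \<in> complex_lie_algebra G"
proof -
  from assms(2,3) obtain A B C D where
    "X = A + cscale \<i> B" "Y = C + cscale \<i> D" and in_g: "A \<in> lie_algebra G" "B \<in> lie_algebra G" "C \<in> lie_algebra G" "D \<in> lie_algebra G"
    by (auto simp: complex_lie_algebra_def)
  then have "X + Y = (A + C) + cscale \<i> (B + D)"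
    by (simp add: cscale_simps)
  then show ?thesis
    using in_g subspace_add[OF subspace_lie_algebra[OF assms(1)]] unfolding complex_lie_algebra_def by blast
qed

lemma complex_lie_algebra_cscale:
  assumes "compact_matrix_group G" "X \<in> complex_lie_algebra G"
  shows "cscale a X \<in> complex_lie_algebra G"
proof -
  note sub = subspace_lie_algebra[OF assms(1)]
  from assms(2) obtain A B where
    X: "X = A + cscale \<i> B" and in_g: "A \<in> lie_algebra G" "B \<in> lie_algebra G"
    by (auto simp: complex_lie_algebra_def)
  have "cscale a X = (Re a *\<^sub>R A - Im a *\<^sub>R B) + cscale \<i> (Im a *\<^sub>R A + Re a *\<^sub>R B)"
    unfolding X by (simp add: cscale_def vec_eq_iff complex_eq_iff algebra_simps)
  moreover have "Re a *\<^sub>R A - Im a *\<^sub>R B \<in> lie_algebra G" "Im a *\<^sub>R A + Re a *\<^sub>R B \<in> lie_algebra G"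
    using in_g by (auto intro!: subspace_add[OF sub] subspace_diff[OF sub] subspace_scale[OF sub])
  ultimately show ?thesis unfolding complex_lie_algebra_def by blast
qed

lemma complex_lie_algebra_zero: "compact_matrix_group G \<Longrightarrow> 0 \<in> complex_lie_algebra G"
  by (simp add: lie_algebra_in_complex subspace_0 subspace_lie_algebra)

lemma complex_lie_algebra_diff:
  "compact_matrix_group G \<Longrightarrow> X \<in> complex_lie_algebra G \<Longrightarrow> Y \<in> complex_lie_algebra G \<Longrightarrow> X - Y \<in> complex_lie_algebra G"
  using complex_lie_algebra_add[of G X "cscale (- 1) Y"] complex_lie_algebra_cscale[of G Y "- 1"]
  by (simp add: cscale_simps)

lemma complex_lie_algebra_sum:
  "compact_matrix_group G \<Longrightarrow> (\<And>i. i \<in> I \<Longrightarrow> X i \<in> complex_lie_algebra G) \<Longrightarrow> (\<Sum>i\<in>I. X i) \<in> complex_lie_algebra G"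
  by (induction I rule: infinite_finite_induct) (auto simp: complex_lie_algebra_zero complex_lie_algebra_add)

lemma complex_lie_algebra_comm:
  assumes "compact_matrix_group G" "X \<in> complex_lie_algebra G" "Y \<in> complex_lie_algebra G"
  shows "comm X Y \<in> complex_lie_algebra G"
proof -
  from assms(2,3) obtain A B C D where
    XY: "X = A + cscale \<i> B" "Y = C + cscale \<i> D" and in_g: "A \<in> lie_algebra G" "B \<in> lie_algebra G" "C \<in> lie_algebra G" "D \<in> lie_algebra G"
    by (auto simp: complex_lie_algebra_def)
  note cla = lie_algebra_in_complex[OF assms(1) lie_algebra_comm[OF assms(1)]]
  show ?thesis
    unfolding XY comm_simps using in_g
    by (intro complex_lie_algebra_add complex_lie_algebra_cscale cla assms(1))
qed

lemma subspace_complex_lie_algebra: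
  assumes "compact_matrix_group G"
  shows "subspace (complex_lie_algebra G)"
proof (intro subspaceI)
  fix a X assume "X \<in> complex_lie_algebra G"
  moreover have "a *\<^sub>R X = cscale (of_real a) X"
    by (simp add: cscale_def vec_eq_iff complex_eq_iff)
  ultimately show "a *\<^sub>R X \<in> complex_lie_algebra G"
    by (simp add: complex_lie_algebra_cscale[OF assms])
qed (auto simp: complex_lie_algebra_zero complex_lie_algebra_add assms)

lemma cpartialM_in_complex_lie_algebra:
  assumes "compact_matrix_group G" "open S" "p \<in> S" "X differentiable (at p)"
    "\<And>q. q \<in> S \<Longrightarrow> X q \<in> complex_lie_algebra G"
  shows "cpartialM A X p \<in> complex_lie_algebra G"
  unfolding cpartialM_def cextM_eq
  using frechet_derivative_in_subspace[OF subspace_complex_lie_algebra[OF assms(1)] assms(2-5)]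
  by (intro complex_lie_algebra_cscale complex_lie_algebra_add assms(1))

section \<open>Changes of foliated charts\<close>

lemma bounded_linear_zcoord: "bounded_linear (zcoord C)"
proof (cases C)
  case (Inl \<gamma>)
  then have "zcoord C = (\<lambda>w. fst w $ \<gamma>)" by (simp add: zcoord_def[abs_def])
  then show ?thesis
    using bounded_linear_compose[OF bounded_linear_vec_nth bounded_linear_fst] by simp
next
  case (Inr \<gamma>)
  then have "zcoord C = (\<lambda>w. cnj (fst w $ \<gamma>))" by (simp add: zcoord_def[abs_def])
  then show ?thesis
    using bounded_linear_compose[OF bounded_linear_cnj bounded_linear_compose[OF bounded_linear_vec_nth bounded_linear_fst]]
    by simp
qed

context foliated_chart
begin

lemma chart_inv_snd: "m \<in> fst c \<Longrightarrow> chart_inv c (snd c m) = m"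
proof -
  have "is_chart c"
    using sasakian in_atlas unfolding sasakian_def smooth_atlas_def by blast
  then have "inj_on (snd c) (fst c)"
    unfolding is_chart_def homeomorphism_def by (metis inj_on_inverseI)
  then show "m \<in> fst c \<Longrightarrow> chart_inv c (snd c m) = m"
    by (simp add: chart_inv_def)
qed

lemma open_image:
  assumes "open N"
  shows "open (snd c ` (fst c \<inter> N))"
proof -
  have "is_chart c"
    using sasakian in_atlas unfolding sasakian_def smooth_atlas_def by blast
  then obtain k where hom: "homeomorphism (fst c) (snd c ` fst c) (snd c) k" and op: "open (snd c ` fst c)"
    unfolding is_chart_def by blast
  have "openin (top_of_set (snd c ` fst c)) (snd c ` (fst c \<inter> N))"
    using assms by (intro homeomorphism_imp_open_map[OF hom]) (simp add: openin_open_Int)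
  then show ?thesis using op by (metis openin_open_trans)
qed

end

locale foliated_change =
  c: foliated_chart M c + c': foliated_chart M c' for M :: "'m::topological_space sasakian_data" and c c'
begin

abbreviation "f \<equiv> change c c'"
abbreviation "W \<equiv> snd c ` (fst c \<inter> fst c')"
abbreviation "J \<equiv> cjac c c'"

lemma change_snd: "m \<in> fst c \<Longrightarrow> f (snd c m) = snd c' m"
  by (simp add: change_def c.chart_inv_snd)

lemma W_subset: "W \<subseteq> snd c ` fst c" by blast

lemma f_in: "p \<in> W \<Longrightarrow> f p \<in> snd c' ` fst c'"
  using change_snd by auto

lemma open_W: "open W"
proof (rule c.open_image)
  have "is_chart c'"
    using c'.sasakian c'.in_atlas unfolding sasakian_def smooth_atlas_def by blast
  then show "open (fst c')" by (simp add: is_chart_def)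
qed

lemma smooth_change: "smooth_on W f"
proof -
  have "charts_compatible c c'"
    using c.sasakian c.in_atlas c'.in_atlas unfolding sasakian_def smooth_atlas_def by blast
  then show ?thesis by (simp add: charts_compatible_def)
qed

lemma change_has_derivative: "p \<in> W \<Longrightarrow> (f has_derivative dchange c c' p) (at p)"
  unfolding dchange_def by (rule smooth_on_has_derivative[OF smooth_change])

lemma linear_dchange: "p \<in> W \<Longrightarrow> linear (dchange c c' p)"
  by (rule has_derivative_linear[OF change_has_derivative])

lemma dchange_reeb:
  assumes "p \<in> W"
  shows "dchange c c' p (0, 1) = (0, 1)"
proof -
  have "vector_field (atlas M) (xi M)"
    using c.contact(2) by (simp add: contact_form_with_reeb_def)
  then have "xi M c' (f p) = dchange c c' p (xi M c p)"
    using assms c.in_atlas c'.in_atlas unfolding vector_field_def by blast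
  then show ?thesis
    using c.reeb[of p] c'.reeb[OF f_in[OF assms]] assms by auto
qed

text \<open>The differential intertwines the two representatives of \<Phi>, whose transverse part is
  multiplication by \<i> in either chart; the vertical part of \<open>\<Phi> v\<close> goes to a
  multiple of the Reeb field and is not seen by \<open>fst\<close>.\<close>

lemma dchange_holomorphic:
  assumes "p \<in> W"
  shows "fst (dchange c c' p (\<i> *s fst v, 0)) = \<i> *s fst (dchange c c' p v)"
proof -
  let ?D = "dchange c c' p"
  have pU: "p \<in> snd c ` fst c" using assms by blast
  have "endomorphism_field (atlas M) (Phi M)"
    using c.contact(1) by (simp add: contact_metric_def)
  then have "Phi M c' (f p) (?D v) = ?D (Phi M c p v)"
    using assms c.in_atlas c'.in_atlas unfolding endomorphism_field_def by blast
  moreover have "Phi M c p v = (\<i> *s fst v, 0) + snd (Phi M c p v) *\<^sub>R (0, 1)"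
    using c.fst_Phi[OF pU, of v] by (simp add: prod_eq_iff)
  ultimately have "Phi M c' (f p) (?D v) = ?D (\<i> *s fst v, 0) + snd (Phi M c p v) *\<^sub>R (0, 1)"
    by (metis linear_add[OF linear_dchange[OF assms]] linear_cmul[OF linear_dchange[OF assms]] dchange_reeb[OF assms])
  then have "fst (Phi M c' (f p) (?D v)) = fst (?D (\<i> *s fst v, 0))"
    by simp
  then show ?thesis
    using c'.fst_Phi[OF f_in[OF assms]] by simp
qed

lemma cjac_eq:
  assumes "p \<in> W"
  shows "J p C A = cext (\<lambda>v. zcoord C (dchange c c' p v)) A"
  unfolding cjac_def o_def
  by (rule cpartial_eqI[OF bounded_linear.has_derivative[OF bounded_linear_zcoord change_has_derivative[OF assms]]])

text \<open>The Cauchy-Riemann equations for the coordinate change.\<close>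

lemma cjac_mixed:
  assumes "p \<in> W" "isl C \<noteq> isl A"
  shows "J p C A = 0"
proof -
  have im: "im_dir A = (\<i> *s fst (re_dir A), 0)"
    by (auto simp: re_dir_def im_dir_def axis_def vec_eq_iff)
  have "fst (dchange c c' p (im_dir A)) = \<i> *s fst (dchange c c' p (re_dir A))"
    unfolding im by (rule dchange_holomorphic[OF assms(1)])
  then show ?thesis
    using assms(2) unfolding cjac_eq[OF assms(1)] cext_eq
    by (cases C; cases A) (auto simp: zcoord_def)
qed

text \<open>The image of a transverse coordinate vector may have an x-component, since x' depends on
  z; \<open>L\<close> does not see it.\<close>

lemma cext_pullback:
  assumes "p \<in> W" "linear L" "L (0, 1) = 0"
  shows "cext (\<lambda>v. L (dchange c c' p v)) A = (\<Sum>C\<in>UNIV. J p C A * cext L C)"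
proof -
  have "cext (\<lambda>v. L (dchange c c' p v)) A =
      cext (\<lambda>v. \<Sum>C\<in>UNIV. zcoord C (dchange c c' p v) * cext L C) A"
    unfolding linear_eq_sum_cext[OF assms(2,3), symmetric] ..
  also have "\<dots> = (\<Sum>C\<in>UNIV. J p C A * cext L C)"
    unfolding cjac_eq[OF assms(1)] cext_eq[of _ A] sum_distrib_left sum.distrib[symmetric] sum_divide_distrib
    by (intro sum.cong refl) (simp add: field_simps)
  finally show ?thesis .
qed

lemma cextM_pullback:
  assumes "p \<in> W" "linear L" "L (0, 1) = 0"
  shows "cextM (\<lambda>v. L (dchange c c' p v)) A = (\<Sum>C\<in>UNIV. cscale (J p C A) (cextM L C))"
proof -
  have "cext (\<lambda>v. L (dchange c c' p v) $ i $ j) A = (\<Sum>C\<in>UNIV. J p C A * cext (\<lambda>v. L v $ i $ j) C)" for i j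
    using assms linear_add[OF assms(2)] linear_cmul[OF assms(2)]
    by (intro cext_pullback[of p "\<lambda>v. L v $ i $ j"]) (auto intro!: linearI)
  then show ?thesis
    by (simp add: vec_eq_iff cextM_def cscale_def)
qed

lemma cpartial_change:
  assumes "p \<in> W" "F differentiable (at (f p))" "frechet_derivative F (at (f p)) (0, 1) = 0"
  shows "cpartial A (\<lambda>q. F (f q)) p = (\<Sum>C\<in>UNIV. J p C A * cpartial C F (f p))"
proof -
  note D = frechet_derivative_works_at[OF assms(2)]
  have "((\<lambda>q. F (f q)) has_derivative (\<lambda>v. frechet_derivative F (at (f p)) (dchange c c' p v))) (at p)"
    using diff_chain_at[OF change_has_derivative[OF assms(1)] D] by (simp add: o_def)
  from cpartial_eqI[OF this] show ?thesis
    using cext_pullback[OF assms(1) has_derivative_linear[OF D] assms(3)]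
    by (simp add: cpartial_def[of _ F])
qed

lemma cpartialM_change:
  assumes "p \<in> W" "F differentiable (at (f p))" "frechet_derivative F (at (f p)) (0, 1) = 0"
  shows "cpartialM A (\<lambda>q. F (f q)) p = (\<Sum>C\<in>UNIV. cscale (J p C A) (cpartialM C F (f p)))"
proof -
  note D = frechet_derivative_works_at[OF assms(2)]
  have "((\<lambda>q. F (f q)) has_derivative (\<lambda>v. frechet_derivative F (at (f p)) (dchange c c' p v))) (at p)"
    using diff_chain_at[OF change_has_derivative[OF assms(1)] D] by (simp add: o_def)
  from cpartialM_eqI[OF this] show ?thesis
    using cextM_pullback[OF assms(1) has_derivative_linear[OF D] assms(3)]
    by (simp add: cpartialM_def[of _ F])
qed

lemma differentiable_change:
  "p \<in> W \<Longrightarrow> F differentiable (at (f p)) \<Longrightarrow> (\<lambda>q. F (f q)) differentiable (at p)"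
  unfolding differentiable_def using diff_chain_at[OF change_has_derivative] by (fastforce simp: o_def)

lemma smooth_zcoord_change: "smooth_on W (\<lambda>q. zcoord C (f q))"
  by (rule smooth_on_bounded_linear[OF open_W bounded_linear_zcoord smooth_change])

lemma smooth_cjac: "invariant_on 0 W (\<lambda>q. J q C A)"
  unfolding cjac_def o_def
  by (intro invariant_on_cpartial open_W) (simp add: invariant_on_zero smooth_zcoord_change)

lemma differentiable_cjac: "p \<in> W \<Longrightarrow> (\<lambda>q. J q C A) differentiable (at p)"
  using smooth_cjac invariant_on_smooth smooth_on_differentiable by blast

lemma cpartial_cjac_sym:
  "p \<in> W \<Longrightarrow> cpartial B (\<lambda>q. J q C A) p = cpartial A (\<lambda>q. J q C B) p"
  unfolding cjac_def o_def by (rule cpartial_commute[OF open_W smooth_zcoord_change])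

text \<open>The two lower indices can be exchanged as second derivatives commute, and the entry with
  lower index \<open>B\<close> vanishes identically. Thus unbarred entries of the Jacobian are
  holomorphic and barred ones antiholomorphic.\<close>

lemma cpartial_cjac_mixed:
  assumes "p \<in> W" "isl B \<noteq> isl C"
  shows "cpartial B (\<lambda>q. J q C A) p = 0"
proof -
  have "cpartial A (\<lambda>q. J q C B) p = cpartial A (\<lambda>q. 0) p"
    by (rule cpartial_cong[OF open_W assms(1)]) (use assms(2) cjac_mixed in auto)
  then show ?thesis
    by (simp add: cpartial_cjac_sym[OF assms(1), of B])
qed

section \<open>Transformation of the transverse metric\<close>

lemma met_change:
  assumes "p \<in> W"
  shows "met M c p (horizontal M c p v) (horizontal M c p w) =
    met M c' (f p) (horizontal M c' (f p) (dchange c c' p v)) (horizontal M c' (f p) (dchange c c' p w))"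
proof -
  have pU: "p \<in> snd c ` fst c" using assms by blast
  have "eta M c p v = eta M c' (f p) (dchange c c' p v)" for v
    using c.eta_form assms c.in_atlas c'.in_atlas unfolding one_form_on_def by fastforce
  then have hor: "dchange c c' p (horizontal M c p v) = horizontal M c' (f p) (dchange c c' p v)" for v
    by (simp only: horizontal_def c.reeb[OF pU] c'.reeb[OF f_in[OF assms]] linear_diff[OF linear_dchange[OF assms]]
        linear_cmul[OF linear_dchange[OF assms]] dchange_reeb[OF assms])
  have "riemannian_metric (atlas M) (met M)"
    using c.contact(1) by (simp add: contact_metric_def)
  then have "met M c p v w = met M c' (f p) (dchange c c' p v) (dchange c c' p w)" for v w
    using assms c.in_atlas c'.in_atlas unfolding riemannian_metric_def by blast
  then show ?thesis by (simp add: hor)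
qed

lemma gdn_change:
  assumes "p \<in> W"
  shows "gdn M c p A B = (\<Sum>C\<in>UNIV. \<Sum>D\<in>UNIV. J p C A * J p D B * gdn M c' (f p) C D)"
proof -
  note fU = f_in[OF assms]
  let ?m = "\<lambda>v w. complex_of_real (met M c' (f p) (horizontal M c' (f p) v) (horizontal M c' (f p) w))"
  have lin: "linear (?m v)" "linear (\<lambda>v. ?m v w)" for v w
    by (intro linear_complex_of_real c'.linear_met_horizontal[OF fU])+
  have zero: "?m v (0, 1) = 0" "?m (0, 1) w = 0" for v w
    using linear_0[OF lin(1)] linear_0[OF lin(2)] c'.metric(1)[OF fU] bilinear_rzero bilinear_lzero
    by (fastforce simp: c'.horizontal_reeb[OF fU])+
  have "linear (\<lambda>v. J p D B * cext (?m v) D)" for D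
    by (intro linearI)
      (simp_all add: linear_add[OF lin(2)] linear_cmul[OF lin(2)] cext_eq field_simps scaleR_conv_of_real)
  then have lin_out: "linear (\<lambda>v. \<Sum>D\<in>UNIV. J p D B * cext (?m v) D)"
    by (intro linear_compose_sum) simp
  have "gdn M c p A B = cext (\<lambda>v. cext (\<lambda>w. ?m (dchange c c' p v) (dchange c c' p w)) B) A"
    by (simp add: gdn_def met_change[OF assms])
  also have "\<dots> = cext (\<lambda>v. \<Sum>D\<in>UNIV. J p D B * cext (?m (dchange c c' p v)) D) A"
    by (simp add: cext_pullback[OF assms lin(1) zero(1)])
  also have "\<dots> = (\<Sum>C\<in>UNIV. J p C A * cext (\<lambda>v. \<Sum>D\<in>UNIV. J p D B * cext (?m v) D) C)"
    by (rule cext_pullback[OF assms lin_out]) (simp add: zero cext_eq)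
  finally have outer: "gdn M c p A B = (\<Sum>C\<in>UNIV. J p C A * cext (\<lambda>v. \<Sum>D\<in>UNIV. J p D B * cext (?m v) D) C)" .
  have "cext (\<lambda>v. \<Sum>D\<in>UNIV. J p D B * cext (?m v) D) C = (\<Sum>D\<in>UNIV. J p D B * gdn M c' (f p) C D)" for C
    unfolding gdn_def cext_eq[of _ C] sum_distrib_left sum.distrib[symmetric] sum_divide_distrib
    by (intro sum.cong refl) (simp add: field_simps)
  with outer show ?thesis
    by (simp add: sum_distrib_left mult.assoc)
qed

end

section \<open>The Ricci form and its transformation law\<close>

lemma sum_swap3:
  "(\<Sum>a\<in>A. \<Sum>b\<in>B. \<Sum>c\<in>C. F a b c) = (\<Sum>b\<in>B. \<Sum>c\<in>C. \<Sum>a\<in>A. F a b c)"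
  by (subst sum.swap, rule sum.cong[OF refl], rule sum.swap)

lemma sum_swap4:
  "(\<Sum>a\<in>A. \<Sum>b\<in>B. \<Sum>c\<in>C. \<Sum>d\<in>D. F a b c d) = (\<Sum>c\<in>C. \<Sum>d\<in>D. \<Sum>a\<in>A. \<Sum>b\<in>B. F a b c d)"
proof -
  have "(\<Sum>a\<in>A. \<Sum>b\<in>B. \<Sum>c\<in>C. \<Sum>d\<in>D. F a b c d) = (\<Sum>a\<in>A. \<Sum>c\<in>C. \<Sum>d\<in>D. \<Sum>b\<in>B. F a b c d)"
    by (intro sum.cong refl sum_swap3)
  then show ?thesis
    by (simp only: sum_swap3[of _ _ _ A])
qed

context foliated_chart
begin

text \<open>\<open>theta \<mu>\<close> is \<open>\<partial>\<^sub>\<mu> log det h\<close>.\<close>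

definition theta :: "3 \<Rightarrow> coords \<Rightarrow> complex" where
  "theta \<mu> p = (\<Sum>\<kappa>\<in>UNIV. \<Sum>\<tau>\<in>UNIV. k p \<kappa> \<tau> * cpartial (Hol \<mu>) (\<lambda>q. h q \<kappa> \<tau>) p)"

lemma invariant_theta: "invariant_on (0, 1) U (theta \<mu>)"
  unfolding theta_def
  by (intro invariant_on_sum invariant_on_mult open_U invariant_gi invariant_on_cpartial[OF open_U invariant_g])

text \<open>Symmetry of \<Gamma> in its lower indices turns the trace in \<open>ricci_eq\<close>
  into a logarithmic derivative of det h. Ricci becomes a barred derivative of an object with one
  index, whose transformation is easier to control than that of the full curvature.\<close>

lemma ricci_theta:
  assumes "p \<in> U"
  shows "ricci M c \<beta> \<mu> p = cpartial (Bar \<beta>) (theta \<mu>) p"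
proof -
  have "cpartial (Bar \<beta>) (theta \<mu>) p = cpartial (Bar \<beta>) (\<lambda>q. \<Sum>\<kappa>\<in>UNIV. \<Gamma> \<kappa> \<kappa> \<mu> q) p"
    by (rule cpartial_cong[OF open_U assms])
      (simp add: theta_def christoffel_hol christoffel_sym[of _ _ "Hol _" "Hol \<mu>"])
  then show ?thesis
    by (simp add: ricci_eq[OF assms] cpartial_sum differentiable_of_invariant[OF invariant_christoffel assms])
qed

lemma invariant_ricci: "invariant_on (0, 1) U (ricci M c \<beta> \<mu>)"
  by (rule invariant_on_cong[OF open_U, THEN iffD2, OF ricci_theta])
    (assumption, intro invariant_on_cpartial open_U invariant_theta)

end

context foliated_change
begin

lemma gup_change:
  assumes "p \<in> W"
  shows "gup M c' (f p) C D = (\<Sum>A\<in>UNIV. \<Sum>B\<in>UNIV. J p C A * J p D B * gup M c p A B)"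
proof -
  define Jm where "Jm = (\<chi> C A. J p C A)"
  define K where "K = matrix_inv (c.gmat p)"
  have "c.gmat p = transpose Jm ** (c'.gmat (f p) ** Jm)"
    unfolding vec_eq_iff c.gmat_def c'.gmat_def Jm_def gdn_change[OF assms] matrix_matrix_mult_def
      transpose_def vec_lambda_beta sum_distrib_left
    by (intro allI sum.cong refl) (simp only: mult_ac)
  then have "K ** (transpose Jm ** (c'.gmat (f p) ** Jm)) = mat 1"
    using matrix_inv_mult(2)[OF c.invertible_gmat[OF subsetD[OF W_subset assms]]] unfolding K_def by simp
  \<comment> \<open>This displays a left inverse of the Jacobian: its invertibility is read off from
    that of the metric instead of from the inverse coordinate change.\<close>
  then have "(K ** transpose Jm ** c'.gmat (f p)) ** Jm = mat 1"
    by (simp add: matrix_mul_assoc)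
  then have "Jm ** (K ** transpose Jm ** c'.gmat (f p)) = mat 1"
    using matrix_left_right_inverse by blast
  then have "matrix_inv (c'.gmat (f p)) = Jm ** K ** transpose Jm"
    by (intro matrix_inv_unique_left) (simp add: matrix_mul_assoc)
  then have "gup M c' (f p) C D = (\<Sum>B\<in>UNIV. \<Sum>A\<in>UNIV. J p C A * gup M c p A B * J p D B)"
    by (simp add: c'.gi_eq c.gi_eq K_def Jm_def matrix_matrix_mult_def transpose_def sum_distrib_right)
  then show ?thesis
    by (subst sum.swap) (simp add: mult_ac)
qed

lemma h_change:
  "p \<in> W \<Longrightarrow> c.h p \<alpha> \<beta> =
    (\<Sum>\<gamma>\<in>UNIV. \<Sum>\<delta>\<in>UNIV. J p (Hol \<gamma>) (Hol \<alpha>) * J p (Bar \<delta>) (Bar \<beta>) * c'.h (f p) \<gamma> \<delta>)"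
  by (simp add: gdn_change[of p "Hol \<alpha>"] sum_cidx cjac_mixed)

lemma k_change:
  "p \<in> W \<Longrightarrow> c'.k (f p) \<gamma> \<delta> =
    (\<Sum>\<alpha>\<in>UNIV. \<Sum>\<beta>\<in>UNIV. J p (Hol \<gamma>) (Hol \<alpha>) * J p (Bar \<delta>) (Bar \<beta>) * c.k p \<alpha> \<beta>)"
  by (simp add: gup_change[of p "Hol \<gamma>"] sum_cidx cjac_mixed)

lemma differentiable_g': "p \<in> W \<Longrightarrow> (\<lambda>q. gdn M c' q A B) differentiable (at (f p))"
  using c'.differentiable_of_invariant[OF c'.invariant_g f_in] .

text \<open>The product rule for three factors, where the barred Jacobian contributes nothing
  because it is antiholomorphic.\<close>

lemma cpartial_h_change:
  assumes "p \<in> W"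
  shows "cpartial (Hol \<mu>) (\<lambda>q. c.h q \<kappa> \<tau>) p =
    (\<Sum>\<gamma>\<in>UNIV. \<Sum>\<delta>\<in>UNIV. cpartial (Hol \<mu>) (\<lambda>q. J q (Hol \<gamma>) (Hol \<kappa>)) p * J p (Bar \<delta>) (Bar \<tau>) * c'.h (f p) \<gamma> \<delta>
      + J p (Hol \<gamma>) (Hol \<kappa>) * J p (Bar \<delta>) (Bar \<tau>) *
        (\<Sum>\<epsilon>\<in>UNIV. J p (Hol \<epsilon>) (Hol \<mu>) * cpartial (Hol \<epsilon>) (\<lambda>q. c'.h q \<gamma> \<delta>) (f p)))"
proof -
  note d = differentiable_cjac[OF assms] differentiable_change[OF assms differentiable_g'[OF assms]]
  have chain: "cpartial (Hol \<mu>) (\<lambda>q. c'.h (f q) \<gamma> \<delta>) p =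
      (\<Sum>\<epsilon>\<in>UNIV. J p (Hol \<epsilon>) (Hol \<mu>) * cpartial (Hol \<epsilon>) (\<lambda>q. c'.h q \<gamma> \<delta>) (f p))" for \<gamma> \<delta>
    using cpartial_change[OF assms differentiable_g'[OF assms] invariant_on_vanishes[OF c'.invariant_g f_in[OF assms]]]
    by (simp add: sum_cidx cjac_mixed[OF assms])
  have "cpartial (Hol \<mu>) (\<lambda>q. c.h q \<kappa> \<tau>) p =
      cpartial (Hol \<mu>) (\<lambda>q. \<Sum>\<gamma>\<in>UNIV. \<Sum>\<delta>\<in>UNIV. J q (Hol \<gamma>) (Hol \<kappa>) * J q (Bar \<delta>) (Bar \<tau>) * c'.h (f q) \<gamma> \<delta>) p"
    by (rule cpartial_cong[OF open_W assms h_change])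
  also have "\<dots> = (\<Sum>\<gamma>\<in>UNIV. \<Sum>\<delta>\<in>UNIV.
      cpartial (Hol \<mu>) (\<lambda>q. J q (Hol \<gamma>) (Hol \<kappa>) * J q (Bar \<delta>) (Bar \<tau>) * c'.h (f q) \<gamma> \<delta>) p)"
    by (simp add: cpartial_sum d)
  also have "\<dots> = (\<Sum>\<gamma>\<in>UNIV. \<Sum>\<delta>\<in>UNIV.
      cpartial (Hol \<mu>) (\<lambda>q. J q (Hol \<gamma>) (Hol \<kappa>)) p * J p (Bar \<delta>) (Bar \<tau>) * c'.h (f p) \<gamma> \<delta>
      + J p (Hol \<gamma>) (Hol \<kappa>) * J p (Bar \<delta>) (Bar \<tau>) * cpartial (Hol \<mu>) (\<lambda>q. c'.h (f q) \<gamma> \<delta>) p)"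
    by (intro sum.cong refl) (simp add: cpartial_mult d cpartial_cjac_mixed[OF assms])
  finally show ?thesis by (simp only: chain)
qed

text \<open>\<open>jinv\<close> is the inverse of the holomorphic Jacobian \<open>j\<close>, computed from \<open>h = j\<^sup>T h' cnj(j)\<close>.\<close>

definition jinv :: "coords \<Rightarrow> 3 \<Rightarrow> 3 \<Rightarrow> complex" where
  "jinv q \<kappa> \<gamma> = (\<Sum>\<tau>\<in>UNIV. \<Sum>\<delta>\<in>UNIV. c.k q \<kappa> \<tau> * (J q (Bar \<delta>) (Bar \<tau>) * c'.h (f q) \<gamma> \<delta>))"

lemma jinv_left:
  assumes "q \<in> W"
  shows "(\<Sum>\<gamma>\<in>UNIV. jinv q \<kappa> \<gamma> * J q (Hol \<gamma>) (Hol \<nu>)) = (if \<kappa> = \<nu> then 1 else 0)"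
proof -
  have "(\<Sum>\<gamma>\<in>UNIV. jinv q \<kappa> \<gamma> * J q (Hol \<gamma>) (Hol \<nu>)) =
      (\<Sum>\<gamma>\<in>UNIV. \<Sum>\<tau>\<in>UNIV. \<Sum>\<delta>\<in>UNIV. c.k q \<kappa> \<tau> * (J q (Hol \<gamma>) (Hol \<nu>) * J q (Bar \<delta>) (Bar \<tau>) * c'.h (f q) \<gamma> \<delta>))"
    unfolding jinv_def sum_distrib_right by (simp only: mult_ac)
  also have "\<dots> = (\<Sum>\<tau>\<in>UNIV. c.k q \<kappa> \<tau> * c.h q \<nu> \<tau>)"
    unfolding h_change[OF assms] sum_distrib_left by (rule sum.swap)
  finally show ?thesis
    using c.k_h(1)[of q \<kappa> \<nu>] assms by auto
qed

lemma jinv_right: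
  assumes "q \<in> W"
  shows "(\<Sum>\<nu>\<in>UNIV. J q (Hol \<gamma>) (Hol \<nu>) * jinv q \<nu> \<epsilon>) = (if \<gamma> = \<epsilon> then 1 else 0)"
proof -
  have "(\<chi> \<kappa> \<gamma>. jinv q \<kappa> \<gamma>) ** (\<chi> \<gamma> \<nu>. J q (Hol \<gamma>) (Hol \<nu>)) = mat 1"
    by (simp add: matrix_matrix_mult_def mat_def vec_eq_iff jinv_left[OF assms])
  then have "(\<chi> \<gamma> \<nu>. J q (Hol \<gamma>) (Hol \<nu>)) ** (\<chi> \<kappa> \<gamma>. jinv q \<kappa> \<gamma>) = mat 1"
    using matrix_left_right_inverse by blast
  then show ?thesis
    by (simp add: matrix_matrix_mult_def mat_def vec_eq_iff)
qed

lemma differentiable_jinv: "p \<in> W \<Longrightarrow> (\<lambda>q. jinv q \<kappa> \<gamma>) differentiable (at p)"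
  unfolding jinv_def
  using c.differentiable_of_invariant[OF c.invariant_gi, of p] W_subset
  by (intro differentiable_sum ballI differentiable_mult differentiable_cjac differentiable_change differentiable_g')
    auto

text \<open>The formula for \<open>jinv\<close> contains the metric and is not visibly holomorphic.
  But its product with the holomorphic Jacobian is constant, so its barred derivative is annihilated
  by an invertible matrix.\<close>

lemma cpartial_jinv:
  assumes "p \<in> W"
  shows "cpartial (Bar \<beta>) (\<lambda>q. jinv q \<kappa> \<epsilon>) p = 0"
proof -
  define x where "x \<gamma> = cpartial (Bar \<beta>) (\<lambda>q. jinv q \<kappa> \<gamma>) p" for \<gamma>
  have x: "(\<Sum>\<gamma>\<in>UNIV. x \<gamma> * J p (Hol \<gamma>) (Hol \<nu>)) = 0" for \<nu>
  proof -
    have "cpartial (Bar \<beta>) (\<lambda>q. \<Sum>\<gamma>\<in>UNIV. jinv q \<kappa> \<gamma> * J q (Hol \<gamma>) (Hol \<nu>)) p =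
        cpartial (Bar \<beta>) (\<lambda>q. if \<kappa> = \<nu> then 1 else 0) p"
      by (rule cpartial_cong[OF open_W assms jinv_left])
    moreover have "cpartial (Bar \<beta>) (\<lambda>q. \<Sum>\<gamma>\<in>UNIV. jinv q \<kappa> \<gamma> * J q (Hol \<gamma>) (Hol \<nu>)) p =
        (\<Sum>\<gamma>\<in>UNIV. x \<gamma> * J p (Hol \<gamma>) (Hol \<nu>))"
      by (simp add: cpartial_sum cpartial_mult differentiable_jinv differentiable_cjac assms
          cpartial_cjac_mixed[OF assms] x_def)
    ultimately show ?thesis by simp
  qed
  have "x \<epsilon> = (\<Sum>\<gamma>\<in>UNIV. x \<gamma> * (\<Sum>\<nu>\<in>UNIV. J p (Hol \<gamma>) (Hol \<nu>) * jinv p \<nu> \<epsilon>))"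
    by (simp add: jinv_right[OF assms] sum_UNIV_delta)
  also have "\<dots> = (\<Sum>\<nu>\<in>UNIV. (\<Sum>\<gamma>\<in>UNIV. x \<gamma> * J p (Hol \<gamma>) (Hol \<nu>)) * jinv p \<nu> \<epsilon>)"
    unfolding sum_distrib_left sum_distrib_right by (subst sum.swap) (simp add: mult.assoc)
  finally show ?thesis by (simp add: x) (simp add: x_def)
qed

text \<open>The transformation of \<open>\<partial> log det h\<close> under \<open>h = j\<^sup>T h' cnj(j)\<close>; the inhomogeneous term
  \<open>\<partial> log det j\<close> is holomorphic.\<close>

lemma theta_change:
  assumes "q \<in> W"
  shows "c.theta \<mu> q = (\<Sum>\<epsilon>\<in>UNIV. J q (Hol \<epsilon>) (Hol \<mu>) * c'.theta \<epsilon> (f q))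
    + (\<Sum>\<kappa>\<in>UNIV. \<Sum>\<gamma>\<in>UNIV. jinv q \<kappa> \<gamma> * cpartial (Hol \<mu>) (\<lambda>q. J q (Hol \<gamma>) (Hol \<kappa>)) q)"
proof -
  let ?j = "\<lambda>\<gamma> \<alpha>. J q (Hol \<gamma>) (Hol \<alpha>)" and ?jb = "\<lambda>\<gamma> \<alpha>. J q (Bar \<gamma>) (Bar \<alpha>)"
  have "c.theta \<mu> q =
    (\<Sum>\<kappa>\<in>UNIV. \<Sum>\<tau>\<in>UNIV. \<Sum>\<gamma>\<in>UNIV. \<Sum>\<delta>\<in>UNIV.
      c.k q \<kappa> \<tau> * (?jb \<delta> \<tau> * c'.h (f q) \<gamma> \<delta>) * cpartial (Hol \<mu>) (\<lambda>q. J q (Hol \<gamma>) (Hol \<kappa>)) q)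
    + (\<Sum>\<kappa>\<in>UNIV. \<Sum>\<tau>\<in>UNIV. \<Sum>\<gamma>\<in>UNIV. \<Sum>\<delta>\<in>UNIV. (?j \<gamma> \<kappa> * ?jb \<delta> \<tau> * c.k q \<kappa> \<tau>) *
        (\<Sum>\<epsilon>\<in>UNIV. ?j \<epsilon> \<mu> * cpartial (Hol \<epsilon>) (\<lambda>q. c'.h q \<gamma> \<delta>) (f q)))"
    unfolding c.theta_def cpartial_h_change[OF assms] sum_distrib_left sum.distrib[symmetric]
    by (intro sum.cong refl) (simp add: distrib_left sum_distrib_left mult_ac)
  also have "(\<Sum>\<kappa>\<in>UNIV. \<Sum>\<tau>\<in>UNIV. \<Sum>\<gamma>\<in>UNIV. \<Sum>\<delta>\<in>UNIV.
      c.k q \<kappa> \<tau> * (?jb \<delta> \<tau> * c'.h (f q) \<gamma> \<delta>) * cpartial (Hol \<mu>) (\<lambda>q. J q (Hol \<gamma>) (Hol \<kappa>)) q) =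
      (\<Sum>\<kappa>\<in>UNIV. \<Sum>\<gamma>\<in>UNIV. jinv q \<kappa> \<gamma> * cpartial (Hol \<mu>) (\<lambda>q. J q (Hol \<gamma>) (Hol \<kappa>)) q)"
    unfolding jinv_def sum_distrib_right by (intro sum.cong[OF refl] sum.swap)
  also have "(\<Sum>\<kappa>\<in>UNIV. \<Sum>\<tau>\<in>UNIV. \<Sum>\<gamma>\<in>UNIV. \<Sum>\<delta>\<in>UNIV. (?j \<gamma> \<kappa> * ?jb \<delta> \<tau> * c.k q \<kappa> \<tau>) *
        (\<Sum>\<epsilon>\<in>UNIV. ?j \<epsilon> \<mu> * cpartial (Hol \<epsilon>) (\<lambda>q. c'.h q \<gamma> \<delta>) (f q))) =
      (\<Sum>\<gamma>\<in>UNIV. \<Sum>\<delta>\<in>UNIV. c'.k (f q) \<gamma> \<delta> *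
        (\<Sum>\<epsilon>\<in>UNIV. ?j \<epsilon> \<mu> * cpartial (Hol \<epsilon>) (\<lambda>q. c'.h q \<gamma> \<delta>) (f q)))"
    unfolding k_change[OF assms] sum_distrib_right[of _ _ "sum _ _"] by (rule sum_swap4)
  also have "\<dots> = (\<Sum>\<gamma>\<in>UNIV. \<Sum>\<delta>\<in>UNIV. \<Sum>\<epsilon>\<in>UNIV. ?j \<epsilon> \<mu> * (c'.k (f q) \<gamma> \<delta> * cpartial (Hol \<epsilon>) (\<lambda>q. c'.h q \<gamma> \<delta>) (f q)))"
    by (simp add: sum_distrib_left mult_ac)
  also have "\<dots> = (\<Sum>\<epsilon>\<in>UNIV. ?j \<epsilon> \<mu> * c'.theta \<epsilon> (f q))"
    unfolding c'.theta_def sum_distrib_left by (rule sum_swap3[symmetric])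
  finally show ?thesis by simp
qed

text \<open>In \<open>theta_change\<close> the barred derivative annihilates the holomorphic
  Jacobian, its unbarred derivative and \<open>jinv\<close>; only the term where it falls on theta
  of the other chart survives.\<close>

lemma ricci_change:
  assumes "p \<in> W"
  shows "ricci M c \<beta> \<mu> p =
    (\<Sum>\<gamma>\<in>UNIV. \<Sum>\<delta>\<in>UNIV. J p (Hol \<gamma>) (Hol \<mu>) * J p (Bar \<delta>) (Bar \<beta>) * ricci M c' \<delta> \<gamma> (f p))"
proof -
  have pU: "p \<in> snd c ` fst c" using assms by blast
  have d': "c'.theta \<gamma> differentiable (at (f p))" for \<gamma>
    by (rule c'.differentiable_of_invariant[OF c'.invariant_theta f_in[OF assms]])
  have sm: "invariant_on 0 W (\<lambda>q. cpartial (Hol \<mu>) (\<lambda>q. J q (Hol \<gamma>) (Hol \<kappa>)) q)" for \<gamma> \<kappa>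
    by (intro invariant_on_cpartial open_W smooth_cjac)
  note d = differentiable_cjac[OF assms] differentiable_change[OF assms d'] differentiable_jinv[OF assms]
    smooth_on_differentiable[OF invariant_on_smooth[OF sm] assms]
  have chain: "cpartial (Bar \<beta>) (\<lambda>q. c'.theta \<gamma> (f q)) p =
      (\<Sum>\<delta>\<in>UNIV. J p (Bar \<delta>) (Bar \<beta>) * ricci M c' \<delta> \<gamma> (f p))" for \<gamma>
    using cpartial_change[OF assms d' invariant_on_vanishes[OF c'.invariant_theta f_in[OF assms]]]
    by (simp add: sum_cidx cjac_mixed[OF assms] c'.ricci_theta[OF f_in[OF assms]])
  have second: "cpartial (Bar \<beta>) (\<lambda>q. cpartial (Hol \<mu>) (\<lambda>q. J q (Hol \<gamma>) (Hol \<kappa>)) q) p = 0" for \<gamma> \<kappa>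
  proof -
    have "cpartial (Bar \<beta>) (\<lambda>q. cpartial (Hol \<mu>) (\<lambda>q. J q (Hol \<gamma>) (Hol \<kappa>)) q) p =
        cpartial (Hol \<mu>) (\<lambda>q. cpartial (Bar \<beta>) (\<lambda>q. J q (Hol \<gamma>) (Hol \<kappa>)) q) p"
      by (rule cpartial_commute[OF open_W invariant_on_smooth[OF smooth_cjac] assms])
    also have "\<dots> = cpartial (Hol \<mu>) (\<lambda>q. 0) p"
      by (rule cpartial_cong[OF open_W assms]) (simp add: cpartial_cjac_mixed)
    finally show ?thesis by simp
  qed
  have "ricci M c \<beta> \<mu> p = cpartial (Bar \<beta>) (\<lambda>q. (\<Sum>\<gamma>\<in>UNIV. J q (Hol \<gamma>) (Hol \<mu>) * c'.theta \<gamma> (f q))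
    + (\<Sum>\<kappa>\<in>UNIV. \<Sum>\<gamma>\<in>UNIV. jinv q \<kappa> \<gamma> * cpartial (Hol \<mu>) (\<lambda>q. J q (Hol \<gamma>) (Hol \<kappa>)) q)) p"
    unfolding c.ricci_theta[OF pU] by (rule cpartial_cong[OF open_W assms theta_change])
  also have "\<dots> = (\<Sum>\<gamma>\<in>UNIV. J p (Hol \<gamma>) (Hol \<mu>) * cpartial (Bar \<beta>) (\<lambda>q. c'.theta \<gamma> (f q)) p)"
    by (simp add: cpartial_add cpartial_sum cpartial_mult d cpartial_jinv[OF assms] second cpartial_cjac_mixed[OF assms])
  finally show ?thesis
    by (simp add: chain sum_distrib_left mult.assoc)
qed

end

section \<open>Transformation of the curvature\<close>

lemma differentiable_cscale:
  fixes X :: "'a::real_normed_vector \<Rightarrow> 'r::finite mat"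
  shows "a differentiable (at p) \<Longrightarrow> X differentiable (at p) \<Longrightarrow> (\<lambda>q. cscale (a q) (X q)) differentiable (at p)"
  unfolding differentiable_def using bounded_bilinear.FDERIV[OF bounded_bilinear_cscale] by blast

locale sasakian_connection =
  fixes M :: "'m::topological_space sasakian_data"
    and B :: "('m, 'e, 'r::finite) bundle_data"
    and \<omega> :: "('m, 'e, 'r) triv \<Rightarrow> 'm chart \<Rightarrow> coords \<Rightarrow> coords \<Rightarrow> 'r mat"
  assumes sasakian: "sasakian M" and sas_bundle: "sasakian_bundle M B" and connection: "\<omega> \<in> connections M B"
begin

abbreviation "Dom b c \<equiv> snd c ` (fst c \<inter> fst b)"
abbreviation "tr \<equiv> transition (proj B)"

lemma group: "compact_matrix_group (grp B)"
  using sas_bundle by (simp add: sasakian_bundle_def)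

lemma foliated_in:
  "b \<in> foliated_trivs B \<Longrightarrow> b \<in> trivs B" "c \<in> foliated_charts M \<Longrightarrow> c \<in> atlas M"
  by (auto simp: foliated_trivs_def foliated_charts_def)

lemma chart: "c \<in> foliated_charts M \<Longrightarrow> foliated_chart M c"
  by (simp add: foliated_chart_def sasakian)

lemma open_triv: "b \<in> foliated_trivs B \<Longrightarrow> open (fst b)"
  using sas_bundle foliated_in(1) unfolding sasakian_bundle_def G_vector_bundle_def is_triv_def by blast

lemma open_dom: "b \<in> foliated_trivs B \<Longrightarrow> c \<in> foliated_charts M \<Longrightarrow> open (Dom b c)"
  by (rule foliated_chart.open_image[OF chart open_triv])

lemma transition_in_group:
  "b \<in> foliated_trivs B \<Longrightarrow> b' \<in> foliated_trivs B \<Longrightarrow> m \<in> fst b \<inter> fst b' \<Longrightarrow> tr b b' m \<in> grp B"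
  using sas_bundle foliated_in(1) unfolding sasakian_bundle_def G_vector_bundle_def triv_compatible_def by blast

lemma transition_invertible:
  "b \<in> foliated_trivs B \<Longrightarrow> b' \<in> foliated_trivs B \<Longrightarrow> m \<in> fst b \<inter> fst b' \<Longrightarrow> invertible (tr b b' m)"
  using transition_in_group group unfolding compact_matrix_group_def by blast

lemma
  assumes b: "b \<in> foliated_trivs B" and c: "c \<in> foliated_charts M"
  shows connection_invariant: "invariant_on (0, 1) (Dom b c) (\<lambda>p. \<omega> b c p v)"
    and connection_linear: "p \<in> Dom b c \<Longrightarrow> linear (\<omega> b c p)"
    and connection_reeb: "p \<in> Dom b c \<Longrightarrow> \<omega> b c p (0, 1) = 0"
    and connection_in_lie_algebra: "p \<in> Dom b c \<Longrightarrow> \<omega> b c p v \<in> lie_algebra (grp B)"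
proof -
  interpret foliated_chart M c by (rule chart[OF c])
  have form: "one_form_on (atlas M) (fst b) (\<omega> b)"
    using connection foliated_in(1)[OF b] by (simp add: connections_def)
  have basic: "basic_on (Dom b c) (\<lambda>p. \<omega> b c p v)"
    using connection b c by (simp add: connections_def)
  have "smooth_on (Dom b c) (\<lambda>p. \<omega> b c p v)"
    using form in_atlas by (simp add: one_form_on_def)
  with basic show "invariant_on (0, 1) (Dom b c) (\<lambda>p. \<omega> b c p v)"
    by (simp add: invariant_on_basic)
  show "p \<in> Dom b c \<Longrightarrow> linear (\<omega> b c p)"
    using form in_atlas unfolding one_form_on_def by blast
  have conn: "\<omega> b c (snd c m) v \<in> lie_algebra (grp B)" "\<omega> b c (snd c m) (xi M c (snd c m)) = pconn B b m"
    if "m \<in> fst c \<inter> fst b" for m v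
    using connection foliated_in(1)[OF b] in_atlas that unfolding connections_def by blast+
  then show "p \<in> Dom b c \<Longrightarrow> \<omega> b c p v \<in> lie_algebra (grp B)"
    by blast
  show "\<omega> b c p (0, 1) = 0" if "p \<in> Dom b c"
  proof -
    from that obtain m where m: "p = snd c m" "m \<in> fst c \<inter> fst b" by blast
    have "pconn B b m = 0"
      using b m(2) by (simp add: foliated_trivs_def)
    then show ?thesis
      using conn(2)[OF m(2)] reeb[of "snd c m"] m by auto
  qed
qed

lemma invariant_connA:
  assumes "b \<in> foliated_trivs B" "c \<in> foliated_charts M"
  shows "invariant_on (0, 1) (Dom b c) (connA (\<omega> b c) A)"
  unfolding connA_def cextM_eq
  by (intro invariant_on_intros open_dom connection_invariant assms)

lemma differentiable_connA:
  assumes "b \<in> foliated_trivs B" "c \<in> foliated_charts M" "p \<in> Dom b c"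
  shows "connA (\<omega> b c) A differentiable (at p)"
  using invariant_on_smooth[OF invariant_connA[OF assms(1,2)]] assms(3) by (rule smooth_on_differentiable)

lemma invariant_curvF:
  assumes "b \<in> foliated_trivs B" "c \<in> foliated_charts M"
  shows "invariant_on (0, 1) (Dom b c) (curvF (\<omega> b c) A D)"
  unfolding curvF_def
  by (intro invariant_on_intros invariant_on_cpartialM invariant_connA open_dom assms)

lemma connA_in_complex_lie_algebra:
  assumes "b \<in> foliated_trivs B" "c \<in> foliated_charts M" "p \<in> Dom b c"
  shows "connA (\<omega> b c) A p \<in> complex_lie_algebra (grp B)"
  unfolding connA_def cextM_eq
  by (intro complex_lie_algebra_cscale complex_lie_algebra_add lie_algebra_in_complex
      connection_in_lie_algebra group assms)

lemma curvF_in_complex_lie_algebra: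
  assumes "b \<in> foliated_trivs B" "c \<in> foliated_charts M" "p \<in> Dom b c"
  shows "curvF (\<omega> b c) A D p \<in> complex_lie_algebra (grp B)"
  unfolding curvF_def
  by (intro complex_lie_algebra_diff complex_lie_algebra_comm connA_in_complex_lie_algebra
      cpartialM_in_complex_lie_algebra[OF group open_dom] differentiable_connA group) (use assms in simp_all)

text \<open>With the frame fixed, the connection components transform as a covector. The derivatives
  of the Jacobian that appear in the exterior derivative are symmetric in the two indices and drop
  out of the difference.\<close>

lemma curvF_change:
  assumes b: "b \<in> foliated_trivs B" and c: "c \<in> foliated_charts M" and c': "c' \<in> foliated_charts M"
    and m: "m \<in> fst c \<inter> fst c' \<inter> fst b"
  shows "curvF (\<omega> b c) A D (snd c m) = (\<Sum>C\<in>UNIV. \<Sum>E\<in>UNIV.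
    cscale (cjac c c' (snd c m) C A * cjac c c' (snd c m) E D) (curvF (\<omega> b c') C E (snd c' m)))"
proof -
  interpret foliated_change M c c'
    by (simp add: foliated_change_def chart c c')
  define X where "X = snd c ` (fst c \<inter> (fst c' \<inter> fst b))"
  define p where "p = snd c m"
  have c'op: "open (fst c')"
    using sasakian c'.in_atlas unfolding sasakian_def smooth_atlas_def is_chart_def by blast
  have open_X: "open X"
    unfolding X_def by (intro c.open_image open_Int open_triv b c'op)
  have pX: "p \<in> X" using m by (auto simp: p_def X_def)
  have XW: "q \<in> W" if "q \<in> X" for q using that by (auto simp: X_def)
  have fX: "f q \<in> Dom b c'" if "q \<in> X" for q using that by (auto simp: X_def change_snd)
  note J = differentiable_cjac[OF XW[OF pX]]
  note A' = differentiable_connA[OF b c' fX[OF pX]]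
  note A'f = differentiable_change[OF XW[OF pX] A']
  let ?a = "connA (\<omega> b c)" and ?a' = "connA (\<omega> b c')"
  have a: "?a A q = (\<Sum>C\<in>UNIV. cscale (J q C A) (?a' C (f q)))" if "q \<in> X" for A q
  proof -
    have form: "one_form_on (atlas M) (fst b) (\<omega> b)"
      using connection foliated_in(1)[OF b] by (simp add: connections_def)
    have "q \<in> snd c ` (fst c \<inter> fst c' \<inter> fst b)"
      using that by (auto simp: X_def)
    then have "\<omega> b c q v = \<omega> b c' (f q) (dchange c c' q v)" for v
      using form c.in_atlas c'.in_atlas unfolding one_form_on_def by blast
    then have "\<omega> b c q = (\<lambda>v. \<omega> b c' (f q) (dchange c c' q v))"
      by (rule ext)
    then show ?thesis
      using cextM_pullback[OF XW[OF that] connection_linear[OF b c' fX[OF that]] connection_reeb[OF b c' fX[OF that]]]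
      by (simp add: connA_def)
  qed
  have "cpartialM A (?a D) p = (\<Sum>C\<in>UNIV. cscale (cpartial A (\<lambda>q. J q C D) p) (?a' C (f p))) +
      (\<Sum>E\<in>UNIV. \<Sum>C\<in>UNIV. cscale (J p C A * J p E D) (cpartialM C (?a' E) (f p)))" for A D
  proof -
    have "cpartialM A (?a D) p = cpartialM A (\<lambda>q. \<Sum>C\<in>UNIV. cscale (J q C D) (?a' C (f q))) p"
      by (rule cpartialM_cong[OF open_X pX a])
    also have "\<dots> = (\<Sum>C\<in>UNIV. cpartialM A (\<lambda>q. cscale (J q C D) (?a' C (f q))) p)"
      by (intro cpartialM_sum differentiable_cscale J A'f)
    also have "\<dots> = (\<Sum>C\<in>UNIV. cscale (cpartial A (\<lambda>q. J q C D) p) (?a' C (f p)) +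
        cscale (J p C D) (cpartialM A (\<lambda>q. ?a' C (f q)) p))"
      by (intro sum.cong refl cpartialM_cscale J A'f)
    also have "\<dots> = (\<Sum>C\<in>UNIV. cscale (cpartial A (\<lambda>q. J q C D) p) (?a' C (f p)) +
        cscale (J p C D) (\<Sum>E\<in>UNIV. cscale (J p E A) (cpartialM E (?a' C) (f p))))"
      by (simp only: cpartialM_change[OF XW[OF pX] A' invariant_on_vanishes[OF invariant_connA[OF b c'] fX[OF pX]]])
    finally show ?thesis
      by (simp add: sum.distrib cscale_sum_right cscale_simps mult.commute)
  qed
  note d = this
  have swap: "(\<Sum>E\<in>UNIV. \<Sum>C\<in>UNIV. cscale (J p C A * J p E D) (cpartialM C (?a' E) (f p))) =
      (\<Sum>C\<in>UNIV. \<Sum>E\<in>UNIV. cscale (J p C A * J p E D) (cpartialM C (?a' E) (f p)))"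
    by (rule sum.swap)
  have br: "comm (?a A p) (?a D p) = (\<Sum>C\<in>UNIV. \<Sum>E\<in>UNIV. cscale (J p C A * J p E D) (comm (?a' C (f p)) (?a' E (f p))))"
    unfolding a[OF pX] by (subst sum.swap)
      (simp add: comm_sum_left comm_sum_right comm_simps cscale_simps cscale_sum_right mult.commute)
  have "curvF (\<omega> b c) A D p = (\<Sum>C\<in>UNIV. \<Sum>E\<in>UNIV. cscale (J p C A * J p E D) (curvF (\<omega> b c') C E (f p)))"
    unfolding curvF_def d br cpartial_cjac_sym[OF XW[OF pX], of A _ D] swap
    by (simp add: cscale_simps sum_subtractf mult.commute)
  moreover have "f p = snd c' m"
    using m by (simp add: p_def change_snd)
  ultimately show ?thesis by (simp add: p_def)
qed

text \<open>With the chart fixed, A becomes \<open>t A t^-1 + (dt) t^-1\<close>. The inhomogeneous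
  terms cancel by the derivative of the inverse, obtained from \<open>t u = 1\<close>, and by the
  symmetry of the second derivatives of \<open>t\<close>.\<close>

lemma curvF_gauge:
  assumes b: "b \<in> foliated_trivs B" and b': "b' \<in> foliated_trivs B" and c: "c \<in> foliated_charts M"
    and m: "m \<in> fst c \<inter> fst b \<inter> fst b'"
  shows "curvF (\<omega> b' c) A D (snd c m) =
    tr b b' m ** curvF (\<omega> b c) A D (snd c m) ** matrix_inv (tr b b' m)"
proof -
  interpret foliated_chart M c by (rule chart[OF c])
  define X where "X = snd c ` (fst c \<inter> (fst b \<inter> fst b'))"
  define p where "p = snd c m"
  define t where "t = tr b b' \<circ> chart_inv c"
  define u where "u q = matrix_inv (t q)" for q
  have open_X: "open X"
    unfolding X_def by (intro open_image open_Int open_triv b b')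
  have pX: "p \<in> X" using m by (auto simp: p_def X_def)
  have Xd: "q \<in> Dom b c" "q \<in> Dom b' c" if "q \<in> X" for q using that by (auto simp: X_def)
  have t_snd: "t (snd c m) = tr b b' m" if "m \<in> fst c" for m
    by (simp add: t_def chart_inv_snd[OF that])
  have t_inv: "invertible (t q)" if "q \<in> X" for q
    using that transition_invertible[OF b b'] by (auto simp: X_def t_snd)
  have tu: "t q ** u q = mat 1" "u q ** t q = mat 1" if "q \<in> X" for q
    unfolding u_def by (rule matrix_inv_mult[OF t_inv[OF that]])+
  have "triv_compatible (atlas M) (grp B) (proj B) b b'"
    using sas_bundle foliated_in(1)[OF b] foliated_in(1)[OF b']
    unfolding sasakian_bundle_def G_vector_bundle_def by blast
  then have smooth_t: "invariant_on 0 X t"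
    using in_atlas by (simp add: invariant_on_zero triv_compatible_def t_def X_def Int_assoc)
  have smooth_u: "invariant_on 0 X u"
    unfolding u_def by (rule invariant_on_matrix_inv[OF open_X smooth_t t_inv])
  let ?a = "connA (\<omega> b c)" and ?a' = "connA (\<omega> b' c)"
  have smooth_dt: "invariant_on 0 X (cpartialM A t)" for A
    by (intro invariant_on_cpartialM open_X smooth_t)
  have diff: "Y differentiable (at p)" if "invariant_on 0 X Y" for Y :: "coords \<Rightarrow> 'r mat"
    using that pX by (simp add: invariant_on_zero smooth_on_differentiable)
  note d = diff[OF smooth_t] diff[OF smooth_u] diff[OF smooth_dt] differentiable_connA[OF b c Xd(1)[OF pX]]
    differentiable_matrix_mult
  have a': "?a' A q = t q ** ?a A q ** u q + cpartialM A t q ** u q" if "q \<in> X" for A q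
  proof -
    from that obtain n where n: "q = snd c n" "n \<in> fst c \<inter> fst b \<inter> fst b'" by (auto simp: X_def)
    have "\<forall>v. let t = tr b b' in
        \<omega> b' c (snd c n) v = t n ** \<omega> b c (snd c n) v ** matrix_inv (t n)
          + frechet_derivative (t \<circ> chart_inv c) (at (snd c n)) v ** matrix_inv (t n)"
      using connection foliated_in(1)[OF b] foliated_in(1)[OF b'] in_atlas n(2)
      unfolding connections_def by blast
    then have "\<omega> b' c q v = t q ** \<omega> b c q v ** u q + frechet_derivative t (at q) v ** u q" for v
      using n t_snd[of n] by (simp add: Let_def u_def t_def)
    then show ?thesis
      by (simp add: connA_def cpartialM_def cextM_eq matrix_ring_simps cscale_simps)
  qed
  have du: "cpartialM A u p = - (u p ** cpartialM A t p ** u p)" for A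
  proof -
    have "cpartialM A (\<lambda>q. t q ** u q) p = cpartialM A (\<lambda>q. mat 1) p"
      by (rule cpartialM_cong[OF open_X pX tu(1)])
    then have "cpartialM A t p ** u p + t p ** cpartialM A u p = 0"
      by (simp add: cpartialM_matrix_mult d)
    then have "u p ** (cpartialM A t p ** u p) + u p ** t p ** cpartialM A u p = 0"
      by (metis matrix_mul_assoc matrix_ring_simps(1,7))
    then show ?thesis
      by (simp add: tu[OF pX] matrix_mul_assoc eq_neg_iff_add_eq_0 add.commute)
  qed
  have da': "cpartialM A (?a' D) p = cpartialM A t p ** ?a D p ** u p + t p ** cpartialM A (?a D) p ** u p
      - t p ** ?a D p ** (u p ** cpartialM A t p ** u p) + cpartialM A (cpartialM D t) p ** u p
      - cpartialM D t p ** (u p ** cpartialM A t p ** u p)" for A D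
  proof -
    have "cpartialM A (?a' D) p = cpartialM A (\<lambda>q. t q ** ?a D q ** u q + cpartialM D t q ** u q) p"
      by (rule cpartialM_cong[OF open_X pX a'])
    then show ?thesis
      by (simp add: cpartialM_add cpartialM_matrix_mult d du matrix_ring_simps)
  qed
  have commute: "cpartialM A (cpartialM D t) p = cpartialM D (cpartialM A t) p"
    using cpartialM_commute[OF open_X invariant_on_smooth[OF smooth_t] pX] .
  have cancel: "Y ** u p ** t p = Y" for Y
    by (simp add: matrix_mul_assoc[symmetric] tu[OF pX])
  have "curvF (\<omega> b' c) A D p = t p ** curvF (\<omega> b c) A D p ** u p"
    unfolding curvF_def da' commute a'[OF pX] comm_def
    by (simp add: matrix_ring_simps matrix_mul_assoc cancel)
  then show ?thesis
    using m by (simp add: p_def u_def t_snd)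
qed

lemma curvF_transform:
  assumes "b \<in> foliated_trivs B" "b' \<in> foliated_trivs B" "c \<in> foliated_charts M" "c' \<in> foliated_charts M"
    and "m \<in> fst c \<inter> fst c' \<inter> fst b \<inter> fst b'"
  shows "tr b b' m ** curvF (\<omega> b c) A D (snd c m) ** matrix_inv (tr b b' m) = (\<Sum>C\<in>UNIV. \<Sum>E\<in>UNIV.
    cscale (cjac c c' (snd c m) C A * cjac c c' (snd c m) E D) (curvF (\<omega> b' c') C E (snd c' m)))"
  using curvF_gauge[OF assms(1-3), of m A D] curvF_change[OF assms(2-4), of m A D] assms(5) by simp

end

section \<open>The curvature endomorphisms\<close>

lemma sum_lists_length_2:
  fixes F :: "'a::finite list \<Rightarrow> 'b::comm_monoid_add"
  shows "(\<Sum>Cs | length Cs = 2. F Cs) = (\<Sum>C\<in>UNIV. \<Sum>D\<in>UNIV. F [C, D])"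
proof -
  have "(\<Sum>Cs | length Cs = 2. F Cs) = (\<Sum>(C, D)\<in>UNIV \<times> UNIV. F [C, D])"
    by (rule sum.reindex_bij_witness[of _ "\<lambda>(C, D). [C, D]" "\<lambda>Cs. (Cs ! 0, Cs ! 1)"])
      (auto simp: length_Suc_conv numeral_2_eq_2)
  then show ?thesis by (simp add: sum.cartesian_product)
qed

lemma
  assumes "\<phi> \<in> Omega k l M B" "b \<in> foliated_trivs B" "c \<in> foliated_charts M"
  shows Omega_invariant: "invariant_on (0, 1) (snd c ` (fst c \<inter> fst b)) (\<phi> b c As)"
    and Omega_in_complex_lie_algebra:
      "p \<in> snd c ` (fst c \<inter> fst b) \<Longrightarrow> \<phi> b c As p \<in> complex_lie_algebra (grp B)"
    and Omega_type: "p \<in> snd c ` (fst c \<inter> fst b) \<Longrightarrow>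
      \<not> (length (filter isl As) = k \<and> length (filter (Not \<circ> isl) As) = l) \<Longrightarrow> \<phi> b c As p = 0"
    and Omega_antisym: "p \<in> snd c ` (fst c \<inter> fst b) \<Longrightarrow> \<phi> b c [D, C] p = - \<phi> b c [C, D] p"
proof -
  have \<phi>: "smooth_on (snd c ` (fst c \<inter> fst b)) (\<phi> b c As) \<and>
        basic_on (snd c ` (fst c \<inter> fst b)) (\<phi> b c As) \<and>
        (\<forall>p \<in> snd c ` (fst c \<inter> fst b).
           \<phi> b c As p \<in> complex_lie_algebra (grp B) \<and>
           (\<not> (length (filter isl As) = k \<and> length (filter (Not \<circ> isl) As) = l) \<longrightarrow> \<phi> b c As p = 0) \<and>
           (\<forall>j < length As. \<forall>i < j. \<phi> b c (As[i := As ! j, j := As ! i]) p = - \<phi> b c As p))" for As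
    using assms unfolding Omega_def by blast
  show "invariant_on (0, 1) (snd c ` (fst c \<inter> fst b)) (\<phi> b c As)"
    using \<phi> by (simp add: invariant_on_basic)
  show "p \<in> snd c ` (fst c \<inter> fst b) \<Longrightarrow> \<phi> b c As p \<in> complex_lie_algebra (grp B)"
    "p \<in> snd c ` (fst c \<inter> fst b) \<Longrightarrow>
      \<not> (length (filter isl As) = k \<and> length (filter (Not \<circ> isl) As) = l) \<Longrightarrow> \<phi> b c As p = 0"
    using \<phi> by blast+
  assume "p \<in> snd c ` (fst c \<inter> fst b)"
  then have "\<forall>j < length [C, D]. \<forall>i < j. \<phi> b c ([C, D][i := [C, D] ! j, j := [C, D] ! i]) p = - \<phi> b c [C, D] p"
    using \<phi>[of "[C, D]"] by blast
  from this[rule_format, of 1 0] show "\<phi> b c [D, C] p = - \<phi> b c [C, D] p"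
    by simp
qed

lemma Omega_transform:
  assumes "\<phi> \<in> Omega k l M B" "b \<in> foliated_trivs B" "b' \<in> foliated_trivs B"
    "c \<in> foliated_charts M" "c' \<in> foliated_charts M" "m \<in> fst c \<inter> fst c' \<inter> fst b \<inter> fst b'"
  shows "transition (proj B) b b' m ** \<phi> b c [A, D] (snd c m) ** matrix_inv (transition (proj B) b b' m) =
    (\<Sum>C\<in>UNIV. \<Sum>E\<in>UNIV.
      cscale (cjac c c' (snd c m) C A * cjac c c' (snd c m) E D) (\<phi> b' c' [C, E] (snd c' m)))"
proof -
  have "\<forall>As. let t = transition (proj B) b b' m in
        t ** \<phi> b c As (snd c m) ** matrix_inv t =
          (\<Sum>Cs | length Cs = length As.
             cscale (\<Prod>i<length As. cjac c c' (snd c m) (Cs ! i) (As ! i)) (\<phi> b' c' Cs (snd c' m)))"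
    using assms unfolding Omega_def by blast
  from this[rule_format, of "[A, D]"] show ?thesis
    by (simp add: Let_def numeral_2_eq_2[symmetric] sum_lists_length_2)
      (simp add: numeral_2_eq_2 lessThan_Suc mult.commute)
qed

text \<open>Both \<open>\<F>\<close> and \<open>\<R>\<close> pair the form with a tensor of type \<open>(1,1)\<close> and
  contract: with the curvature through the commutator, and with the Ricci tensor, regarded as a
  scalar matrix, through the product.\<close>

definition contraction ::
  "'m sasakian_data \<Rightarrow> ('r::finite mat \<Rightarrow> 'r mat \<Rightarrow> 'r mat) \<Rightarrow>
   (('m, 'e, 'r) triv \<Rightarrow> 'm chart \<Rightarrow> cidx \<Rightarrow> cidx \<Rightarrow> coords \<Rightarrow> 'r mat) \<Rightarrow>
   ('m, 'e, 'r) gforms \<Rightarrow> ('m, 'e, 'r) gforms" where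
  "contraction M P K \<phi> b c As p = (case As of
      [Inl \<mu>, Inl \<nu>] \<Rightarrow> (\<Sum>\<alpha>\<in>UNIV. \<Sum>\<beta>\<in>UNIV. cscale (gup M c p (Hol \<alpha>) (Bar \<beta>))
         (P (\<phi> b c [Hol \<alpha>, Hol \<nu>] p) (K b c (Hol \<mu>) (Bar \<beta>) p)
          - P (\<phi> b c [Hol \<alpha>, Hol \<mu>] p) (K b c (Hol \<nu>) (Bar \<beta>) p)))
    | _ \<Rightarrow> 0)"

lemma contraction_other: "(\<And>\<mu> \<nu>. As \<noteq> [Hol \<mu>, Hol \<nu>]) \<Longrightarrow> contraction M P K \<phi> b c As p = 0"
  by (auto simp: contraction_def split: list.split sum.split)

definition ricci_matrix ::
  "'m sasakian_data \<Rightarrow> 'm chart \<Rightarrow> cidx \<Rightarrow> cidx \<Rightarrow> coords \<Rightarrow> 'r::finite mat" where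
  "ricci_matrix M c A D p =
     cscale (case (A, D) of (Inl \<mu>, Inr \<beta>) \<Rightarrow> ricci M c \<beta> \<mu> p | _ \<Rightarrow> 0) (mat 1)"

lemma F_op_eq: "F_op M \<omega> = contraction M comm (\<lambda>b c. curvF (\<omega> b c))"
  by (intro ext) (simp add: F_op_def contraction_def)

lemma R_op_eq: "R_op M = contraction M (**) (\<lambda>b c. ricci_matrix M c)"
  by (intro ext) (simp add: R_op_def contraction_def ricci_matrix_def cscale_simps split: list.split sum.split)

text \<open>What \<F> and \<R> share: a pairing that commutes with conjugation by the frame change,
  and a tensor \<open>K\<close> with the same transformation law as a form. The pairing as a whole,
  not \<open>K\<close>, is required to have values in the complexified Lie algebra, because the
  scalar matrix carrying the Ricci tensor need not lie there.\<close>

locale tensorial_pairing = sasakian_connection M B \<omega>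
  for M :: "'m::topological_space sasakian_data" and B :: "('m, 'e, 'r::finite) bundle_data" and \<omega> +
  fixes P :: "'r mat \<Rightarrow> 'r mat \<Rightarrow> 'r mat"
    and K :: "('m, 'e, 'r) triv \<Rightarrow> 'm chart \<Rightarrow> cidx \<Rightarrow> cidx \<Rightarrow> coords \<Rightarrow> 'r mat"
  assumes bilinear: "bounded_bilinear P"
    and cscale_left: "P (cscale a X) Y = cscale a (P X Y)"
    and cscale_right: "P X (cscale a Y) = cscale a (P X Y)"
    and equivariant: "invertible t \<Longrightarrow>
      P (t ** X ** matrix_inv t) (t ** Y ** matrix_inv t) = t ** P X Y ** matrix_inv t"
    and invariant_K: "b \<in> foliated_trivs B \<Longrightarrow> c \<in> foliated_charts M \<Longrightarrow>
      invariant_on (0, 1) (snd c ` (fst c \<inter> fst b)) (K b c A D)"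
    and pairing_in_complex_lie_algebra: "b \<in> foliated_trivs B \<Longrightarrow> c \<in> foliated_charts M \<Longrightarrow>
      p \<in> snd c ` (fst c \<inter> fst b) \<Longrightarrow> X \<in> complex_lie_algebra (grp B) \<Longrightarrow>
      P X (K b c A D p) \<in> complex_lie_algebra (grp B)"
    and transform_K: "b \<in> foliated_trivs B \<Longrightarrow> b' \<in> foliated_trivs B \<Longrightarrow> c \<in> foliated_charts M \<Longrightarrow>
      c' \<in> foliated_charts M \<Longrightarrow> m \<in> fst c \<inter> fst c' \<inter> fst b \<inter> fst b' \<Longrightarrow>
      transition (proj B) b b' m ** K b c A D (snd c m) ** matrix_inv (transition (proj B) b b' m) =
      (\<Sum>C\<in>UNIV. \<Sum>E\<in>UNIV. cscale (cjac c c' (snd c m) C A * cjac c c' (snd c m) E D) (K b' c' C E (snd c' m)))"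
begin

lemma sum_left: "P (\<Sum>i\<in>I. X i) Y = (\<Sum>i\<in>I. P (X i) Y)"
  by (rule bounded_bilinear.sum_left[OF bilinear])

lemma sum_right: "P X (\<Sum>i\<in>I. Y i) = (\<Sum>i\<in>I. P X (Y i))"
  by (rule bounded_bilinear.sum_right[OF bilinear])

text \<open>The contraction before antisymmetrisation, summed over all complex indices so that it
  transforms formally under the full Jacobian. For forms of type (2,0) the additional terms vanish
  by type.\<close>

definition pair_trace :: "('m, 'e, 'r) gforms \<Rightarrow> ('m, 'e, 'r) triv \<Rightarrow> 'm chart \<Rightarrow> cidx \<Rightarrow> cidx \<Rightarrow> coords \<Rightarrow> 'r mat" where
  "pair_trace \<phi> b c N L p = (\<Sum>A\<in>UNIV. \<Sum>D\<in>UNIV. cscale (gup M c p A D) (P (\<phi> b c [A, L] p) (K b c N D p)))"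

lemma contraction_eq:
  assumes "\<phi> \<in> Omega 2 0 M B" "b \<in> foliated_trivs B" "c \<in> foliated_charts M" "p \<in> Dom b c"
  shows "contraction M P K \<phi> b c [Hol \<mu>, Hol \<nu>] p =
    pair_trace \<phi> b c (Hol \<mu>) (Hol \<nu>) p - pair_trace \<phi> b c (Hol \<nu>) (Hol \<mu>) p"
proof -
  interpret foliated_chart M c by (rule chart[OF assms(3)])
  have pU: "p \<in> U" using assms(4) by blast
  have "\<phi> b c [Bar \<alpha>, L] p = 0" for \<alpha> L
    by (rule Omega_type[OF assms]) (cases L; simp)
  then have "pair_trace \<phi> b c N L p =
      (\<Sum>\<alpha>\<in>UNIV. \<Sum>\<beta>\<in>UNIV. cscale (gup M c p (Hol \<alpha>) (Bar \<beta>)) (P (\<phi> b c [Hol \<alpha>, L] p) (K b c N (Bar \<beta>) p)))" for N L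
    by (simp add: pair_trace_def sum_cidx gi_pure[OF pU] cscale_simps bounded_bilinear.zero_left[OF bilinear])
  then show ?thesis
    by (simp add: contraction_def cscale_simps sum_subtractf)
qed

text \<open>Equivariance brings the conjugation inside the pairing, where both factors transform as
  tensors. The two Jacobians at the contracted indices are absorbed by \<open>gup_change\<close>,
  the two at the free indices remain; the rest is reordering of sums.\<close>

lemma pair_trace_transform:
  assumes "\<phi> \<in> Omega 2 0 M B" "b \<in> foliated_trivs B" "b' \<in> foliated_trivs B"
    "c \<in> foliated_charts M" "c' \<in> foliated_charts M" "m \<in> fst c \<inter> fst c' \<inter> fst b \<inter> fst b'"
  shows "tr b b' m ** pair_trace \<phi> b c N L (snd c m) ** matrix_inv (tr b b' m) =
    (\<Sum>E\<in>UNIV. \<Sum>D\<in>UNIV. cscale (cjac c c' (snd c m) E N * cjac c c' (snd c m) D L)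
      (pair_trace \<phi> b' c' E D (snd c' m)))"
proof -
  interpret foliated_change M c c'
    by (simp add: foliated_change_def chart assms)
  let ?p = "snd c m" and ?t = "tr b b' m"
  have pW: "?p \<in> W" using assms(6) by blast
  have fp: "f ?p = snd c' m" using assms(6) by (simp add: change_snd)
  have inv: "invertible ?t"
    using transition_invertible[OF assms(2,3)] assms(6) by blast
  let ?\<phi>' = "\<lambda>C D. \<phi> b' c' [C, D] (snd c' m)" and ?K' = "\<lambda>E F. K b' c' E F (snd c' m)"
  have conj_cscale: "?t ** cscale a X ** matrix_inv ?t = cscale a (?t ** X ** matrix_inv ?t)" for a X
    by (simp add: cscale_simps)
  have conj_sum: "?t ** (\<Sum>i\<in>I. X i) ** matrix_inv ?t = (\<Sum>i\<in>I. ?t ** X i ** matrix_inv ?t)" for I :: "cidx set" and X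
    by (induction I rule: infinite_finite_induct) (auto simp: matrix_ring_simps)
  have "?t ** pair_trace \<phi> b c N L ?p ** matrix_inv ?t =
      (\<Sum>A\<in>UNIV. \<Sum>B'\<in>UNIV. cscale (gup M c ?p A B')
        (P (?t ** \<phi> b c [A, L] ?p ** matrix_inv ?t) (?t ** K b c N B' ?p ** matrix_inv ?t)))"
    by (simp only: pair_trace_def conj_sum conj_cscale equivariant[OF inv])
  also have "\<dots> = (\<Sum>A\<in>UNIV. \<Sum>B'\<in>UNIV. \<Sum>C\<in>UNIV. \<Sum>D\<in>UNIV. \<Sum>E\<in>UNIV. \<Sum>F\<in>UNIV.
      cscale (gup M c ?p A B' * (J ?p C A * J ?p D L * (J ?p E N * J ?p F B'))) (P (?\<phi>' C D) (?K' E F)))"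
    unfolding Omega_transform[OF assms] transform_K[OF assms(2-6)]
    by (simp only: sum_left, simp only: sum_right cscale_left cscale_right cscale_sum_right cscale_simps,
        intro sum.cong refl arg_cong2[where f = cscale], simp only: mult_ac)
  also have "\<dots> = (\<Sum>C\<in>UNIV. \<Sum>D\<in>UNIV. \<Sum>A\<in>UNIV. \<Sum>B'\<in>UNIV. \<Sum>E\<in>UNIV. \<Sum>F\<in>UNIV.
      cscale (gup M c ?p A B' * (J ?p C A * J ?p D L * (J ?p E N * J ?p F B'))) (P (?\<phi>' C D) (?K' E F)))"
    by (rule sum_swap4)
  also have "\<dots> = (\<Sum>C\<in>UNIV. \<Sum>D\<in>UNIV. \<Sum>E\<in>UNIV. \<Sum>F\<in>UNIV. \<Sum>A\<in>UNIV. \<Sum>B'\<in>UNIV.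
      cscale (gup M c ?p A B' * (J ?p C A * J ?p D L * (J ?p E N * J ?p F B'))) (P (?\<phi>' C D) (?K' E F)))"
    by (intro sum.cong[OF refl] sum_swap4)
  also have "\<dots> = (\<Sum>C\<in>UNIV. \<Sum>D\<in>UNIV. \<Sum>E\<in>UNIV. \<Sum>F\<in>UNIV.
      cscale (J ?p E N * J ?p D L) (cscale (gup M c' (snd c' m) C F) (P (?\<phi>' C D) (?K' E F))))"
  proof (intro sum.cong refl)
    fix C D E F
    show "(\<Sum>A\<in>UNIV. \<Sum>B'\<in>UNIV. cscale (gup M c ?p A B' * (J ?p C A * J ?p D L * (J ?p E N * J ?p F B'))) (P (?\<phi>' C D) (?K' E F))) =
        cscale (J ?p E N * J ?p D L) (cscale (gup M c' (snd c' m) C F) (P (?\<phi>' C D) (?K' E F)))"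
      unfolding gup_change[OF pW, unfolded fp] cscale_sum_left cscale_sum_right cscale_simps
      by (intro sum.cong refl arg_cong2[where f = cscale]) (simp only: mult_ac)
  qed
  also have "\<dots> = (\<Sum>D\<in>UNIV. \<Sum>E\<in>UNIV. \<Sum>C\<in>UNIV. \<Sum>F\<in>UNIV.
      cscale (J ?p E N * J ?p D L) (cscale (gup M c' (snd c' m) C F) (P (?\<phi>' C D) (?K' E F))))"
    by (rule sum_swap3)
  also have "\<dots> = (\<Sum>E\<in>UNIV. \<Sum>D\<in>UNIV. cscale (J ?p E N * J ?p D L) (pair_trace \<phi> b' c' E D (snd c' m)))"
    unfolding pair_trace_def cscale_sum_right by (rule sum.swap)
  finally show ?thesis .
qed

lemma contraction_in_complex_lie_algebra:
  assumes "\<phi> \<in> Omega 2 0 M B" "b \<in> foliated_trivs B" "c \<in> foliated_charts M" "p \<in> Dom b c"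
  shows "contraction M P K \<phi> b c As p \<in> complex_lie_algebra (grp B)"
proof (cases "\<exists>\<mu> \<nu>. As = [Hol \<mu>, Hol \<nu>]")
  case True
  then obtain \<mu> \<nu> where "As = [Hol \<mu>, Hol \<nu>]" by blast
  then show ?thesis
    unfolding contraction_def
    by (simp, intro complex_lie_algebra_sum complex_lie_algebra_cscale complex_lie_algebra_diff group
        pairing_in_complex_lie_algebra Omega_in_complex_lie_algebra[OF assms(1)] assms)
next
  case False
  then have "contraction M P K \<phi> b c As p = 0"
    by (intro contraction_other) blast
  then show ?thesis
    by (simp add: complex_lie_algebra_zero group)
qed

lemma contraction_invariant:
  assumes "\<phi> \<in> Omega 2 0 M B" "b \<in> foliated_trivs B" "c \<in> foliated_charts M"
  shows "invariant_on (0, 1) (Dom b c) (contraction M P K \<phi> b c As)"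
proof (cases "\<exists>\<mu> \<nu>. As = [Hol \<mu>, Hol \<nu>]")
  case True
  interpret foliated_chart M c by (rule chart[OF assms(3)])
  have "invariant_on (0, 1) (Dom b c) (\<lambda>q. gup M c q A D)" for A D
    by (rule invariant_on_subset[OF invariant_gi]) blast
  moreover from True obtain \<mu> \<nu> where "As = [Hol \<mu>, Hol \<nu>]" by blast
  ultimately show ?thesis
    unfolding contraction_def[abs_def]
    by (simp, intro invariant_on_sum invariant_on_cscale invariant_on_diff invariant_on_bounded_bilinear[OF _ bilinear]
        Omega_invariant[OF assms(1)] invariant_K open_dom assms)
next
  case False
  then have "contraction M P K \<phi> b c As = (\<lambda>p. 0)"
    by (intro ext contraction_other) blast
  then show ?thesis by (simp add: invariant_on_const)
qed

lemma contraction_swap: "contraction M P K \<phi> b c [D, C] p = - contraction M P K \<phi> b c [C, D] p"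
  by (cases C; cases D) (simp_all add: contraction_def cscale_simps sum_subtractf)

text \<open>Antisymmetrising in the free indices commutes with the tensor law of
  \<open>pair_trace\<close>. For index lists of any other length or type both sides vanish, since
  the Jacobian preserves types.\<close>

lemma contraction_transform:
  assumes "\<phi> \<in> Omega 2 0 M B" "b \<in> foliated_trivs B" "b' \<in> foliated_trivs B"
    "c \<in> foliated_charts M" "c' \<in> foliated_charts M" "m \<in> fst c \<inter> fst c' \<inter> fst b \<inter> fst b'"
  shows "tr b b' m ** contraction M P K \<phi> b c As (snd c m) ** matrix_inv (tr b b' m) =
    (\<Sum>Cs | length Cs = length As. cscale (\<Prod>i<length As. cjac c c' (snd c m) (Cs ! i) (As ! i))
       (contraction M P K \<phi> b' c' Cs (snd c' m)))"
proof (cases "length As = 2")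
  case False
  then have "contraction M P K \<phi> b c As (snd c m) = 0"
    by (intro contraction_other) auto
  moreover have "contraction M P K \<phi> b' c' Cs (snd c' m) = 0" if "length Cs = length As" for Cs
    using False that by (intro contraction_other) auto
  ultimately show ?thesis
    by (simp add: matrix_ring_simps cscale_simps)
next
  case True
  interpret foliated_change M c c'
    by (simp add: foliated_change_def chart assms)
  let ?p = "snd c m" and ?t = "tr b b' m"
  have pW: "?p \<in> W" using assms(6) by blast
  from True obtain N L where As: "As = [N, L]"
    by (auto simp: length_Suc_conv numeral_2_eq_2)
  let ?Y = "contraction M P K \<phi> b' c'"
  have rhs: "(\<Sum>Cs | length Cs = length As. cscale (\<Prod>i<length As. J ?p (Cs ! i) (As ! i)) (?Y Cs (snd c' m))) =
      (\<Sum>C\<in>UNIV. \<Sum>D\<in>UNIV. cscale (J ?p C N * J ?p D L) (?Y [C, D] (snd c' m)))"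
    unfolding True sum_lists_length_2 by (simp add: As numeral_2_eq_2 lessThan_Suc mult.commute)
  show ?thesis
  proof (cases "isl N \<and> isl L")
    case False
    have zero: "cscale (J ?p C N * J ?p D L) (?Y [C, D] (snd c' m)) = 0" for C D
    proof (cases "isl C \<and> isl D")
      case True
      then show ?thesis
        using False cjac_mixed[OF pW, of C N] cjac_mixed[OF pW, of D L] by (auto simp: cscale_simps)
    next
      case False
      then have "?Y [C, D] (snd c' m) = 0"
        by (intro contraction_other) auto
      then show ?thesis by (simp add: cscale_simps)
    qed
    have "contraction M P K \<phi> b c As ?p = 0"
      using False by (intro contraction_other) (auto simp: As)
    then show ?thesis
      unfolding rhs zero by (simp add: matrix_ring_simps)
  next
    case True
    then obtain \<mu> \<nu> where NL: "N = Hol \<mu>" "L = Hol \<nu>"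
      by (auto simp: isl_def)
    have pD: "?p \<in> Dom b c" and p'D: "snd c' m \<in> Dom b' c'" using assms(6) by auto
    let ?X = "\<lambda>E D. pair_trace \<phi> b' c' E D (snd c' m)"
    have "?t ** contraction M P K \<phi> b c As ?p ** matrix_inv ?t =
        ?t ** pair_trace \<phi> b c N L ?p ** matrix_inv ?t - ?t ** pair_trace \<phi> b c L N ?p ** matrix_inv ?t"
      using contraction_eq[OF assms(1,2,4) pD] by (simp add: As NL matrix_ring_simps)
    also have "\<dots> = (\<Sum>E\<in>UNIV. \<Sum>D\<in>UNIV. cscale (J ?p E N * J ?p D L) (?X E D)) -
        (\<Sum>E\<in>UNIV. \<Sum>D\<in>UNIV. cscale (J ?p E L * J ?p D N) (?X E D))"
      by (simp only: pair_trace_transform[OF assms])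
    also have "(\<Sum>E\<in>UNIV. \<Sum>D\<in>UNIV. cscale (J ?p E L * J ?p D N) (?X E D)) =
        (\<Sum>E\<in>UNIV. \<Sum>D\<in>UNIV. cscale (J ?p E N * J ?p D L) (?X D E))"
      by (subst sum.swap) (simp add: mult.commute)
    also have "(\<Sum>E\<in>UNIV. \<Sum>D\<in>UNIV. cscale (J ?p E N * J ?p D L) (?X E D)) - \<dots> =
        (\<Sum>E\<in>UNIV. \<Sum>D\<in>UNIV. cscale (J ?p E N * J ?p D L) (?X E D - ?X D E))"
      by (simp add: cscale_simps sum_subtractf)
    also have "\<dots> = (\<Sum>E\<in>UNIV. \<Sum>D\<in>UNIV. cscale (J ?p E N * J ?p D L) (?Y [E, D] (snd c' m)))"
      by (simp add: sum_cidx NL cjac_mixed[OF pW] cscale_simps contraction_eq[OF assms(1,3,5) p'D])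
    finally show ?thesis by (simp only: rhs)
  qed
qed

lemma contraction_in_Omega:
  assumes "\<phi> \<in> Omega 2 0 M B"
  shows "contraction M P K \<phi> \<in> Omega 2 0 M B"
proof -
  have type: "contraction M P K \<phi> b c As p = 0"
    if "\<not> (length (filter isl As) = 2 \<and> length (filter (Not \<circ> isl) As) = 0)" for b c As p
    using that by (intro contraction_other) auto
  have anti: "contraction M P K \<phi> b c (As[i := As ! j, j := As ! i]) p = - contraction M P K \<phi> b c As p"
    if "j < length As" "i < j" for b c As p i j
  proof (cases "length As = 2")
    case True
    then obtain C D where "As = [C, D]"
      by (auto simp: length_Suc_conv numeral_2_eq_2)
    moreover have "j = 1" "i = 0" using that True by auto
    ultimately show ?thesis by (simp add: contraction_swap[of _ _ _ D C])
  next
    case False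
    then have "contraction M P K \<phi> b c As p = 0" "contraction M P K \<phi> b c (As[i := As ! j, j := As ! i]) p = 0"
      by (intro contraction_other, metis length_Cons length_list_update list.size(3) numeral_2_eq_2)+
    then show ?thesis by simp
  qed
  show ?thesis
    unfolding Omega_def mem_Collect_eq
  proof (intro conjI ballI allI impI)
    fix b c As assume bc: "b \<in> foliated_trivs B" "c \<in> foliated_charts M"
    show "smooth_on (Dom b c) (contraction M P K \<phi> b c As)" "basic_on (Dom b c) (contraction M P K \<phi> b c As)"
      using contraction_invariant[OF assms bc] by (auto simp: invariant_on_basic)
    fix p assume "p \<in> Dom b c"
    then show "contraction M P K \<phi> b c As p \<in> complex_lie_algebra (grp B)"
      by (rule contraction_in_complex_lie_algebra[OF assms bc])
  next
    fix b b' c c' m As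
    assume "b \<in> foliated_trivs B" "b' \<in> foliated_trivs B" "c \<in> foliated_charts M" "c' \<in> foliated_charts M"
      "m \<in> fst c \<inter> fst c' \<inter> fst b \<inter> fst b'"
    from contraction_transform[OF assms this] show "let t = tr b b' m in
        t ** contraction M P K \<phi> b c As (snd c m) ** matrix_inv t =
          (\<Sum>Cs | length Cs = length As. cscale (\<Prod>i<length As. cjac c c' (snd c m) (Cs ! i) (As ! i))
            (contraction M P K \<phi> b' c' Cs (snd c' m)))"
      by (simp add: Let_def)
  qed (use type anti in auto)
qed

lemma endomorphism_contraction: "endomorphism_of (Omega 2 0 M B) (contraction M P K)"
proof -
  have add: "contraction M P K (\<lambda>b c As p. \<phi> b c As p + \<psi> b c As p) b c As p =
      contraction M P K \<phi> b c As p + contraction M P K \<psi> b c As p" for \<phi> \<psi> b c As p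
  proof (cases "\<exists>\<mu> \<nu>. As = [Hol \<mu>, Hol \<nu>]")
    case True
    then show ?thesis
      by (auto simp: contraction_def bounded_bilinear.add_left[OF bilinear] sum.distrib[symmetric]
          cscale_simps(1)[symmetric] algebra_simps intro!: sum.cong)
  next
    case False
    then have "contraction M P K \<phi> b c As p = 0" for \<phi>
      by (intro contraction_other) blast
    then show ?thesis by simp
  qed
  have scale: "contraction M P K (\<lambda>b c As p. cscale a (\<phi> b c As p)) b c As p =
      cscale a (contraction M P K \<phi> b c As p)" for a \<phi> b c As p
  proof (cases "\<exists>\<mu> \<nu>. As = [Hol \<mu>, Hol \<nu>]")
    case True
    then show ?thesis
      by (auto simp: contraction_def cscale_left cscale_sum_right cscale_simps mult.commute)
  next
    case False
    then have "contraction M P K \<phi> b c As p = 0" for \<phi>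
      by (intro contraction_other) blast
    then show ?thesis by (simp add: cscale_simps)
  qed
  show ?thesis
    unfolding endomorphism_of_def using contraction_in_Omega add scale by (auto intro!: ext)
qed

end

section \<open>The operators \<open>F_op\<close> and \<open>R_op\<close> as instances, and the
  global statement\<close>

lemma conjugate_comm:
  fixes t :: "'r::finite mat"
  assumes "invertible t"
  shows "comm (t ** X ** matrix_inv t) (t ** Y ** matrix_inv t) = t ** comm X Y ** matrix_inv t"
    "(t ** X ** matrix_inv t) ** (t ** Y ** matrix_inv t) = t ** (X ** Y) ** matrix_inv t"
proof -
  have "Z ** matrix_inv t ** t = Z" for Z :: "'r mat"
    by (simp add: matrix_mul_assoc[symmetric] matrix_inv_mult[OF assms])
  then show "comm (t ** X ** matrix_inv t) (t ** Y ** matrix_inv t) = t ** comm X Y ** matrix_inv t"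
    "(t ** X ** matrix_inv t) ** (t ** Y ** matrix_inv t) = t ** (X ** Y) ** matrix_inv t"
    by (simp_all add: comm_def matrix_ring_simps matrix_mul_assoc)
qed

lemma bounded_bilinear_comm: "bounded_bilinear (comm :: 'r::finite mat \<Rightarrow> 'r mat \<Rightarrow> 'r mat)"
  by (intro bilinear_conv_bounded_bilinear[THEN iffD1])
    (auto simp: bilinear_def comm_def matrix_ring_simps scalar_matrix_assoc matrix_scalar_ac algebra_simps
      intro!: linearI)

context sasakian_connection
begin

lemma endomorphism_F: "endomorphism_of (Omega 2 0 M B) (F_op M \<omega>)"
proof -
  interpret tensorial_pairing M B \<omega> comm "\<lambda>b c. curvF (\<omega> b c)"
  proof (intro tensorial_pairing.intro tensorial_pairing_axioms.intro sasakian_connection_axioms)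
    show "bounded_bilinear (comm :: 'r mat \<Rightarrow> 'r mat \<Rightarrow> 'r mat)"
      by (rule bounded_bilinear_comm)
  qed ((rule curvF_transform; assumption) | simp add: comm_simps conjugate_comm invariant_curvF
      complex_lie_algebra_comm group curvF_in_complex_lie_algebra)+
  show ?thesis
    unfolding F_op_eq by (rule endomorphism_contraction)
qed

text \<open>A scalar matrix is fixed by conjugation, so the frame change has no effect and only
  \<open>ricci_change\<close> remains; for index pairs other than an unbarred one followed by a
  barred one, both sides vanish.\<close>

lemma ricci_matrix_transform:
  assumes "b \<in> foliated_trivs B" "b' \<in> foliated_trivs B" "c \<in> foliated_charts M" "c' \<in> foliated_charts M"
    "m \<in> fst c \<inter> fst c' \<inter> fst b \<inter> fst b'"
  shows "tr b b' m ** ricci_matrix M c A D (snd c m) ** matrix_inv (tr b b' m) =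
    (\<Sum>C\<in>UNIV. \<Sum>E\<in>UNIV. cscale (cjac c c' (snd c m) C A * cjac c c' (snd c m) E D)
      (ricci_matrix M c' C E (snd c' m) :: 'r mat))"
proof -
  interpret foliated_change M c c'
    by (simp add: foliated_change_def chart assms)
  have pW: "snd c m \<in> W" using assms(5) by blast
  have fp: "f (snd c m) = snd c' m" using assms(5) by (simp add: change_snd)
  have "invertible (tr b b' m)"
    using transition_invertible[OF assms(1,2)] assms(5) by blast
  then have "tr b b' m ** ricci_matrix M c A D (snd c m) ** matrix_inv (tr b b' m) =
      (ricci_matrix M c A D (snd c m) :: 'r mat)"
    by (simp add: ricci_matrix_def cscale_simps matrix_inv_mult)
  also have "\<dots> = (\<Sum>C\<in>UNIV. \<Sum>E\<in>UNIV. cscale (J (snd c m) C A * J (snd c m) E D) (ricci_matrix M c' C E (snd c' m)))"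
    by (cases A; cases D)
      (simp_all add: ricci_matrix_def sum_cidx cscale_simps cjac_mixed[OF pW] ricci_change[OF pW, unfolded fp]
        cscale_sum_left)
  finally show ?thesis .
qed

lemma endomorphism_R: "endomorphism_of (Omega 2 0 M B) (R_op M)"
proof -
  interpret tensorial_pairing M B \<omega> "(**)" "\<lambda>b c. ricci_matrix M c"
  proof (intro tensorial_pairing.intro tensorial_pairing_axioms.intro sasakian_connection_axioms)
    show "bounded_bilinear ((**) :: 'r mat \<Rightarrow> 'r mat \<Rightarrow> 'r mat)"
      by (rule bounded_bilinear_matrix_mult)
    fix b c A D assume bc: "b \<in> foliated_trivs B" "c \<in> foliated_charts M"
    interpret foliated_chart M c by (rule chart[OF bc(2)])
    have "invariant_on (0, 1) (Dom b c) (ricci M c \<beta> \<mu>)" for \<beta> \<mu>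
      by (rule invariant_on_subset[OF invariant_ricci]) blast
    then show "invariant_on (0, 1) (Dom b c) (ricci_matrix M c A D :: coords \<Rightarrow> 'r mat)"
      unfolding ricci_matrix_def
      by (intro invariant_on_cscale open_dom bc invariant_on_const)
        (cases A; cases D; simp add: invariant_on_const)
  qed ((rule ricci_matrix_transform; assumption) | simp add: cscale_simps conjugate_comm ricci_matrix_def
      complex_lie_algebra_cscale group)+
  show ?thesis
    unfolding R_op_eq by (rule endomorphism_contraction)
qed

lemma laplace_formula:
  assumes \<phi>: "\<phi> \<in> Omega 2 0 M B" and b: "b \<in> foliated_trivs B" and c: "c \<in> foliated_charts M"
    and p: "p \<in> Dom b c"
  shows "laplace M c (\<omega> b c) (\<phi> b c) [Hol \<mu>, Hol \<nu>] p =
          - (\<Sum>\<alpha>\<in>UNIV. \<Sum>\<beta>\<in>UNIV. cscale (gup M c p (Hol \<alpha>) (Bar \<beta>))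
               (nabt M c (\<omega> b c) (nabt M c (\<omega> b c) (\<phi> b c)) [Bar \<beta>, Hol \<alpha>, Hol \<mu>, Hol \<nu>] p))
          - F_op M \<omega> \<phi> b c [Hol \<mu>, Hol \<nu>] p
          - R_op M \<phi> b c [Hol \<mu>, Hol \<nu>] p"
proof -
  interpret foliated_chart M c by (rule chart[OF c])
  interpret chart_connection M c "\<omega> b c" "Dom b c"
  proof
    show "smooth_on (Dom b c) (\<lambda>p. \<omega> b c p v)" for v
      by (rule invariant_on_smooth[OF connection_invariant[OF b c]])
  qed (use open_dom[OF b c] in auto)
  have "invariant_on 0 (Dom b c) (\<phi> b c As)" for As
    using invariant_on_smooth[OF Omega_invariant[OF \<phi> b c]] by (simp add: invariant_on_zero)
  from weitzenboeck[of p "\<phi> b c" \<mu> \<nu>, OF p this Omega_antisym[OF \<phi> b c]] show ?thesis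
    by (simp add: F_op_def R_op_def)
qed

end

theorem proposition3p1:
  fixes M :: "'m::t2_space sasakian_data"
    and B :: "('m, 'e, 'r::finite) bundle_data"
    and \<omega> :: "('m, 'e, 'r) triv \<Rightarrow> 'm chart \<Rightarrow> coords \<Rightarrow> coords \<Rightarrow> 'r mat"
  assumes "compact (UNIV :: 'm set)" and "connected (UNIV :: 'm set)"
    and "sasakian M" and "sasakian_bundle M B" and "\<omega> \<in> connections M B"
  shows "(\<forall>\<phi> \<in> Omega 2 0 M B. \<forall>b \<in> foliated_trivs B. \<forall>c \<in> foliated_charts M.
      \<forall>p \<in> snd c ` (fst c \<inter> fst b). \<forall>\<mu> \<nu>.
        laplace M c (\<omega> b c) (\<phi> b c) [Hol \<mu>, Hol \<nu>] p =
          - (\<Sum>\<alpha>\<in>UNIV. \<Sum>\<beta>\<in>UNIV. cscale (gup M c p (Hol \<alpha>) (Bar \<beta>))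
               (nabt M c (\<omega> b c) (nabt M c (\<omega> b c) (\<phi> b c)) [Bar \<beta>, Hol \<alpha>, Hol \<mu>, Hol \<nu>] p))
          - F_op M \<omega> \<phi> b c [Hol \<mu>, Hol \<nu>] p
          - R_op M \<phi> b c [Hol \<mu>, Hol \<nu>] p)
    \<and> endomorphism_of (Omega 2 0 M B) (F_op M \<omega>)
    \<and> endomorphism_of (Omega 2 0 M B) (R_op M)"
proof -
  interpret sasakian_connection M B \<omega>
    using assms(3-5) by unfold_locales
  show ?thesis
    using laplace_formula endomorphism_F endomorphism_R by blast
qed

end
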